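(* Let $K$ be a compact $n$-dimensional submanifold (with boundary) of $\mathbb{R}^n$ with smooth boundary $\Sigma=\partial K$. Then $$\lim_{\epsilon\downarrow 0}\frac{\mu_n(\mathrm{Tub}_\epsilon\,\Sigma)}{2\epsilon}=\frac{1}{\omega_{n-1}}\int_{u\in\mathbb{S}^{n-1}}\mathcal{V}_{n-1}(\Sigma\,|\,u^\perp)\,dS_u .$$
   Context: $\mu_n$ is $n$-dimensional Lebesgue measure. For $\epsilon>0$, $$\mathrm{Tub}_\epsilon\,\Sigma=\{p+a:\ p\in\Sigma,\ a\in N_p\Sigma,\ |a|<\epsilon\},$$ where $N_p\Sigma$ is the orthogonal complement of the tangent space $T_p\Sigma$ in $\mathbb{R}^n$. $\omega_{n-1}$ is the $(n-1)$-dimensional volume of the unit ball in $\mathbb{R}^{n-1}$; $dS_u$ is the area element of the unit sphere $\mathbb{S}^{n-1}$ at $u$; $u^\perp$ is the linear hyperplane orthogonal to $u$. The weighted projected area of $\Sigma$ along $u\in\mathbb{S}^{n-1}$ onto $u^\perp$ is $$\mathcal{V}_{n-1}(\Sigma\,|\,u^\perp)=\frac12\int_{q\in\Sigma}|u\cdot\tilde n(q)|\,d\Sigma_q ,$$ where $\tilde n(q)$ is the outward unit normal and $d\Sigma_q$ the area element of $\Sigma$ at $q$. *)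

theory Defs
  imports "HOL-Analysis.Analysis"
begin

text \<open>
  Smoothness means \<open>C\<^sup>\<infinity>\<close>. The predicates below are only meant for open \<open>U\<close>, since
  \<open>frechet_derivative f (at x)\<close> is the unrestricted derivative. In finite dimension,
  continuity of all iterated directional derivatives of order at most \<open>k\<close> is the usual
  notion of class \<open>C\<^sup>k\<close>.
\<close>

primrec Ck_on :: "nat \<Rightarrow> 'a::euclidean_space set \<Rightarrow> ('a \<Rightarrow> 'b::euclidean_space) \<Rightarrow> bool" where
  "Ck_on 0 U f \<longleftrightarrow> continuous_on U f"
| "Ck_on (Suc k) U f \<longleftrightarrow>
     f differentiable_on U \<and> (\<forall>v. Ck_on k U (\<lambda>x. frechet_derivative f (at x) v))"

definition smooth_on :: "'a::euclidean_space set \<Rightarrow> ('a \<Rightarrow> 'b::euclidean_space) \<Rightarrow> bool" where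
  "smooth_on U f \<longleftrightarrow> (\<forall>k. Ck_on k U f)"

definition smooth_diffeo ::
    "'a::euclidean_space set \<Rightarrow> 'a set \<Rightarrow> ('a \<Rightarrow> 'a) \<Rightarrow> bool" where
  "smooth_diffeo W V \<psi> \<longleftrightarrow>
     open W \<and> open V \<and> bij_betw \<psi> W V \<and> smooth_on W \<psi> \<and> smooth_on V (inv_into W \<psi>)"

text \<open>
  Submanifolds with boundary of full dimension \<open>DIM('a)\<close>. A boundary point is a point around
  which an ambient diffeomorphism takes \<open>K\<close> to a closed coordinate half-space, the point
  itself going to the bounding hyperplane. The other points have a full neighbourhood in \<open>K\<close>.
\<close>

definition manifold_boundary :: "'a::euclidean_space set \<Rightarrow> 'a set" where
  "manifold_boundary K = {p \<in> K. \<exists>W V \<psi>. \<exists>b\<in>Basis. p \<in> W \<and> smooth_diffeo W V \<psi> \<and>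
     \<psi> ` (W \<inter> K) = V \<inter> {y. y \<bullet> b \<le> 0} \<and> \<psi> p \<bullet> b = 0}"

definition full_dim_submanifold_with_boundary :: "'a::euclidean_space set \<Rightarrow> bool" where
  "full_dim_submanifold_with_boundary K \<longleftrightarrow> (\<forall>p\<in>K. p \<in> interior K \<or> p \<in> manifold_boundary K)"

definition tangent_space :: "'a::euclidean_space set \<Rightarrow> 'a \<Rightarrow> 'a set" where
  "tangent_space S p = {v. \<exists>\<gamma> d. d > 0 \<and> smooth_on {-d<..<d::real} \<gamma> \<and> \<gamma> ` {-d<..<d} \<subseteq> S \<and>
     \<gamma> 0 = p \<and> (\<gamma> has_vector_derivative v) (at 0)}"

definition normal_space :: "'a::euclidean_space set \<Rightarrow> 'a \<Rightarrow> 'a set" where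
  "normal_space S p = orthogonal_comp (tangent_space S p)"

definition Tub :: "real \<Rightarrow> 'a::euclidean_space set \<Rightarrow> 'a set" where
  "Tub \<epsilon> S = {p + a | p a. p \<in> S \<and> a \<in> normal_space S p \<and> norm a < \<epsilon>}"

text \<open>Only meaningful for \<open>q \<in> manifold_boundary K\<close>.\<close>

definition outward_unit_normal :: "'a::euclidean_space set \<Rightarrow> 'a \<Rightarrow> 'a" where
  "outward_unit_normal K q = (THE \<nu>. norm \<nu> = 1 \<and> \<nu> \<in> normal_space (manifold_boundary K) q \<and>
     (\<forall>\<^sub>F t in at_right 0. q + t *\<^sub>R \<nu> \<notin> K))"

text \<open>
  Lebesgue measure of dimension \<open>DIM('a) - 1\<close> on the coordinate hyperplane orthogonal to
  \<open>b \<in> Basis\<close>, built like \<open>lborel\<close> but without the coordinate \<open>b\<close>, and regarded as a Borel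
  measure on the whole space. If \<open>DIM('a) = 1\<close> it is the unit mass at \<open>0\<close>.
\<close>

definition hyperplane_lborel :: "'a::euclidean_space \<Rightarrow> 'a measure" where
  "hyperplane_lborel b =
     distr (\<Pi>\<^sub>M i\<in>Basis - {b}. lborel) borel (\<lambda>f. \<Sum>i\<in>Basis - {b}. f i *\<^sub>R i)"

text \<open>
  The area measure of a smooth hypersurface \<open>S\<close>, regarded as a Borel measure on the whole space:
  it is carried by \<open>S\<close>, and the area of each piece of \<open>S\<close> that is the graph of a smooth
  function over an open subset of a coordinate hyperplane is given by the classical area
  element \<open>sqrt (1 + |grad g|\<^sup>2) dx\<close>. Every smooth hypersurface is locally such a graph, so
  this determines the measure. A smooth function on a relatively open subset of the hyperplane
  is represented by \<open>g\<close> on an open subset \<open>U\<close> of the whole space, of which only the values and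
  the derivatives along the hyperplane matter. If \<open>DIM('a) = 1\<close> the area is the number of points.
\<close>

definition is_area_measure :: "'a::euclidean_space set \<Rightarrow> 'a measure \<Rightarrow> bool" where
  "is_area_measure S \<sigma> \<longleftrightarrow> sets \<sigma> = sets borel \<and> emeasure \<sigma> (- S) = 0 \<and>
     (\<forall>b\<in>Basis. \<forall>U (g :: 'a \<Rightarrow> real).
        open U \<and> smooth_on U g \<and> (\<lambda>x. x + g x *\<^sub>R b) ` (U \<inter> {x. x \<bullet> b = 0}) \<subseteq> S \<longrightarrow>
        emeasure \<sigma> ((\<lambda>x. x + g x *\<^sub>R b) ` (U \<inter> {x. x \<bullet> b = 0})) =
        (\<integral>\<^sup>+x\<in>U \<inter> {x. x \<bullet> b = 0}.
           ennreal (sqrt (1 + (\<Sum>i\<in>Basis - {b}. (frechet_derivative g (at x) i)\<^sup>2)))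
         \<partial>hyperplane_lborel b))"

definition area_measure :: "'a::euclidean_space set \<Rightarrow> 'a measure" where
  "area_measure S = (THE \<sigma>. is_area_measure S \<sigma>)"

text \<open>The weighted projected area of the boundary of \<open>K\<close> along the unit vector \<open>u\<close>.\<close>

definition weighted_projected_area :: "'a::euclidean_space set \<Rightarrow> 'a \<Rightarrow> real" where
  "weighted_projected_area K u =
     1 / 2 * (LINT q:manifold_boundary K|area_measure (manifold_boundary K).
       \<bar>u \<bullet> outward_unit_normal K q\<bar>)"

end

theory Submission
  imports Defs
begin

text \<open>
  Both sides of the formula equal the area of \<open>\<Sigma> = \<partial>K\<close>. The comparison rests on
  first-order estimates and Fubini alone, without a parametrisation of the tube.

  \<^emph>\<open>Tubes.\<close> The segment from a point to a nearest point of \<open>\<Sigma>\<close> is normal to \<open>\<Sigma>\<close>, so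
  \<open>Tub \<epsilon> \<Sigma>\<close> is the set of points at distance less than \<open>\<epsilon>\<close> (\<open>Tub_eq_infdist\<close>). The left-hand
  side is therefore the Minkowski content of \<open>\<Sigma>\<close>. To first order the distance to \<open>\<Sigma>\<close> is the
  distance to the tangent plane (\<open>infdist_level_set\<close>). Write a piece of \<open>\<Sigma>\<close> as the graph of \<open>g\<close>
  over a coordinate hyperplane. A point that lies \<open>\<epsilon> s\<close> above the graph is then at distance about
  \<open>\<epsilon> \<bar>s\<bar> / sqrt (1 + \<bar>grad g\<bar>\<^sup>2)\<close> from \<open>\<Sigma>\<close>, so the tube over \<open>x\<close> is an interval of
  length about \<open>2 \<epsilon> sqrt (1 + \<bar>grad g\<bar>\<^sup>2)\<close>. Fubini and dominated convergence turn this pointwise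
  statement into the convergence of the normalised tube integrals to the integral against the classical
  area element (\<open>tube_mean_tendsto_graph_integral\<close>).

  \<^emph>\<open>The area measure.\<close> The limit of the tube integrals does not mention the graph. Hence the area
  elements of different graphs agree where they overlap, and a partition of unity glues them to one
  measure (\<open>exists_minkowski_measure\<close>). By the implicit function theorem smooth graphs cover \<open>\<Sigma>\<close>, so
  it is the only area measure of \<open>\<Sigma>\<close>, and it has the total mass that the tubes measure
  (\<open>area_measure_minkowski\<close>, \<open>tube_volume_tendsto_area\<close>).

  \<^emph>\<open>Projections.\<close> The outward normal is the normalised gradient of a local defining function; it is
  continuous on \<open>\<Sigma>\<close>, and Fubini moves the integral over directions \<open>u\<close> inside. It remains to see that
  \<open>\<bar>u \<bullet> n\<bar>\<close> integrates over the unit sphere to twice the volume of the unit ball one dimension lower,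
  for every unit vector \<open>n\<close>. As the area of the sphere is also a limit of tube integrals, the integral
  is rotation invariant, and for a basis vector \<open>n\<close> it is computed on thin spherical shells
  (\<open>nn_integral_sphere_abs_inner\<close>).
\<close>

section \<open>Calculus of smooth maps\<close>

lemma Ck_on_subset: "Ck_on k U f \<Longrightarrow> V \<subseteq> U \<Longrightarrow> Ck_on k V f"
proof (induction k arbitrary: f)
  case 0 then show ?case by (auto intro: continuous_on_subset)
next
  case (Suc k) then show ?case by (auto intro: differentiable_on_subset)
qed

lemma smooth_on_subset: "smooth_on U f \<Longrightarrow> V \<subseteq> U \<Longrightarrow> smooth_on V f"
  unfolding smooth_on_def using Ck_on_subset by blast

lemma Ck_on_lower: "Ck_on (Suc k) U f \<Longrightarrow> Ck_on k U f"
proof (induction k arbitrary: f)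
  case 0 then show ?case by (auto intro: differentiable_imp_continuous_on)
next
  case (Suc k)
  then show ?case by (auto simp del: Ck_on.simps simp: Ck_on.simps(2)[of "Suc k"] Ck_on.simps(2)[of k])
qed

lemma Ck_on_imp_differentiable:
  assumes "Ck_on (Suc k) U f" "open U" "x \<in> U"
  shows "(f has_derivative frechet_derivative f (at x)) (at x)"
  using assms by (auto simp: differentiable_on_eq_differentiable_at frechet_derivative_works)

lemma Ck_on_imp_continuous: "Ck_on k U f \<Longrightarrow> continuous_on U f"
  by (cases k) (auto intro: differentiable_imp_continuous_on)

lemma Ck_on_cong:
  assumes "open U" "\<And>x. x \<in> U \<Longrightarrow> f x = g x"
  shows "Ck_on k U f \<longleftrightarrow> Ck_on k U g"
  using assms
proof (induction k arbitrary: f g)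
  case 0 then show ?case by (auto intro!: continuous_on_cong)
next
  case (Suc k)
  have d: "(f has_derivative D) (at x) \<longleftrightarrow> (g has_derivative D) (at x)" if "x \<in> U" for x D
    using has_derivative_transform_within_open[OF _ Suc.prems(1) that, of f D UNIV g]
      has_derivative_transform_within_open[OF _ Suc.prems(1) that, of g D UNIV f] Suc.prems(2)
    by auto
  have "f differentiable_on U \<longleftrightarrow> g differentiable_on U"
    using d by (auto simp: differentiable_on_eq_differentiable_at[OF \<open>open U\<close>] differentiable_def)
  moreover have "frechet_derivative f (at x) = frechet_derivative g (at x)" if "x \<in> U" for x
    unfolding frechet_derivative_def using d[OF that] by simp
  then have "Ck_on k U (\<lambda>x. frechet_derivative f (at x) v) \<longleftrightarrow>
      Ck_on k U (\<lambda>x. frechet_derivative g (at x) v)" for v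
    by (intro Suc.IH) (auto simp: Suc.prems)
  ultimately show ?case by simp
qed

text \<open>The form in which differentiability classes are climbed: exhibit a derivative whose
  directional values are one class lower.\<close>

lemma Ck_on_SucI:
  assumes "open U" "\<And>x. x \<in> U \<Longrightarrow> (f has_derivative D x) (at x)"
    and "\<And>v. Ck_on k U (\<lambda>x. D x v)"
  shows "Ck_on (Suc k) U f"
proof -
  have "frechet_derivative f (at x) = D x" if "x \<in> U" for x
    using assms(2)[OF that] frechet_derivative_at by metis
  then have "Ck_on k U (\<lambda>x. frechet_derivative f (at x) v) \<longleftrightarrow> Ck_on k U (\<lambda>x. D x v)" for v
    by (intro Ck_on_cong) (auto simp: assms)
  then show ?thesis
    using assms by (auto simp: differentiable_on_eq_differentiable_at differentiable_def)
qed

lemma Ck_on_const: "open U \<Longrightarrow> Ck_on k U (\<lambda>x. c)"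
proof (induction k arbitrary: c)
  case (Suc k) then show ?case by (intro Ck_on_SucI[where D="\<lambda>x v. 0"]) auto
qed auto

lemma Ck_on_linear:
  assumes "open U" "bounded_linear f" shows "Ck_on k U f"
proof (cases k)
  case 0 then show ?thesis using assms by (auto intro: linear_continuous_on)
next
  case (Suc m)
  show ?thesis unfolding Suc
    by (rule Ck_on_SucI[where D="\<lambda>x. f"])
      (auto simp: assms Ck_on_const bounded_linear_imp_has_derivative)
qed

lemma Ck_on_add:
  "open U \<Longrightarrow> Ck_on k U f \<Longrightarrow> Ck_on k U g \<Longrightarrow> Ck_on k U (\<lambda>x. f x + g x)"
proof (induction k arbitrary: f g)
  case (Suc k)
  show ?case
  proof (rule Ck_on_SucI[where D="\<lambda>x v. frechet_derivative f (at x) v + frechet_derivative g (at x) v"])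
    show "Ck_on k U (\<lambda>x. frechet_derivative f (at x) v + frechet_derivative g (at x) v)" for v
      using Suc.prems by (intro Suc.IH) auto
  qed (use Suc.prems in \<open>auto intro!: has_derivative_add Ck_on_imp_differentiable simp del: Ck_on.simps\<close>)
qed (auto intro: continuous_on_add)

lemma Ck_on_sum:
  "open U \<Longrightarrow> (\<And>i. i \<in> I \<Longrightarrow> Ck_on k U (f i)) \<Longrightarrow> Ck_on k U (\<lambda>x. \<Sum>i\<in>I. f i x)"
  by (induction I rule: infinite_finite_induct) (auto intro: Ck_on_const Ck_on_add)

lemma Ck_on_inner_left:
  "open U \<Longrightarrow> Ck_on k U f \<Longrightarrow> Ck_on k U (\<lambda>x. f x \<bullet> c)"
proof (induction k arbitrary: f)
  case (Suc k)
  show ?case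
  proof (rule Ck_on_SucI[where D="\<lambda>x v. frechet_derivative f (at x) v \<bullet> c"])
    show "Ck_on k U (\<lambda>x. frechet_derivative f (at x) v \<bullet> c)" for v
      using Suc.prems by (intro Suc.IH) auto
  qed (use Suc.prems in \<open>auto intro!: has_derivative_inner_left Ck_on_imp_differentiable simp del: Ck_on.simps\<close>)
qed (auto intro: continuous_on_inner)

lemma Ck_on_scaleR:
  fixes f :: "'a::euclidean_space \<Rightarrow> real" and g :: "'a \<Rightarrow> 'b::euclidean_space"
  shows "open U \<Longrightarrow> Ck_on k U f \<Longrightarrow> Ck_on k U g \<Longrightarrow> Ck_on k U (\<lambda>x. f x *\<^sub>R g x)"
proof (induction k arbitrary: f g)
  case (Suc k)
  show ?case
  proof (rule Ck_on_SucI[where D="\<lambda>x v. f x *\<^sub>R frechet_derivative g (at x) v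
        + frechet_derivative f (at x) v *\<^sub>R g x"])
    show "Ck_on k U (\<lambda>x. f x *\<^sub>R frechet_derivative g (at x) v
        + frechet_derivative f (at x) v *\<^sub>R g x)" for v
      using Suc.prems Ck_on_lower[OF Suc.prems(2)] Ck_on_lower[OF Suc.prems(3)]
      by (intro Ck_on_add Suc.IH) auto
  qed (use Suc.prems in \<open>auto intro!: has_derivative_scaleR Ck_on_imp_differentiable simp del: Ck_on.simps\<close>)
qed (auto intro: continuous_on_scaleR)

lemma Ck_on_mult:
  fixes f g :: "'a::euclidean_space \<Rightarrow> real"
  shows "open U \<Longrightarrow> Ck_on k U f \<Longrightarrow> Ck_on k U g \<Longrightarrow> Ck_on k U (\<lambda>x. f x * g x)"
  using Ck_on_scaleR[of U k f g] by simp

lemma Ck_on_inverse: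
  fixes f :: "'a::euclidean_space \<Rightarrow> real"
  shows "open U \<Longrightarrow> (\<And>x. x \<in> U \<Longrightarrow> f x \<noteq> 0) \<Longrightarrow> Ck_on k U f \<Longrightarrow> Ck_on k U (\<lambda>x. inverse (f x))"
proof (induction k)
  case (Suc k)
  have inv: "Ck_on k U (\<lambda>x. inverse (f x))"
    using Suc.prems by (intro Suc.IH) (auto intro: Ck_on_lower simp del: Ck_on.simps)
  show ?case
  proof (rule Ck_on_SucI[where D="\<lambda>x v. - (inverse (f x) * frechet_derivative f (at x) v * inverse (f x))"])
    have "Ck_on k U (\<lambda>x. (-1) * (inverse (f x) * frechet_derivative f (at x) v * inverse (f x)))" for v
      using Suc.prems inv by (intro Ck_on_mult Ck_on_const) auto
    then show "Ck_on k U (\<lambda>x. - (inverse (f x) * frechet_derivative f (at x) v * inverse (f x)))" for v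
      by simp
    show "((\<lambda>x. inverse (f x)) has_derivative
        (\<lambda>v. - (inverse (f x) * frechet_derivative f (at x) v * inverse (f x)))) (at x)" if "x \<in> U" for x
      using Suc.prems that by (intro Deriv.has_derivative_inverse Ck_on_imp_differentiable) auto
  qed (use Suc.prems in auto)
qed (auto intro: continuous_on_inverse)

text \<open>By the chain rule the derivative of the composition is a sum of products of \<open>f' \<circ> h\<close> and \<open>h'\<close>,
  both one class lower, and the induction hypothesis applies to \<open>f' \<circ> h\<close>.\<close>

lemma Ck_on_compose:
  fixes h :: "'a::euclidean_space \<Rightarrow> 'b::euclidean_space"
    and f :: "'b \<Rightarrow> 'c::euclidean_space"
  shows "open U \<Longrightarrow> open V \<Longrightarrow> h ` U \<subseteq> V \<Longrightarrow> Ck_on k U h \<Longrightarrow> Ck_on k V f \<Longrightarrow>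
    Ck_on k U (\<lambda>x. f (h x))"
proof (induction k arbitrary: f)
  case 0 then show ?case by (auto intro: continuous_on_compose2)
next
  case (Suc k)
  define df where "df y = frechet_derivative f (at y)" for y
  define dh where "dh x = frechet_derivative h (at x)" for x
  have derf: "(f has_derivative df y) (at y)" if "y \<in> V" for y
    unfolding df_def using Suc.prems that by (intro Ck_on_imp_differentiable)
  have derh: "(h has_derivative dh x) (at x)" if "x \<in> U" for x
    unfolding dh_def using Suc.prems that by (intro Ck_on_imp_differentiable)
  have lower: "Ck_on k U h" "Ck_on k V f"
    using Suc.prems Ck_on_lower by blast+
  show ?case
  proof (rule Ck_on_SucI[OF \<open>open U\<close>])
    fix x assume "x \<in> U"
    then have "h x \<in> V" using Suc.prems by auto
    have lin: "linear (df (h x))"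
      using derf[OF \<open>h x \<in> V\<close>] has_derivative_linear by blast
    \<comment> \<open>The chain rule in coordinates, where every factor is scalar or a lower composition.\<close>
    have "df (h x) (dh x v) = (\<Sum>i\<in>Basis. (dh x v \<bullet> i) *\<^sub>R df (h x) i)" for v
      by (subst euclidean_representation[symmetric, of "dh x v"])
        (simp add: linear_sum[OF lin] linear_scale[OF lin] del: euclidean_representation)
    with has_derivative_compose[OF derh[OF \<open>x \<in> U\<close>] derf[OF \<open>h x \<in> V\<close>]]
    show "((\<lambda>x. f (h x)) has_derivative (\<lambda>v. \<Sum>i\<in>Basis. (dh x v \<bullet> i) *\<^sub>R df (h x) i)) (at x)"
      by simp
  next
    fix v
    have "Ck_on k U (\<lambda>x. dh x v \<bullet> i)" for i
      using Suc.prems by (intro Ck_on_inner_left) (auto simp: dh_def)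
    moreover have "Ck_on k V (\<lambda>y. df y i)" for i
      using Suc.prems by (auto simp: df_def)
    ultimately show "Ck_on k U (\<lambda>x. \<Sum>i\<in>Basis. (dh x v \<bullet> i) *\<^sub>R df (h x) i)"
      using Suc.prems lower by (intro Ck_on_sum Ck_on_scaleR Suc.IH) auto
  qed
qed

lemma smooth_on_compose:
  fixes h :: "'a::euclidean_space \<Rightarrow> 'b::euclidean_space"
    and f :: "'b \<Rightarrow> 'c::euclidean_space"
  assumes "open U" "open V" "h ` U \<subseteq> V" "smooth_on U h" "smooth_on V f"
  shows "smooth_on U (\<lambda>x. f (h x))"
  using assms unfolding smooth_on_def by (blast intro: Ck_on_compose)

lemma smooth_on_has_derivative:
  assumes "smooth_on U f" "open U" "x \<in> U"
  shows "(f has_derivative frechet_derivative f (at x)) (at x)"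
  using assms Ck_on_imp_differentiable[of 0] unfolding smooth_on_def by blast

lemma smooth_on_continuous_derivative:
  assumes "smooth_on U f"
  shows "continuous_on U (\<lambda>x. frechet_derivative f (at x) v)"
proof -
  have "Ck_on (Suc 0) U f" using assms unfolding smooth_on_def by blast
  then show ?thesis by simp
qed

lemma smooth_on_continuous: "smooth_on U f \<Longrightarrow> continuous_on U f"
  unfolding smooth_on_def using Ck_on_imp_continuous by blast

text \<open>Continuous partial derivatives are bounded on a compact ball; the mean value theorem on the convex
  ball turns the bound into a Lipschitz constant.\<close>

lemma smooth_on_locally_lipschitz:
  fixes g :: "'a::euclidean_space \<Rightarrow> real"
  assumes "smooth_on U g" "open U" "p \<in> U"
  obtains r L where "r > 0" "ball p r \<subseteq> U" "0 \<le> L"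
    "\<And>x y. x \<in> ball p r \<Longrightarrow> y \<in> ball p r \<Longrightarrow> \<bar>g x - g y\<bar> \<le> L * norm (x - y)"
proof -
  obtain r where r: "r > 0" "cball p r \<subseteq> U"
    using assms open_contains_cball by blast
  let ?D = "\<lambda>x. frechet_derivative g (at x)"
  have "\<exists>B. \<forall>x\<in>cball p r. \<bar>?D x i\<bar> \<le> B" for i
  proof -
    have "continuous_on (cball p r) (\<lambda>x. ?D x i)"
      using smooth_on_continuous_derivative[OF assms(1)] r continuous_on_subset by blast
    then have "bounded ((\<lambda>x. ?D x i) ` cball p r)"
      by (intro compact_imp_bounded compact_continuous_image) auto
    then show ?thesis by (auto simp: bounded_iff)
  qed
  then obtain B where B: "\<And>i x. x \<in> cball p r \<Longrightarrow> \<bar>?D x i\<bar> \<le> B i" by metis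
  have lin: "linear (?D x)" if "x \<in> cball p r" for x
    using smooth_on_has_derivative[OF assms(1,2)] r that has_derivative_linear by blast
  have on: "onorm (?D x) \<le> (\<Sum>i\<in>Basis. B i)" if "x \<in> ball p r" for x
  proof (rule onorm_le)
    fix v
    have "?D x v = (\<Sum>i\<in>Basis. (v \<bullet> i) * ?D x i)"
      using lin[of x] that
      by (subst euclidean_representation[symmetric, of v])
        (simp add: linear_sum linear_scale del: euclidean_representation)
    also have "\<bar>\<dots>\<bar> \<le> (\<Sum>i\<in>Basis. norm v * B i)"
      using B that Basis_le_norm
      by (intro order.trans[OF sum_abs] sum_mono) (auto simp: abs_mult intro!: mult_mono)
    finally show "norm (?D x v) \<le> (\<Sum>i\<in>Basis. B i) * norm v"
      by (simp add: sum_distrib_left mult.commute)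
  qed
  show thesis
  proof (rule that[OF r(1), of "\<Sum>i\<in>Basis. B i"])
    show "ball p r \<subseteq> U" using r by auto
    show "0 \<le> (\<Sum>i\<in>Basis. B i)"
    proof (rule sum_nonneg)
      fix i :: 'a
      have "\<bar>?D p i\<bar> \<le> B i" using B r(1) by simp
      then show "0 \<le> B i" by linarith
    qed
    show "\<bar>g x - g y\<bar> \<le> (\<Sum>i\<in>Basis. B i) * norm (x - y)" if "x \<in> ball p r" "y \<in> ball p r" for x y
    proof -
      have "(g has_derivative ?D z) (at z within ball p r)" if "z \<in> ball p r" for z
        using smooth_on_has_derivative[OF assms(1,2), of z] r that has_derivative_at_withinI
        by (meson ball_subset_cball subset_iff)
      then have "norm (g x - g y) \<le> (\<Sum>i\<in>Basis. B i) * norm (x - y)"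
        by (rule differentiable_bound[OF convex_ball _ on that(1) that(2)])
      then show ?thesis by simp
    qed
  qed
qed

section \<open>The distance to a hypersurface to first order\<close>

text \<open>Only first-order information is used: the defining function is almost affine near \<open>p\<close>, so a
  nearest point cannot beat the distance to the tangent plane by much, and by the intermediate
  value theorem a short segment across the tangent plane does meet the hypersurface.\<close>

lemma infdist_level_set:
  fixes F :: "'a::euclidean_space \<Rightarrow> real"
  assumes "closed S" "open W" "p \<in> S" "p \<in> W" and SW: "S \<inter> W = {x\<in>W. F x = 0}"
    and cont: "continuous_on W F" and der: "(F has_derivative (\<lambda>v. N \<bullet> v)) (at p)" and "N \<noteq> 0"
  shows "((\<lambda>\<epsilon>. infdist (p + \<epsilon> *\<^sub>R v) S / \<epsilon>) \<longlongrightarrow> \<bar>N \<bullet> v\<bar> / norm N) (at_right 0)"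
proof (rule tendstoI)
  fix e :: real assume "e > 0"
  have "F p = 0" using assms by auto
  \<comment> \<open>\<open>w\<close> is the tangential part of \<open>v\<close>. The zero of \<open>F\<close> is sought on the segment
    \<open>p + \<epsilon> (w + s N)\<close>, \<open>\<bar>s\<bar> \<le> h\<close>, which stays within \<open>\<epsilon> R\<close> of \<open>p\<close>.\<close>
  define w where "w = v - ((N \<bullet> v) / (norm N)\<^sup>2) *\<^sub>R N"
  have Nw: "N \<bullet> w = 0" using \<open>N \<noteq> 0\<close> by (simp add: w_def inner_diff_right power2_norm_eq_inner)
  have N: "norm N > 0" using \<open>N \<noteq> 0\<close> by simp
  define h where "h = e / (2 * norm N)"
  define R where "R = norm w + h * norm N"
  have "h > 0" using N \<open>e > 0\<close> by (simp add: h_def)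
  have "R > 0" unfolding R_def using \<open>h > 0\<close> N by (simp add: add_nonneg_pos)
  \<comment> \<open>\<open>\<kappa>\<close> is the relative error allowed in the affine approximation. The first bound makes \<open>F\<close>
    change sign along the segment, the second keeps the loss in the lower estimate below \<open>e\<close>.\<close>
  define \<kappa> where "\<kappa> = min (h * (norm N)\<^sup>2 / R) (e * norm N / (4 * norm v + 1))"
  have "\<kappa> > 0" using \<open>h > 0\<close> \<open>R > 0\<close> \<open>e > 0\<close> N by (simp add: \<kappa>_def add_nonneg_pos)
  have \<kappa>1: "\<kappa> * R \<le> h * (norm N)\<^sup>2"
    using mult_right_mono[of \<kappa> "h * (norm N)\<^sup>2 / R" R] \<open>R > 0\<close> by (simp add: \<kappa>_def)
  have v1: "4 * norm v + 1 > 0" by (simp add: add_nonneg_pos)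
  have "\<kappa> \<le> e * norm N / (4 * norm v + 1)" by (simp add: \<kappa>_def)
  then have "\<kappa> * (4 * norm v + 1) \<le> e * norm N"
    using v1 by (simp add: pos_le_divide_eq)
  then have \<kappa>2: "4 * \<kappa> * norm v < e * norm N" using \<open>\<kappa> > 0\<close> by (simp add: algebra_simps)
  obtain d0 where d0: "d0 > 0"
      "\<And>y. norm (y - p) < d0 \<Longrightarrow> \<bar>F y - F p - N \<bullet> (y - p)\<bar> \<le> \<kappa> * norm (y - p)"
    using der \<open>\<kappa> > 0\<close> unfolding has_derivative_at_alt by (metis real_norm_def)
  obtain d1 where d1: "d1 > 0" "ball p d1 \<subseteq> W" using assms openE by blast
  define d where "d = min d0 d1"
  have "d > 0" using d0 d1 by (simp add: d_def)
  have near: "\<bar>F y - N \<bullet> (y - p)\<bar> \<le> \<kappa> * norm (y - p)" "y \<in> W" if "norm (y - p) < d" for y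
    using d0(2)[of y] d1 that \<open>F p = 0\<close> by (auto simp: d_def dist_norm norm_minus_commute subset_iff)
  have "0 < d / (2 * norm v + R)"
    using \<open>d > 0\<close> \<open>R > 0\<close> by (simp add: add_nonneg_pos)
  then have "\<forall>\<^sub>F \<epsilon> in at_right 0. \<epsilon> \<in> {0<..<d / (2 * norm v + R)}"
    by (rule eventually_at_right_real)
  then show "\<forall>\<^sub>F \<epsilon> in at_right 0. dist (infdist (p + \<epsilon> *\<^sub>R v) S / \<epsilon>) (\<bar>N \<bullet> v\<bar> / norm N) < e"
  proof eventually_elim
    fix \<epsilon> :: real assume "\<epsilon> \<in> {0<..<d / (2 * norm v + R)}"
    then have \<epsilon>: "\<epsilon> > 0" and "\<epsilon> < d / (2 * norm v + R)" by auto
    then have sm: "\<epsilon> * (2 * norm v + R) < d"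
      using \<open>R > 0\<close> by (simp add: pos_less_divide_eq add_nonneg_pos)
    have sm1: "2 * \<epsilon> * norm v < d" "\<epsilon> * R < d"
    proof -
      have "0 < \<epsilon> * R" "0 \<le> \<epsilon> * (2 * norm v)" using \<epsilon> \<open>R > 0\<close> by auto
      then show "2 * \<epsilon> * norm v < d" "\<epsilon> * R < d" using sm by (auto simp: distrib_left)
    qed
    let ?x = "p + \<epsilon> *\<^sub>R v" and ?I = "infdist (p + \<epsilon> *\<^sub>R v) S"
    obtain q where q: "q \<in> S" "?I = dist ?x q"
      using infdist_attains_inf[OF \<open>closed S\<close>, of ?x] \<open>p \<in> S\<close> by auto
    have "?I \<le> \<epsilon> * norm v"
      using infdist_le[OF \<open>p \<in> S\<close>, of ?x] \<epsilon> by (simp add: dist_norm)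
    then have "norm (q - p) \<le> 2 * \<epsilon> * norm v"
      using q norm_triangle_ineq[of "q - ?x" "\<epsilon> *\<^sub>R v"] \<epsilon>
      by (simp add: dist_norm norm_minus_commute algebra_simps)
    then have "\<bar>N \<bullet> (q - p)\<bar> \<le> \<kappa> * (2 * \<epsilon> * norm v)"
    proof -
      have "q \<in> W" "norm (q - p) < d"
        using near(2)[of q] \<open>norm (q - p) \<le> _\<close> sm1 by auto
      moreover from this have "F q = 0" using SW q(1) by blast
      ultimately have "\<bar>N \<bullet> (q - p)\<bar> \<le> \<kappa> * norm (q - p)"
        using near(1)[of q] \<open>F q = 0\<close> by simp
      also have "\<dots> \<le> \<kappa> * (2 * \<epsilon> * norm v)"
        using \<open>norm (q - p) \<le> _\<close> \<open>\<kappa> > 0\<close> by simp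
      finally show ?thesis .
    qed
    moreover have "\<epsilon> * (N \<bullet> v) = N \<bullet> (?x - q) + N \<bullet> (q - p)"
      by (simp add: inner_diff_right inner_add_right)
    moreover have "\<bar>N \<bullet> (?x - q)\<bar> \<le> norm N * ?I"
      using Cauchy_Schwarz_ineq2[of N "?x - q"] q by (simp add: dist_norm)
    ultimately have "\<epsilon> * \<bar>N \<bullet> v\<bar> \<le> norm N * ?I + 2 * \<kappa> * \<epsilon> * norm v"
    proof -
      have "\<epsilon> * \<bar>N \<bullet> v\<bar> = \<bar>\<epsilon> * (N \<bullet> v)\<bar>" using \<epsilon> by (simp add: abs_mult)
      with \<open>\<epsilon> * (N \<bullet> v) = _\<close> \<open>\<bar>N \<bullet> (q - p)\<bar> \<le> _\<close> \<open>\<bar>N \<bullet> (?x - q)\<bar> \<le> _\<close>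
      show ?thesis by (simp add: mult_ac)
    qed
    also have "\<dots> < norm N * ?I + \<epsilon> * (e * norm N)"
    proof -
      have "2 * \<kappa> * \<epsilon> * norm v \<le> \<epsilon> * (4 * \<kappa> * norm v)" using \<epsilon> \<open>\<kappa> > 0\<close> by simp
      then show ?thesis using mult_strict_left_mono[OF \<kappa>2 \<epsilon>] by linarith
    qed
    finally have *: "\<epsilon> * \<bar>N \<bullet> v\<bar> < norm N * ?I + \<epsilon> * (e * norm N)" .
    have lower: "\<bar>N \<bullet> v\<bar> / norm N - e < ?I / \<epsilon>"
    proof -
      have "norm N * (\<epsilon> * (\<bar>N \<bullet> v\<bar> / norm N - e)) = \<epsilon> * \<bar>N \<bullet> v\<bar> - \<epsilon> * (e * norm N)"
        using N by (simp add: right_diff_distrib)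
      with * have "norm N * (\<epsilon> * (\<bar>N \<bullet> v\<bar> / norm N - e)) < norm N * ?I" by linarith
      then show ?thesis using N \<epsilon> by (simp add: pos_less_divide_eq mult.commute)
    qed
    define y where "y s = p + \<epsilon> *\<^sub>R (w + s *\<^sub>R N)" for s
    have yd: "norm (y s - p) \<le> \<epsilon> * R" if "\<bar>s\<bar> \<le> h" for s
    proof -
      have "norm (w + s *\<^sub>R N) \<le> norm w + \<bar>s\<bar> * norm N"
        using norm_triangle_ineq[of w "s *\<^sub>R N"] by simp
      also have "\<dots> \<le> R" unfolding R_def using that by (simp add: mult_right_mono)
      finally show ?thesis using \<epsilon> by (simp add: y_def)
    qed
    have Fy: "\<bar>F (y s) - \<epsilon> * s * (norm N)\<^sup>2\<bar> \<le> \<epsilon> * (h * (norm N)\<^sup>2)" if "\<bar>s\<bar> \<le> h" for s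
    proof -
      have "N \<bullet> (y s - p) = \<epsilon> * s * (norm N)\<^sup>2"
        by (simp add: y_def inner_add_right Nw power2_norm_eq_inner)
      then have "\<bar>F (y s) - \<epsilon> * s * (norm N)\<^sup>2\<bar> \<le> \<kappa> * norm (y s - p)"
        using near(1)[of "y s"] yd[OF that] sm1 by simp
      also have "\<dots> \<le> \<kappa> * (\<epsilon> * R)" using yd[OF that] \<open>\<kappa> > 0\<close> by simp
      also have "\<dots> \<le> \<epsilon> * (h * (norm N)\<^sup>2)"
        using mult_left_mono[OF \<kappa>1, of \<epsilon>] \<epsilon> by (simp add: algebra_simps)
      finally show ?thesis .
    qed
    have "continuous_on {-h..h} (\<lambda>s. F (y s))"
    proof (rule continuous_on_compose2[OF cont])
      show "continuous_on {-h..h} y" unfolding y_def by (intro continuous_intros)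
      show "y ` {-h..h} \<subseteq> W" using near(2) yd sm1 by (smt (verit) atLeastAtMost_iff image_subset_iff)
    qed
    moreover have "F (y (-h)) \<le> 0" "0 \<le> F (y h)"
      using Fy[of h] Fy[of "-h"] \<open>h > 0\<close> by (auto simp: algebra_simps)
    ultimately obtain s where s: "-h \<le> s" "s \<le> h" "F (y s) = 0"
      using IVT'[of "\<lambda>s. F (y s)" "-h" 0 h] \<open>h > 0\<close> by force
    have "y s \<in> W" using s yd[of s] sm1 by (intro near(2)) linarith
    then have "y s \<in> S" using s(3) SW by blast
    then have "?I \<le> dist ?x (y s)" by (rule infdist_le)
    also have "?x - y s = (\<epsilon> * ((N \<bullet> v) / (norm N)\<^sup>2 - s)) *\<^sub>R N"
      by (simp add: y_def w_def algebra_simps)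
    then have "dist ?x (y s) = \<epsilon> * (\<bar>(N \<bullet> v) / (norm N)\<^sup>2 - s\<bar> * norm N)"
      using \<epsilon> by (simp add: dist_norm abs_mult)
    also have "\<bar>(N \<bullet> v) / (norm N)\<^sup>2 - s\<bar> * norm N \<le> (\<bar>N \<bullet> v\<bar> / (norm N)\<^sup>2 + h) * norm N"
    proof (rule mult_right_mono)
      have "\<bar>(N \<bullet> v) / (norm N)\<^sup>2\<bar> = \<bar>N \<bullet> v\<bar> / (norm N)\<^sup>2" by simp
      then show "\<bar>(N \<bullet> v) / (norm N)\<^sup>2 - s\<bar> \<le> \<bar>N \<bullet> v\<bar> / (norm N)\<^sup>2 + h"
        using s by linarith
    qed simp
    also have "\<dots> = \<bar>N \<bullet> v\<bar> / norm N + e / 2"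
      using N by (simp add: h_def power2_eq_square distrib_right)
    finally have "?I / \<epsilon> \<le> \<bar>N \<bullet> v\<bar> / norm N + e / 2"
      using \<epsilon> by (simp add: pos_divide_le_eq mult.commute)
    with lower \<open>e > 0\<close> show "dist (?I / \<epsilon>) (\<bar>N \<bullet> v\<bar> / norm N) < e"
      by (auto simp: dist_real_def)
  qed
qed

section \<open>Smooth hypersurfaces and graphs over coordinate hyperplanes\<close>

text \<open>The derivative is required to be nonzero at \<open>p\<close> alone because \<open>F\<close> may depend on \<open>p\<close>; by
  continuity it is then nonzero near \<open>p\<close>.\<close>

definition smooth_hypersurface :: "'a::euclidean_space set \<Rightarrow> bool" where
  "smooth_hypersurface S \<longleftrightarrow> (\<forall>p\<in>S. \<exists>W (F::'a \<Rightarrow> real). open W \<and> p \<in> W \<and> smooth_on W F \<and>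
     S \<inter> W = {x\<in>W. F x = 0} \<and> (\<exists>v. frechet_derivative F (at p) v \<noteq> 0))"

definition hyperplane_proj :: "'a::euclidean_space \<Rightarrow> 'a \<Rightarrow> 'a" where
  "hyperplane_proj b x = x - (x \<bullet> b) *\<^sub>R b"

lemma hyperplane_proj_orth [simp]: "b \<in> Basis \<Longrightarrow> hyperplane_proj b x \<bullet> b = 0"
  by (simp add: hyperplane_proj_def inner_diff_left)

lemma hyperplane_proj_id: "x \<bullet> b = 0 \<Longrightarrow> hyperplane_proj b x = x"
  by (simp add: hyperplane_proj_def)

lemma hyperplane_proj_split: "hyperplane_proj b x + (x \<bullet> b) *\<^sub>R b = x"
  by (simp add: hyperplane_proj_def)

lemma hyperplane_proj_lift [simp]:
  "b \<in> Basis \<Longrightarrow> hyperplane_proj b (x + t *\<^sub>R b) = hyperplane_proj b x"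
  by (simp add: hyperplane_proj_def inner_add_left algebra_simps)

lemma bounded_linear_hyperplane_proj: "bounded_linear (hyperplane_proj b)"
  unfolding hyperplane_proj_def
  by (intro bounded_linear_intros)

lemma hyperplane_proj_diff: "hyperplane_proj b (x - y) = hyperplane_proj b x - hyperplane_proj b y"
  by (simp add: hyperplane_proj_def inner_diff_left algebra_simps)

lemma continuous_on_hyperplane_proj: "continuous_on A (hyperplane_proj b)"
  using bounded_linear_hyperplane_proj by (rule linear_continuous_on)

lemma norm_hyperplane_proj_le:
  assumes "b \<in> Basis" shows "norm (hyperplane_proj b x) \<le> norm x"
proof -
  have "(norm (hyperplane_proj b x))\<^sup>2 = (norm x)\<^sup>2 - (x \<bullet> b)\<^sup>2"
    using assms unfolding power2_norm_eq_inner hyperplane_proj_def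
    by (simp add: inner_diff_left inner_diff_right inner_commute power2_eq_square)
  then have "(norm (hyperplane_proj b x))\<^sup>2 \<le> (norm x)\<^sup>2" by simp
  then show ?thesis by (rule power2_le_imp_le) simp
qed

lemma hyperplane_proj_representation:
  fixes b :: "'a::euclidean_space"
  assumes "b \<in> Basis"
  shows "hyperplane_proj b x = (\<Sum>i\<in>Basis - {b}. (x \<bullet> i) *\<^sub>R i)"
  using assms euclidean_representation[of x]
  by (simp add: hyperplane_proj_def sum.remove[of Basis b] algebra_simps)

text \<open>Implicit function theorem: where a partial derivative of the defining function is nonzero, the
  inverse function theorem for \<open>y \<mapsto> proj y + F y b\<close> gives the graph function, and
  differentiating \<open>F (x + g x b) = 0\<close> expresses its derivative through \<open>g\<close> itself, so smoothness
  propagates from class to class.\<close>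

lemma smooth_hypersurface_local_graph:
  fixes S :: "'a::euclidean_space set"
  assumes "smooth_hypersurface S" "p \<in> S"
  obtains b U and g :: "'a \<Rightarrow> real" where "b \<in> Basis" "open U" "smooth_on U g"
    "(\<lambda>x. x + g x *\<^sub>R b) ` (U \<inter> {x. x \<bullet> b = 0}) \<subseteq> S"
    "p \<in> (\<lambda>x. x + g x *\<^sub>R b) ` (U \<inter> {x. x \<bullet> b = 0})"
proof -
  obtain W and F :: "'a \<Rightarrow> real" and v where W: "open W" "p \<in> W" "smooth_on W F"
      "S \<inter> W = {x\<in>W. F x = 0}" and v: "frechet_derivative F (at p) v \<noteq> 0"
    using assms unfolding smooth_hypersurface_def by meson
  define D where "D y = frechet_derivative F (at y)" for y
  have der: "(F has_derivative D y) (at y)" if "y \<in> W" for y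
    unfolding D_def using W that smooth_on_has_derivative by blast
  have lin: "linear (D y)" if "y \<in> W" for y
    using der[OF that] has_derivative_linear by blast
  have contD: "continuous_on W (\<lambda>y. D y w)" for w
    unfolding D_def using smooth_on_continuous_derivative[OF W(3)] .
  have "\<exists>b\<in>Basis. D p b \<noteq> 0"
  proof (rule ccontr)
    assume "\<not> ?thesis"
    then have "D p v = 0"
      using lin[OF W(2)]
      by (subst euclidean_representation[symmetric, of v])
        (simp add: linear_sum linear_scale del: euclidean_representation)
    with v show False by (simp add: D_def)
  qed
  then obtain b where b: "b \<in> Basis" "D p b \<noteq> 0" by blast
  define W' where "W' = {y\<in>W. D y b \<noteq> 0}"
  have "open W'"
  proof -
    have "W' = W \<inter> (\<lambda>y. D y b) -` (- {0})" by (auto simp: W'_def)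
    moreover have "open (W \<inter> (\<lambda>y. D y b) -` (- {0}))"
      using contD W(1) by (intro continuous_open_preimage) auto
    ultimately show ?thesis by simp
  qed
  have "p \<in> W'" using W b by (simp add: W'_def)
  let ?P = "hyperplane_proj b"
  define \<Phi> where "\<Phi> y = ?P y + F y *\<^sub>R b" for y
  define \<Phi>' where "\<Phi>' y = Blinfun (\<lambda>v. ?P v + D y v *\<^sub>R b)" for y
  have \<Phi>': "blinfun_apply (\<Phi>' y) = (\<lambda>v. ?P v + D y v *\<^sub>R b)" if "y \<in> W" for y
    unfolding \<Phi>'_def using der[OF that] has_derivative_bounded_linear
    by (intro bounded_linear_Blinfun_apply bounded_linear_add bounded_linear_hyperplane_proj
        bounded_linear_scaleR_const) blast
  have derP: "(?P has_derivative ?P) (at y)" for y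
    by (rule bounded_linear_imp_has_derivative[OF bounded_linear_hyperplane_proj])
  have der\<Phi>: "(\<Phi> has_derivative blinfun_apply (\<Phi>' y)) (at y)" if "y \<in> W'" for y
    using that der[of y] \<Phi>'[of y] derP[of y] unfolding \<Phi>_def W'_def
    by (auto intro!: has_derivative_add has_derivative_scaleR_left)
  have cont\<Phi>': "continuous_on W' \<Phi>'"
  proof (rule continuous_on_blinfun_componentwise)
    fix i :: 'a
    have "continuous_on W' (\<lambda>y. ?P i + D y i *\<^sub>R b)"
      using contD[of i] by (intro continuous_intros continuous_on_subset[OF contD]) (auto simp: W'_def)
    then show "continuous_on W' (\<lambda>y. blinfun_apply (\<Phi>' y) i)"
      by (rule continuous_on_eq) (simp add: \<Phi>' W'_def)
  qed
  \<comment> \<open>\<open>J\<close> inverts \<open>\<Phi>' p\<close>: the component along \<open>b\<close> is found by solving \<open>D p v = w \<bullet> b\<close>.\<close>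
  define J where "J w = ?P w + ((w \<bullet> b - D p (?P w)) / D p b) *\<^sub>R b" for w
  have blD: "bounded_linear (D p)" using der[OF W(2)] has_derivative_bounded_linear by blast
  have blJ: "bounded_linear J"
    unfolding J_def
    by (intro bounded_linear_add bounded_linear_hyperplane_proj bounded_linear_scaleR_const
        bounded_linear_compose[OF bounded_linear_divide] bounded_linear_sub bounded_linear_inner_left
        bounded_linear_compose[OF blD])
  have "Blinfun J o\<^sub>L \<Phi>' p = id_blinfun"
  proof (rule blinfun_eqI)
    fix v
    have "?P (?P v + D p v *\<^sub>R b) = ?P v"
      using b by (simp add: hyperplane_proj_id)
    moreover have "(?P v + D p v *\<^sub>R b) \<bullet> b = D p v"
      using b by (simp add: inner_add_left)
    moreover have "D p v = D p (?P v) + (v \<bullet> b) * D p b"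
      using linear_add[OF lin[OF W(2)], of "?P v" "(v \<bullet> b) *\<^sub>R b"] linear_scale[OF lin[OF W(2)]]
      by (simp add: hyperplane_proj_split)
    ultimately have "J (?P v + D p v *\<^sub>R b) = v"
      using b by (simp add: J_def hyperplane_proj_split)
    then show "blinfun_apply (Blinfun J o\<^sub>L \<Phi>' p) v = blinfun_apply id_blinfun v"
      by (simp add: \<Phi>'[OF W(2)] bounded_linear_Blinfun_apply[OF blJ])
  qed
  then obtain U' V G G' where inv: "open U'" "U' \<subseteq> W'" "p \<in> U'" "open V" "\<Phi> p \<in> V"
      "homeomorphism U' V \<Phi> G" and derG: "\<And>y. y \<in> V \<Longrightarrow> (G has_derivative G' y) (at y)"
    using inverse_function_theorem[OF \<open>open W'\<close> der\<Phi> cont\<Phi>' \<open>p \<in> W'\<close>] by metis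
  define U where "U = {x. ?P x \<in> V}"
  define g where "g x = G (?P x) \<bullet> b" for x
  define \<gamma> where "\<gamma> x = ?P x + g x *\<^sub>R b" for x
  have "open U"
    using continuous_open_preimage[OF continuous_on_hyperplane_proj[of UNIV b] open_UNIV \<open>open V\<close>]
    by (simp add: U_def vimage_def)
  have \<gamma>G: "\<gamma> x = G (?P x)" and F\<gamma>: "F (\<gamma> x) = 0" and \<gamma>W: "\<gamma> x \<in> W'" if "x \<in> U" for x
  proof -
    have G: "G (?P x) \<in> U'" "\<Phi> (G (?P x)) = ?P x"
      using that inv(6) unfolding U_def homeomorphism_def by auto
    have "?P (\<Phi> (G (?P x))) = ?P (G (?P x))" "\<Phi> (G (?P x)) \<bullet> b = F (G (?P x))"
      using b by (simp_all add: \<Phi>_def hyperplane_proj_id inner_add_left)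
    then have P: "?P (G (?P x)) = ?P x" and "F (G (?P x)) = 0"
      using G b by (simp_all add: hyperplane_proj_id)
    show "\<gamma> x = G (?P x)"
      using hyperplane_proj_split[of b "G (?P x)"] by (simp add: \<gamma>_def g_def P)
    then show "F (\<gamma> x) = 0" "\<gamma> x \<in> W'" using \<open>F (G (?P x)) = 0\<close> G inv(2) by auto
  qed
  define D' where "D' x v = - D (\<gamma> x) (?P v) * inverse (D (\<gamma> x) b)" for x v
  have derg: "(g has_derivative D' x) (at x)" if "x \<in> U" for x
  proof -
    let ?E = "\<lambda>v. G' (?P x) (?P v) \<bullet> b"
    have "?P x \<in> V" using that by (simp add: U_def)
    have E: "(g has_derivative ?E) (at x)"
      unfolding g_def
      by (intro has_derivative_inner_left has_derivative_compose[OF derP derG] \<open>?P x \<in> V\<close>)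
    have "\<gamma> x \<in> W" using \<gamma>W[OF that] by (simp add: W'_def)
    have "((\<lambda>x. F (\<gamma> x)) has_derivative (\<lambda>v. D (\<gamma> x) (?P v + ?E v *\<^sub>R b))) (at x)"
      using has_derivative_add[OF derP has_derivative_scaleR_left[OF E]]
      by (intro has_derivative_compose[OF _ der] \<open>\<gamma> x \<in> W\<close>) (simp add: \<gamma>_def)
    moreover have "((\<lambda>x. F (\<gamma> x)) has_derivative (\<lambda>v. 0)) (at x)"
      by (rule has_derivative_transform_within_open[OF has_derivative_const \<open>open U\<close> that])
        (simp add: F\<gamma>)
    ultimately have "(\<lambda>v. D (\<gamma> x) (?P v + ?E v *\<^sub>R b)) = (\<lambda>v. 0)"
      by (rule has_derivative_unique)
    then have "D (\<gamma> x) (?P v) + ?E v * D (\<gamma> x) b = 0" for v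
      using lin[OF \<open>\<gamma> x \<in> W\<close>] by (simp add: linear_add linear_scale fun_eq_iff)
    moreover have "D (\<gamma> x) b \<noteq> 0" using \<gamma>W[OF that] by (simp add: W'_def)
    moreover have "e = - a * inverse d" if "a + e * d = 0" "d \<noteq> 0" for a e d :: real
    proof -
      have "e * d = - a" using that(1) by linarith
      then show ?thesis using that(2) by (metis nonzero_eq_divide_eq divide_inverse)
    qed
    ultimately have "?E v = D' x v" for v
      unfolding D'_def by blast
    then have "?E = D' x" by blast
    with E show ?thesis by simp
  qed
  have "Ck_on k U g" for k
  proof (induction k)
    case 0
    show ?case
      using derg by (auto intro!: continuous_at_imp_continuous_on has_derivative_continuous)
  next
    case (Suc k)
    have "Ck_on k U (\<lambda>x. ?P x + g x *\<^sub>R b)"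
      by (rule Ck_on_add[OF \<open>open U\<close> Ck_on_linear[OF \<open>open U\<close> bounded_linear_hyperplane_proj]
            Ck_on_scaleR[OF \<open>open U\<close> Suc Ck_on_const[OF \<open>open U\<close>]]])
    then have \<gamma>k: "Ck_on k U \<gamma>" unfolding \<gamma>_def .
    have Dk: "Ck_on k U (\<lambda>x. D (\<gamma> x) w)" for w
    proof (rule Ck_on_compose[OF \<open>open U\<close> \<open>open W'\<close> _ \<gamma>k])
      show "\<gamma> ` U \<subseteq> W'" using \<gamma>W by auto
      have "Ck_on (Suc k) W F" using W(3) unfolding smooth_on_def by blast
      then have "Ck_on k W (\<lambda>y. D y w)" by (simp add: D_def)
      then show "Ck_on k W' (\<lambda>y. D y w)" by (rule Ck_on_subset) (auto simp: W'_def)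
    qed
    have "Ck_on k U (\<lambda>x. (-1) * D (\<gamma> x) (?P v) * inverse (D (\<gamma> x) b))" for v
    proof (rule Ck_on_mult[OF \<open>open U\<close> Ck_on_mult[OF \<open>open U\<close> Ck_on_const[OF \<open>open U\<close>]] Ck_on_inverse[OF \<open>open U\<close> _ Dk]])
      show "D (\<gamma> x) b \<noteq> 0" if "x \<in> U" for x using \<gamma>W[OF that] by (simp add: W'_def)
      show "Ck_on k U (\<lambda>x. D (\<gamma> x) (?P v))" by (rule Dk)
    qed
    then have "Ck_on k U (\<lambda>x. D' x v)" for v by (simp add: D'_def)
    with \<open>open U\<close> derg show ?case by (rule Ck_on_SucI)
  qed
  then have "smooth_on U g" by (simp add: smooth_on_def)
  moreover have "(\<lambda>x. x + g x *\<^sub>R b) ` (U \<inter> {x. x \<bullet> b = 0}) \<subseteq> S"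
  proof clarify
    fix x assume "x \<in> U" "x \<bullet> b = 0"
    then have "x + g x *\<^sub>R b = \<gamma> x" by (simp add: \<gamma>_def hyperplane_proj_id)
    then show "x + g x *\<^sub>R b \<in> S"
      using F\<gamma> \<gamma>W \<open>x \<in> U\<close> W(4) by (auto simp: W'_def)
  qed
  moreover have "p \<in> (\<lambda>x. x + g x *\<^sub>R b) ` (U \<inter> {x. x \<bullet> b = 0})"
  proof
    have "F p = 0" using W assms by auto
    then have "\<Phi> p = ?P p" by (simp add: \<Phi>_def)
    then have "G (?P p) = p" "?P p \<in> V"
      using inv(3,5,6) unfolding homeomorphism_def by auto
    then show "p = ?P p + g (?P p) *\<^sub>R b" "?P p \<in> U \<inter> {x. x \<bullet> b = 0}"
      using b by (simp_all add: g_def U_def hyperplane_proj_id hyperplane_proj_split)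
  qed
  ultimately show thesis using that \<open>open U\<close> b(1) by blast
qed

text \<open>A graph contained in a hypersurface fills it locally. The tangent vectors of the graph together
  with \<open>b\<close> span the space, so \<open>F\<close> has nonzero derivative along \<open>b\<close> and cannot vanish twice on a
  short segment in direction \<open>b\<close>.\<close>

lemma smooth_hypersurface_coincides_with_graph:
  fixes S :: "'a::euclidean_space set"
  assumes "smooth_hypersurface S" and b: "b \<in> Basis" and "open U" and "smooth_on U g"
    and sub: "(\<lambda>x. x + g x *\<^sub>R b) ` (U \<inter> {x. x \<bullet> b = 0}) \<subseteq> S"
    and p: "p \<in> (\<lambda>x. x + g x *\<^sub>R b) ` (U \<inter> {x. x \<bullet> b = 0})"
  obtains r where "r > 0" "hyperplane_proj b ` ball p r \<subseteq> U"
    "S \<inter> ball p r \<subseteq> (\<lambda>x. x + g x *\<^sub>R b) ` (U \<inter> {x. x \<bullet> b = 0})"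
proof -
  let ?P = "hyperplane_proj b"
  obtain x0 where x0: "p = x0 + g x0 *\<^sub>R b" "x0 \<in> U" "x0 \<bullet> b = 0" using p by auto
  have "p \<in> S" using sub p by blast
  have Pp: "?P p = x0" using b x0 by (simp add: hyperplane_proj_id)
  obtain W and F :: "'a \<Rightarrow> real" and v where W: "open W" "p \<in> W" "smooth_on W F"
      "S \<inter> W = {x\<in>W. F x = 0}" and v: "frechet_derivative F (at p) v \<noteq> 0"
    using \<open>smooth_hypersurface S\<close> \<open>p \<in> S\<close> unfolding smooth_hypersurface_def by meson
  define D where "D y = frechet_derivative F (at y)" for y
  have der: "(F has_derivative D y) (at y)" if "y \<in> W" for y
    unfolding D_def using W that smooth_on_has_derivative by blast
  have lin: "linear (D y)" if "y \<in> W" for y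
    using der[OF that] has_derivative_linear by blast
  \<comment> \<open>\<open>h\<close> projects along \<open>b\<close> onto the graph.\<close>
  define h where "h y = ?P y + g (?P y) *\<^sub>R b" for y
  have hp: "h p = p" unfolding h_def Pp using x0(1) by simp
  have U': "open (?P -` U)"
    using continuous_open_preimage[OF continuous_on_hyperplane_proj[of UNIV b] open_UNIV \<open>open U\<close>]
    by simp
  have contP: "continuous_on (?P -` U) (\<lambda>y. g (?P y))"
    by (rule continuous_on_compose2[OF smooth_on_continuous[OF \<open>smooth_on U g\<close>]
          continuous_on_hyperplane_proj]) auto
  have conth: "continuous_on (?P -` U) h"
    unfolding h_def by (intro continuous_intros continuous_on_hyperplane_proj contP)
  have hS: "h y \<in> S" if "y \<in> ?P -` U" for y
    using sub that b by (auto simp: h_def)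
  have "D p b \<noteq> 0"
  proof
    assume "D p b = 0"
    let ?Dg = "frechet_derivative g (at x0)"
    have "((\<lambda>y. g (?P y)) has_derivative (\<lambda>v. ?Dg (?P v))) (at p)"
      using smooth_on_has_derivative[OF \<open>smooth_on U g\<close> \<open>open U\<close> x0(2)]
      by (intro has_derivative_compose[OF
            bounded_linear_imp_has_derivative[OF bounded_linear_hyperplane_proj]]) (simp add: Pp)
    then have "(h has_derivative (\<lambda>v. ?P v + ?Dg (?P v) *\<^sub>R b)) (at p)"
      unfolding h_def
      by (intro has_derivative_add has_derivative_scaleR_left
          bounded_linear_imp_has_derivative[OF bounded_linear_hyperplane_proj])
    then have "((\<lambda>y. F (h y)) has_derivative (\<lambda>v. D p (?P v + ?Dg (?P v) *\<^sub>R b))) (at p)"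
      by (rule has_derivative_compose) (simp add: hp der[OF W(2)])
    moreover have "((\<lambda>y. F (h y)) has_derivative (\<lambda>v. 0)) (at p)"
    proof (rule has_derivative_transform_within_open[OF has_derivative_const[of 0]])
      show "open ((?P -` U) \<inter> h -` W)" using continuous_open_preimage[OF conth U' W(1)] .
      show "p \<in> (?P -` U) \<inter> h -` W" using hp Pp x0 W by auto
      show "0 = F (h y)" if "y \<in> (?P -` U) \<inter> h -` W" for y using hS[of y] that W(4) by auto
    qed
    ultimately have "(\<lambda>v. D p (?P v + ?Dg (?P v) *\<^sub>R b)) = (\<lambda>v. 0)"
      by (rule has_derivative_unique)
    then have "D p (?P v) = 0"
      using \<open>D p b = 0\<close> lin[OF W(2)] by (simp add: linear_add linear_scale fun_eq_iff)
    then have "D p (?P v + (v \<bullet> b) *\<^sub>R b) = 0"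
      using \<open>D p b = 0\<close> lin[OF W(2)] by (simp add: linear_add linear_scale)
    with v show False by (simp add: D_def hyperplane_proj_split)
  qed
  have "open (W \<inter> (\<lambda>y. D y b) -` (- {0}))"
    using smooth_on_continuous_derivative[OF W(3)] W(1) unfolding D_def
    by (intro continuous_open_preimage) auto
  moreover have "p \<in> W \<inter> (\<lambda>y. D y b) -` (- {0})" using W(2) \<open>D p b \<noteq> 0\<close> by simp
  ultimately obtain r0 where r0: "r0 > 0" "ball p r0 \<subseteq> W \<inter> (\<lambda>y. D y b) -` (- {0})"
    by (rule openE)
  have "open ((?P -` U) \<inter> h -` ball p r0)" using continuous_open_preimage[OF conth U'] by simp
  moreover have "p \<in> (?P -` U) \<inter> h -` ball p r0" using hp Pp x0 r0 by auto
  ultimately obtain r1 where r1: "r1 > 0" "ball p r1 \<subseteq> (?P -` U) \<inter> h -` ball p r0"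
    by (rule openE)
  show thesis
  proof (rule that[of "min r0 r1"])
    show "min r0 r1 > 0" using r0 r1 by simp
    show "?P ` ball p (min r0 r1) \<subseteq> U" using r1 by auto
    show "S \<inter> ball p (min r0 r1) \<subseteq> (\<lambda>x. x + g x *\<^sub>R b) ` (U \<inter> {x. x \<bullet> b = 0})"
    proof clarify
      fix q assume q: "q \<in> S" "q \<in> ball p (min r0 r1)"
      have U: "?P q \<in> U" and hq: "h q \<in> ball p r0" using q r1 by auto
      have "F q = 0" "F (h q) = 0"
        using q hS[of q] U hq r0 W(4) by auto
      have line: "q - h q = (q \<bullet> b - g (?P q)) *\<^sub>R b"
        unfolding h_def using hyperplane_proj_split[of b q] by (metis add_diff_cancel_left scaleR_diff_left)
      have "q = h q"
      proof (rule ccontr)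
        assume "q \<noteq> h q"
        have seg: "h q + t *\<^sub>R (q - h q) \<in> ball p r0" if "t \<in> {0..1}" for t
        proof -
          have "h q + t *\<^sub>R (q - h q) = (1 - t) *\<^sub>R h q + t *\<^sub>R q" by (simp add: algebra_simps)
          then show ?thesis using convexD_alt[OF convex_ball[of p r0] hq, of q t] q that by simp
        qed
        have derF: "((\<lambda>t. F (h q + t *\<^sub>R (q - h q))) has_derivative
            (\<lambda>s. D (h q + t *\<^sub>R (q - h q)) (s *\<^sub>R (q - h q)))) (at t within {0..1})"
          if "t \<in> {0..1}" for t
          using seg[OF that] r0
          by (intro has_derivative_compose[OF _ der]) (auto intro!: derivative_eq_intros)
        obtain t where t: "t \<in> {0<..<1}"
          "F q - F (h q) = D (h q + t *\<^sub>R (q - h q)) (q - h q)"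
          using mvt_simple[of 0 1 "\<lambda>t. F (h q + t *\<^sub>R (q - h q))", OF _ derF] by auto
        have W't: "h q + t *\<^sub>R (q - h q) \<in> W" "D (h q + t *\<^sub>R (q - h q)) b \<noteq> 0"
          using seg[of t] t r0 by auto
        then have "(q \<bullet> b - g (?P q)) * D (h q + t *\<^sub>R (q - h q)) b = 0"
          using t(2) lin[OF W't(1)] \<open>F q = 0\<close> \<open>F (h q) = 0\<close>
          by (subst (asm) (2) line) (simp add: linear_scale)
        with W't(2) have "q - h q = 0" unfolding line by simp
        with \<open>q \<noteq> h q\<close> show False by simp
      qed
      then show "q \<in> (\<lambda>x. x + g x *\<^sub>R b) ` (U \<inter> {x. x \<bullet> b = 0})"
        using U b unfolding h_def by (intro image_eqI[of _ _ "?P q"]) auto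
    qed
  qed
qed

section \<open>Lebesgue measure on coordinate hyperplanes and on graphs\<close>

lemma sets_hyperplane_lborel [simp, measurable_cong]: "sets (hyperplane_lborel b) = sets borel"
  by (simp add: hyperplane_lborel_def)

lemma space_hyperplane_lborel [simp]: "space (hyperplane_lborel b) = UNIV"
  by (simp add: hyperplane_lborel_def)

lemma hyperplane_lift_measurable:
  "(\<lambda>f. \<Sum>i\<in>I. f i *\<^sub>R i) \<in> Pi\<^sub>M I (\<lambda>_. lborel) \<rightarrow>\<^sub>M (borel :: 'a::euclidean_space measure)"
  by measurable

lemma AE_hyperplane_lborel:
  assumes "b \<in> Basis"
  shows "AE x in hyperplane_lborel b. x \<bullet> b = 0"
proof -
  have "(\<Sum>i\<in>Basis - {b}. f i *\<^sub>R i) \<bullet> b = 0" for f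
    using assms by (auto simp: inner_sum_left inner_Basis intro!: sum.neutral)
  then show ?thesis
    unfolding hyperplane_lborel_def by (subst AE_distr_iff[OF hyperplane_lift_measurable]) auto
qed

lemma emeasure_hyperplane_lborel_cball:
  fixes b :: "'a::euclidean_space"
  assumes "b \<in> Basis" "r > 0"
  shows "emeasure (hyperplane_lborel b) (cball 0 r) =
    ennreal (unit_ball_vol (real (DIM('a) - 1)) * r ^ (DIM('a) - 1))"
proof -
  let ?P = "Pi\<^sub>M (Basis - {b}) (\<lambda>_. lborel :: real measure)"
  have nrm: "norm (\<Sum>i\<in>Basis - {b}. f i *\<^sub>R i) = sqrt (\<Sum>i\<in>Basis - {b}. (f i)\<^sup>2)" for f
  proof -
    have "(\<Sum>i\<in>Basis - {b}. f i *\<^sub>R i) \<bullet> j = f j" if "j \<in> Basis - {b}" for j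
      using that by (simp add: inner_sum_left inner_Basis if_distrib[of "\<lambda>x. _ * x"] cong: if_cong)
    then show ?thesis
      unfolding norm_eq_sqrt_inner inner_sum_right by (simp add: power2_eq_square)
  qed
  have "emeasure (hyperplane_lborel b) (cball 0 r) =
      emeasure ?P ((\<lambda>f. \<Sum>i\<in>Basis - {b}. f i *\<^sub>R i) -` cball 0 r \<inter> space ?P)"
    unfolding hyperplane_lborel_def by (rule emeasure_distr[OF hyperplane_lift_measurable]) simp
  also have "(\<lambda>f. \<Sum>i\<in>Basis - {b}. f i *\<^sub>R i) -` cball 0 r =
      {f. sqrt (\<Sum>i\<in>Basis - {b}. (f i)\<^sup>2) \<le> r}"
    by (auto simp: nrm)
  also have "emeasure ?P ({f. sqrt (\<Sum>i\<in>Basis - {b}. (f i)\<^sup>2) \<le> r} \<inter> space ?P) =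
      ennreal (unit_ball_vol (real (card (Basis - {b}))) * r ^ card (Basis - {b}))"
    using \<open>r > 0\<close> by (intro emeasure_cball_aux) auto
  finally show ?thesis using assms by simp
qed

lemma emeasure_hyperplane_lborel_bounded:
  assumes "b \<in> Basis" "bounded A"
  shows "emeasure (hyperplane_lborel b) A < \<infinity>"
proof -
  obtain r where "r > 0" "\<forall>x\<in>A. norm x \<le> r"
    using \<open>bounded A\<close> by (auto simp: bounded_pos)
  then have "emeasure (hyperplane_lborel b) A \<le> emeasure (hyperplane_lborel b) (cball 0 r)"
    by (intro emeasure_mono) auto
  also have "\<dots> < \<infinity>" using assms \<open>r > 0\<close> by (simp add: emeasure_hyperplane_lborel_cball)
  finally show ?thesis .
qed

lemma sigma_finite_hyperplane_lborel:
  assumes "b \<in> Basis"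
  shows "sigma_finite_measure (hyperplane_lborel b)"
proof
  let ?A = "range (\<lambda>n::nat. cball (0::'a) (real n))"
  have "(\<Union>n::nat. cball (0::'a) (real n)) = UNIV"
    using real_arch_simple by auto
  then show "\<exists>A. countable A \<and> A \<subseteq> sets (hyperplane_lborel b) \<and>
      \<Union> A = space (hyperplane_lborel b) \<and> (\<forall>a\<in>A. emeasure (hyperplane_lborel b) a \<noteq> \<infinity>)"
    using emeasure_hyperplane_lborel_bounded[OF assms bounded_cball]
    by (intro exI[of _ ?A]) (auto simp: less_top)
qed

text \<open>Fubini for the splitting of the space into a coordinate hyperplane and its normal direction.\<close>

lemma nn_integral_lborel_hyperplane:
  fixes f :: "'a::euclidean_space \<Rightarrow> ennreal"
  assumes "b \<in> Basis" and f [measurable]: "f \<in> borel_measurable borel"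
  shows "(\<integral>\<^sup>+x. f x \<partial>lborel) = (\<integral>\<^sup>+x. \<integral>\<^sup>+t. f (x + t *\<^sub>R b) \<partial>lborel \<partial>hyperplane_lborel b)"
proof -
  let ?I = "Basis - {b}" and ?s = "\<lambda>I f. \<Sum>i\<in>I. f i *\<^sub>R i :: 'a"
  interpret product_sigma_finite "\<lambda>_. lborel :: real measure" by standard
  have B: "Basis = insert b ?I" using assms by auto
  have m: "(\<lambda>h. f (?s Basis h)) \<in> borel_measurable (Pi\<^sub>M (insert b ?I) (\<lambda>_. lborel))"
    unfolding B[symmetric] by measurable
  have upd: "?s Basis (x(b := t)) = ?s ?I x + t *\<^sub>R b" for x t
  proof -
    have "?s Basis (x(b := t)) = t *\<^sub>R b + ?s ?I (x(b := t))"
      using assms by (subst sum.remove[of Basis b]) auto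
    also have "?s ?I (x(b := t)) = ?s ?I x" by (intro sum.cong) auto
    finally show ?thesis by (simp add: add.commute)
  qed
  have "(\<integral>\<^sup>+x. f x \<partial>lborel) = (\<integral>\<^sup>+h. f (?s Basis h) \<partial>Pi\<^sub>M Basis (\<lambda>_. lborel))"
    by (subst lborel_eq) (simp add: nn_integral_distr)
  also have "\<dots> = (\<integral>\<^sup>+h. f (?s Basis h) \<partial>Pi\<^sub>M (insert b ?I) (\<lambda>_. lborel))"
    using B by simp
  also have "\<dots> = (\<integral>\<^sup>+x. \<integral>\<^sup>+t. f (?s Basis (x(b := t))) \<partial>lborel \<partial>Pi\<^sub>M ?I (\<lambda>_. lborel))"
    by (rule product_nn_integral_insert[OF _ _ m]) auto
  also have "\<dots> = (\<integral>\<^sup>+x. \<integral>\<^sup>+t. f (?s ?I x + t *\<^sub>R b) \<partial>lborel \<partial>Pi\<^sub>M ?I (\<lambda>_. lborel))"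
    by (simp only: upd)
  also have "\<dots> = (\<integral>\<^sup>+x. \<integral>\<^sup>+t. f (x + t *\<^sub>R b) \<partial>lborel \<partial>hyperplane_lborel b)"
    unfolding hyperplane_lborel_def by (subst nn_integral_distr) auto
  finally show ?thesis .
qed

definition graph_area_density :: "'a::euclidean_space \<Rightarrow> ('a \<Rightarrow> real) \<Rightarrow> 'a \<Rightarrow> real" where
  "graph_area_density b g x = sqrt (1 + (\<Sum>i\<in>Basis - {b}. (frechet_derivative g (at x) i)\<^sup>2))"

lemma graph_area_density_ge_1: "graph_area_density b g x \<ge> 1"
  by (simp add: graph_area_density_def sum_nonneg)

locale graph_patch =
  fixes b :: "'a::euclidean_space" and U :: "'a set" and g :: "'a \<Rightarrow> real"
  assumes basis: "b \<in> Basis" and open_dom: "open U" and smooth: "smooth_on U g"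
begin

definition patch :: "'a set" where
  "patch = (\<lambda>x. x + g x *\<^sub>R b) ` (U \<inter> {x. x \<bullet> b = 0})"

text \<open>The height and the density are cut off outside \<open>U\<close> to make them Borel functions.\<close>

definition height :: "'a \<Rightarrow> real" where "height x = (if x \<in> U then g x else 0)"

definition density_on :: "'a \<Rightarrow> real" where
  "density_on x = (if x \<in> U then graph_area_density b g x else 0)"

definition graph_measure :: "'a measure" where
  "graph_measure = distr (density (hyperplane_lborel b) (\<lambda>x. ennreal (density_on x))) borel
     (\<lambda>x. x + height x *\<^sub>R b)"

lemma height_measurable [measurable]: "height \<in> borel_measurable borel"
  unfolding height_def using open_dom
  by (intro borel_measurable_continuous_on_if smooth_on_continuous[OF smooth]) auto

lemma density_on_measurable [measurable]: "density_on \<in> borel_measurable borel"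
  unfolding density_on_def graph_area_density_def using open_dom
  by (intro borel_measurable_continuous_on_if continuous_intros
      smooth_on_continuous_derivative[OF smooth]) auto

lemma density_on_nonneg: "density_on x \<ge> 0"
  using graph_area_density_ge_1[of b g x] by (simp add: density_on_def)

lemma sets_graph_measure [simp, measurable_cong]: "sets graph_measure = sets borel"
  by (simp add: graph_measure_def)

lemma space_graph_measure [simp]: "space graph_measure = UNIV"
  by (simp add: graph_measure_def)

lemma nn_integral_graph_measure:
  assumes [measurable]: "f \<in> borel_measurable borel"
  shows "(\<integral>\<^sup>+y. f y \<partial>graph_measure) =
    (\<integral>\<^sup>+x. ennreal (density_on x) * f (x + height x *\<^sub>R b) \<partial>hyperplane_lborel b)"
  unfolding graph_measure_def by (subst nn_integral_distr) (auto simp: nn_integral_density)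

lemma emeasure_graph_measure_total:
  "emeasure graph_measure UNIV = (\<integral>\<^sup>+x\<in>U \<inter> {x. x \<bullet> b = 0}.
     ennreal (sqrt (1 + (\<Sum>i\<in>Basis - {b}. (frechet_derivative g (at x) i)\<^sup>2))) \<partial>hyperplane_lborel b)"
proof -
  have "emeasure graph_measure UNIV = (\<integral>\<^sup>+x. ennreal (density_on x) \<partial>hyperplane_lborel b)"
    using nn_integral_graph_measure[of "\<lambda>_. 1"] by simp
  also have "\<dots> = (\<integral>\<^sup>+x\<in>U \<inter> {x. x \<bullet> b = 0}.
     ennreal (sqrt (1 + (\<Sum>i\<in>Basis - {b}. (frechet_derivative g (at x) i)\<^sup>2))) \<partial>hyperplane_lborel b)"
    using AE_hyperplane_lborel[OF basis]
    by (intro nn_integral_cong_AE)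
      (auto simp: density_on_def graph_area_density_def indicator_def elim!: eventually_mono)
  finally show ?thesis .
qed

text \<open>The graph as a zero set, from which it is seen to be a Borel set.\<close>

lemma patch_eq: "patch = {y. hyperplane_proj b y \<in> U \<and> height (hyperplane_proj b y) = y \<bullet> b}"
proof (intro equalityI subsetI)
  fix y assume "y \<in> patch"
  then show "y \<in> {y. hyperplane_proj b y \<in> U \<and> height (hyperplane_proj b y) = y \<bullet> b}"
    using basis by (auto simp: patch_def height_def hyperplane_proj_id inner_add_left)
next
  fix y assume "y \<in> {y. hyperplane_proj b y \<in> U \<and> height (hyperplane_proj b y) = y \<bullet> b}"
  then show "y \<in> patch"
    using basis hyperplane_proj_split[of b y] unfolding patch_def height_def
    by (intro image_eqI[of _ _ "hyperplane_proj b y"]) auto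
qed

lemma hyperplane_proj_measurable [measurable]: "hyperplane_proj b \<in> borel_measurable borel"
  by (intro borel_measurable_continuous_onI continuous_on_hyperplane_proj)

lemma patch_measurable [measurable]: "patch \<in> sets borel"
proof -
  have [measurable]: "U \<in> sets borel" using open_dom by auto
  have [measurable]: "(\<lambda>y. height (hyperplane_proj b y)) \<in> borel_measurable borel"
    by (rule measurable_compose[OF hyperplane_proj_measurable height_measurable])
  have "{y \<in> space borel. hyperplane_proj b y \<in> U \<and> height (hyperplane_proj b y) = y \<bullet> b} \<in> sets borel"
    by measurable
  then show ?thesis unfolding patch_eq by simp
qed

lemma AE_graph_measure: "AE y in graph_measure. y \<in> patch"
proof -
  have "AE x in hyperplane_lborel b. 0 < ennreal (density_on x) \<longrightarrow> x + height x *\<^sub>R b \<in> patch"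
    using AE_hyperplane_lborel[OF basis]
    by (rule eventually_mono) (auto simp: density_on_def height_def patch_def split: if_splits)
  then have "AE x in density (hyperplane_lborel b) (\<lambda>x. ennreal (density_on x)). x + height x *\<^sub>R b \<in> patch"
    by (subst AE_density) auto
  then show ?thesis
    unfolding graph_measure_def by (subst AE_distr_iff) auto
qed

end

section \<open>Thin tubes around a graph\<close>

text \<open>The integral of \<open>\<phi>\<close> over the \<open>\<epsilon>\<close>-tube, relative to the thickness of the tube.\<close>

definition tube_mean :: "'a::euclidean_space set \<Rightarrow> ('a \<Rightarrow> real) \<Rightarrow> real \<Rightarrow> ennreal" where
  "tube_mean S \<phi> \<epsilon> = (\<integral>\<^sup>+y. ennreal (1 / (2 * \<epsilon>)) *
     (ennreal (\<phi> y) * indicator {y. infdist y S < \<epsilon>} y) \<partial>lborel)"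

text \<open>A ball about a point of \<open>S\<close> in which \<open>S\<close> is a Lipschitz graph. The tripled radius leaves room for
  nearest points: those of points in \<open>ball q r\<close> lie in \<open>ball q (3 * r)\<close>.\<close>

locale graph_ball = graph_patch +
  fixes S :: "'a set" and q :: 'a and r L :: real
  assumes closed: "closed S" and patch_sub: "patch \<subseteq> S" and center: "q \<in> S" and radius: "r > 0"
    and coincide: "S \<inter> ball q (3 * r) \<subseteq> patch" and proj_ball: "hyperplane_proj b ` ball q (3 * r) \<subseteq> U"
    and L_nonneg: "0 \<le> L"
    and lipschitz: "\<And>x y. x \<in> hyperplane_proj b ` ball q (3 * r) \<Longrightarrow>
      y \<in> hyperplane_proj b ` ball q (3 * r) \<Longrightarrow> \<bar>g x - g y\<bar> \<le> L * norm (x - y)"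
begin

text \<open>Shifting a point of the graph by \<open>s\<close> along \<open>b\<close> moves it to first order by
  \<open>s\<close> divided by the area density away from the graph.\<close>

lemma infdist_along_axis:
  assumes x: "x \<in> U" "x \<bullet> b = 0" and p: "x + g x *\<^sub>R b \<in> ball q (3 * r)"
  shows "((\<lambda>\<epsilon>. infdist (x + (g x + \<epsilon> * s) *\<^sub>R b) S / \<epsilon>) \<longlongrightarrow> \<bar>s\<bar> / graph_area_density b g x) (at_right 0)"
proof -
  let ?W = "ball q (3 * r)" and ?P = "hyperplane_proj b" and ?Dg = "frechet_derivative g (at x)"
  define p where "p = x + g x *\<^sub>R b"
  define F where "F y = y \<bullet> b - g (?P y)" for y
  define N where "N = b - (\<Sum>i\<in>Basis - {b}. ?Dg i *\<^sub>R i)"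
  have Pp: "?P p = x" using x basis by (simp add: p_def hyperplane_proj_id)
  have derg: "(g has_derivative ?Dg) (at x)"
    using smooth_on_has_derivative[OF smooth open_dom x(1)] .
  then have lin: "linear ?Dg" by (rule has_derivative_linear)
  have "N \<bullet> v = v \<bullet> b - ?Dg (?P v)" for v
  proof -
    have "?Dg (?P v) = (\<Sum>i\<in>Basis - {b}. (v \<bullet> i) * ?Dg i)"
      unfolding hyperplane_proj_representation[OF basis]
      by (simp add: linear_sum[OF lin] linear_scale[OF lin])
    moreover have "N \<bullet> v = v \<bullet> b - (\<Sum>i\<in>Basis - {b}. (v \<bullet> i) * ?Dg i)"
      unfolding N_def inner_diff_left inner_sum_left inner_scaleR_left
      by (simp add: inner_commute mult.commute)
    ultimately show ?thesis by simp
  qed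
  moreover have "((\<lambda>y. g (?P y)) has_derivative (\<lambda>v. ?Dg (?P v))) (at p)"
    using derg
    by (intro has_derivative_compose[OF
          bounded_linear_imp_has_derivative[OF bounded_linear_hyperplane_proj]]) (simp add: Pp)
  then have "(F has_derivative (\<lambda>v. v \<bullet> b - ?Dg (?P v))) (at p)"
    unfolding F_def by (intro has_derivative_diff has_derivative_inner_left has_derivative_ident)
  ultimately have der: "(F has_derivative (\<lambda>v. N \<bullet> v)) (at p)" by simp
  have Nb: "N \<bullet> b = 1"
    using basis by (auto simp: N_def inner_diff_left inner_sum_left inner_Basis intro!: sum.neutral)
  have Ni: "N \<bullet> i = - ?Dg i" if "i \<in> Basis - {b}" for i
    using that basis by (simp add: N_def inner_diff_left inner_sum_left inner_Basis
        if_distrib[of "\<lambda>x. _ * x"] cong: if_cong) (auto simp: inner_not_same_Basis)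
  have "norm N = graph_area_density b g x"
    unfolding norm_eq_sqrt_inner graph_area_density_def
    by (subst euclidean_inner, subst sum.remove[of Basis b])
      (use basis in \<open>auto simp: Nb Ni power2_eq_square\<close>)
  moreover have "N \<noteq> 0" using Nb by auto
  moreover have "S \<inter> ?W = {y\<in>?W. F y = 0}"
  proof (intro equalityI subsetI)
    fix y assume "y \<in> S \<inter> ?W"
    then show "y \<in> {y\<in>?W. F y = 0}"
      using coincide unfolding patch_eq height_def F_def by auto
  next
    fix y assume y: "y \<in> {y\<in>?W. F y = 0}"
    then have "?P y \<in> U" using proj_ball by auto
    with y have "y \<in> patch" unfolding patch_eq height_def F_def by auto
    with y show "y \<in> S \<inter> ?W" using patch_sub by auto
  qed
  moreover have "continuous_on ?W F"
    unfolding F_def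
    by (intro continuous_intros continuous_on_compose2[OF smooth_on_continuous[OF smooth]
          continuous_on_hyperplane_proj] proj_ball)
  moreover have "p \<in> S" using x patch_sub by (auto simp: p_def patch_def)
  ultimately have "((\<lambda>\<epsilon>. infdist (p + \<epsilon> *\<^sub>R (s *\<^sub>R b)) S / \<epsilon>) \<longlongrightarrow>
      \<bar>N \<bullet> (s *\<^sub>R b)\<bar> / graph_area_density b g x) (at_right 0)"
    using infdist_level_set[OF closed open_ball, of p q "3 * r" F N "s *\<^sub>R b"] der p
    by (simp add: p_def)
  then show ?thesis by (simp add: p_def Nb algebra_simps)
qed

text \<open>Uniform counterpart of the preceding limit, for the domination: \<open>y \<mapsto> y \<bullet> b - g (proj y)\<close> vanishes
  at a nearest point of \<open>S\<close> and has Lipschitz constant \<open>1 + L\<close>.\<close>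

lemma height_bound_in_tube:
  assumes y: "y \<in> ball q r" and "infdist y S < \<epsilon>"
  shows "\<bar>y \<bullet> b - g (hyperplane_proj b y)\<bar> \<le> (1 + L) * \<epsilon>"
proof -
  let ?P = "hyperplane_proj b"
  obtain z where z: "z \<in> S" "infdist y S = dist y z"
    using infdist_attains_inf[OF closed, of y] center by auto
  have "dist y z \<le> dist y q" using infdist_le[OF center, of y] z by simp
  then have "z \<in> ball q (3 * r)" "y \<in> ball q (3 * r)"
    using y radius dist_triangle[of q z y] by (auto simp: dist_commute)
  then have *: "z \<bullet> b = g (?P z)" "\<bar>g (?P z) - g (?P y)\<bar> \<le> L * norm (?P z - ?P y)"
    using coincide z(1) lipschitz[of "?P z" "?P y"] by (auto simp: patch_eq height_def)
  have "\<bar>(y - z) \<bullet> b\<bar> \<le> norm (y - z)"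
    using Basis_le_norm[OF basis] .
  moreover have "norm (?P z - ?P y) \<le> norm (y - z)"
    using norm_hyperplane_proj_le[OF basis, of "z - y"] by (simp add: hyperplane_proj_diff norm_minus_commute)
  then have "L * norm (?P z - ?P y) \<le> L * norm (y - z)" using L_nonneg by (rule mult_left_mono)
  ultimately have "\<bar>y \<bullet> b - g (?P y)\<bar> \<le> (1 + L) * norm (y - z)"
    using * by (simp add: inner_diff_left distrib_right)
  also have "\<dots> \<le> (1 + L) * \<epsilon>"
    using assms(2) z(2) L_nonneg by (intro mult_left_mono) (auto simp: dist_norm)
  finally show ?thesis .
qed

text \<open>The tube is sliced along the direction \<open>b\<close> by Fubini and each slice is rescaled by
  \<open>t = g x + \<epsilon> s\<close>. The integrand then converges pointwise: the slice over \<open>x\<close> becomes the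
  interval of all \<open>s\<close> with \<open>\<bar>s\<bar>\<close> below the area density, of length twice that
  density. The Lipschitz bound provides the dominating function. Continuity of the
  weight is asked at points of \<open>S\<close> only, since the weights of a partition of unity are quotients that
  may be discontinuous where the sum of the bumps vanishes.\<close>

lemma
  fixes \<phi> :: "'a \<Rightarrow> real"
  assumes [measurable]: "\<phi> \<in> borel_measurable borel"
    and bound: "\<And>y. 0 \<le> \<phi> y" "\<And>y. \<phi> y \<le> M"
    and supp: "\<And>y. y \<notin> ball q r \<Longrightarrow> \<phi> y = 0"
    and cont: "\<And>p. p \<in> S \<Longrightarrow> isCont \<phi> p"
  shows tube_mean_tendsto_graph_integral:
      "(tube_mean S \<phi> \<longlongrightarrow> (\<integral>\<^sup>+y. ennreal (\<phi> y) \<partial>graph_measure)) (at_right 0)"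
    and graph_integral_finite: "(\<integral>\<^sup>+y. ennreal (\<phi> y) \<partial>graph_measure) < \<infinity>"
proof -
  let ?H = "hyperplane_lborel b" and ?P = "hyperplane_proj b"
  interpret H: sigma_finite_measure ?H by (rule sigma_finite_hyperplane_lborel[OF basis])
  interpret HL: pair_sigma_finite ?H "lborel :: real measure" by standard
  \<comment> \<open>With \<open>z = (x, s)\<close>: the rescaled point, the integrand at scale \<open>\<epsilon>\<close>, its limit, and the dominating
    function.\<close>
  define y where "y \<epsilon> z = fst z + (height (fst z) + \<epsilon> * snd z) *\<^sub>R b" for \<epsilon> :: real and z :: "'a \<times> real"
  define u where "u \<epsilon> z = ennreal (\<phi> (y \<epsilon> z) / 2) * indicator {y. infdist y S < \<epsilon>} (y \<epsilon> z)" for \<epsilon> z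
  define u0 where "u0 z = ennreal (\<phi> (y 0 z) / 2) * indicator {z. \<bar>snd z\<bar> < density_on (fst z)} z" for z
  define B where "B = cball (?P q) r \<times> {-(1+L)..1+L}"
  define w where "w z = ennreal M * indicator B z" for z :: "'a \<times> real"
  have [measurable]: "B \<in> sets (?H \<Otimes>\<^sub>M lborel)" unfolding B_def by (rule pair_measureI) auto
  have [measurable]: "y \<epsilon> \<in> borel_measurable (?H \<Otimes>\<^sub>M lborel)" for \<epsilon> unfolding y_def by measurable
  have [measurable]: "{y. infdist y S < \<epsilon>} \<in> sets borel" for \<epsilon>
    by (intro borel_open open_Collect_less continuous_intros)
  have um [measurable]: "u \<epsilon> \<in> borel_measurable (?H \<Otimes>\<^sub>M lborel)" for \<epsilon> unfolding u_def by measurable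
  have [measurable]: "u0 \<in> borel_measurable (?H \<Otimes>\<^sub>M lborel)" unfolding u0_def by measurable
  have [measurable]: "w \<in> borel_measurable (?H \<Otimes>\<^sub>M lborel)" unfolding w_def by measurable
  have slice: "tube_mean S \<phi> \<epsilon> = (\<integral>\<^sup>+z. u \<epsilon> z \<partial>(?H \<Otimes>\<^sub>M lborel))" if "\<epsilon> > 0" for \<epsilon>
  proof -
    define f where "f y = ennreal (1 / (2 * \<epsilon>)) * (ennreal (\<phi> y) * indicator {y. infdist y S < \<epsilon>} y)" for y
    have [measurable]: "f \<in> borel_measurable borel" unfolding f_def by measurable
    have "(\<integral>\<^sup>+t. f (x + t *\<^sub>R b) \<partial>lborel) = (\<integral>\<^sup>+s. u \<epsilon> (x, s) \<partial>lborel)" for x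
    proof -
      have "(\<integral>\<^sup>+t. f (x + t *\<^sub>R b) \<partial>lborel) =
          ennreal \<epsilon> * (\<integral>\<^sup>+s. f (x + (height x + \<epsilon> * s) *\<^sub>R b) \<partial>lborel)"
        using nn_integral_real_affine[of "\<lambda>t. f (x + t *\<^sub>R b)" \<epsilon> "height x"] that by simp
      also have "\<dots> = (\<integral>\<^sup>+s. ennreal \<epsilon> * f (x + (height x + \<epsilon> * s) *\<^sub>R b) \<partial>lborel)"
        by (rule nn_integral_cmult[symmetric]) measurable
      also have "\<dots> = (\<integral>\<^sup>+s. u \<epsilon> (x, s) \<partial>lborel)"
      proof (intro nn_integral_cong)
        fix s
        have "ennreal \<epsilon> * (ennreal (1 / (2 * \<epsilon>)) * ennreal (\<phi> (y \<epsilon> (x, s)))) = ennreal (\<phi> (y \<epsilon> (x, s)) / 2)"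
          using that bound(1) by (simp flip: ennreal_mult)
        then show "ennreal \<epsilon> * f (x + (height x + \<epsilon> * s) *\<^sub>R b) = u \<epsilon> (x, s)"
          by (simp add: f_def u_def y_def mult.assoc[symmetric])
      qed
      finally show ?thesis .
    qed
    then have "(\<integral>\<^sup>+y. f y \<partial>lborel) = (\<integral>\<^sup>+x. \<integral>\<^sup>+s. u \<epsilon> (x, s) \<partial>lborel \<partial>?H)"
      by (simp add: nn_integral_lborel_hyperplane[OF basis])
    also have "\<dots> = (\<integral>\<^sup>+z. u \<epsilon> z \<partial>(?H \<Otimes>\<^sub>M lborel))"
      by (rule lborel.nn_integral_fst[OF um])
    finally show ?thesis unfolding f_def tube_mean_def .
  qed
  have lim: "(\<integral>\<^sup>+z. u0 z \<partial>(?H \<Otimes>\<^sub>M lborel)) = (\<integral>\<^sup>+y. ennreal (\<phi> y) \<partial>graph_measure)"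
  proof -
    have "(\<integral>\<^sup>+s. u0 (x, s) \<partial>lborel) = ennreal (density_on x) * ennreal (\<phi> (x + height x *\<^sub>R b))" for x
    proof -
      have "(\<integral>\<^sup>+s. u0 (x, s) \<partial>lborel) =
          (\<integral>\<^sup>+s. ennreal (\<phi> (x + height x *\<^sub>R b) / 2) * indicator {- density_on x <..< density_on x} s \<partial>lborel)"
        by (intro nn_integral_cong) (auto simp: u0_def y_def indicator_def)
      also have "\<dots> = ennreal (\<phi> (x + height x *\<^sub>R b) / 2) * ennreal (2 * density_on x)"
        using density_on_nonneg[of x] by (simp add: nn_integral_cmult_indicator)
      also have "\<dots> = ennreal (density_on x) * ennreal (\<phi> (x + height x *\<^sub>R b))"
        using density_on_nonneg[of x] bound(1) by (simp flip: ennreal_mult)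
      finally show ?thesis .
    qed
    then show ?thesis
      by (simp flip: lborel.nn_integral_fst add: nn_integral_graph_measure)
  qed
  have w_fin: "(\<integral>\<^sup>+z. w z \<partial>(?H \<Otimes>\<^sub>M lborel)) < \<infinity>"
  proof -
    have "(\<integral>\<^sup>+z. w z \<partial>(?H \<Otimes>\<^sub>M lborel)) = ennreal M * emeasure (?H \<Otimes>\<^sub>M lborel) B"
      unfolding w_def by (rule nn_integral_cmult_indicator) measurable
    also have "emeasure (?H \<Otimes>\<^sub>M lborel) B = emeasure ?H (cball (?P q) r) * ennreal (2 * (1 + L))"
      unfolding B_def using L_nonneg by (subst lborel.emeasure_pair_measure_Times) auto
    finally have "(\<integral>\<^sup>+z. w z \<partial>(?H \<Otimes>\<^sub>M lborel)) =
      ennreal M * (emeasure ?H (cball (?P q) r) * ennreal (2 * (1 + L)))" .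
    then show ?thesis
      using emeasure_hyperplane_lborel_bounded[OF basis, of "cball (?P q) r"]
      by (simp add: ennreal_mult_less_top)
  qed
  have AE0: "AE z in ?H \<Otimes>\<^sub>M lborel. fst z \<bullet> b = 0 \<and> \<bar>snd z\<bar> \<noteq> density_on (fst z)"
  proof (rule HL.AE_pair_measure)
    show "{z \<in> space (?H \<Otimes>\<^sub>M lborel). fst z \<bullet> b = 0 \<and> \<bar>snd z\<bar> \<noteq> density_on (fst z)} \<in> sets (?H \<Otimes>\<^sub>M lborel)"
      by measurable
    have "AE s in lborel. \<bar>s\<bar> \<noteq> c" for c :: real
    proof -
      have "AE s in lborel. s \<noteq> c" "AE s in lborel. s \<noteq> - c" by (rule AE_lborel_singleton)+
      then show ?thesis by eventually_elim auto
    qed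
    then show "AE x in ?H. AE s in lborel. fst (x, s) \<bullet> b = 0 \<and> \<bar>snd (x, s)\<bar> \<noteq> density_on (fst (x, s))"
      using AE_hyperplane_lborel[OF basis] by (auto elim!: eventually_mono)
  qed
  have dom: "u \<epsilon> z \<le> w z" if z: "fst z \<bullet> b = 0" and "\<epsilon> > 0" for \<epsilon> z
  proof (cases "y \<epsilon> z \<in> ball q r \<and> infdist (y \<epsilon> z) S < \<epsilon>")
    case True
    have P: "?P (y \<epsilon> z) = fst z" using z basis by (simp add: y_def hyperplane_proj_id)
    have "y \<epsilon> z \<in> ball q (3 * r)" using True radius by auto
    then have "?P (y \<epsilon> z) \<in> U" using proj_ball by (simp add: image_subset_iff)
    then have "fst z \<in> U" by (simp only: P)
    then have "y \<epsilon> z \<bullet> b - g (?P (y \<epsilon> z)) = \<epsilon> * snd z"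
      using z basis unfolding P by (simp add: y_def height_def inner_add_left)
    then have "\<epsilon> * \<bar>snd z\<bar> \<le> \<epsilon> * (1 + L)"
      using height_bound_in_tube[of "y \<epsilon> z" \<epsilon>] True \<open>\<epsilon> > 0\<close> by (simp add: abs_mult mult.commute)
    then have "\<bar>snd z\<bar> \<le> 1 + L" using \<open>\<epsilon> > 0\<close> by simp
    moreover have "norm (fst z - ?P q) \<le> r"
      using norm_hyperplane_proj_le[OF basis, of "y \<epsilon> z - q"] True
      by (auto simp: hyperplane_proj_diff P dist_norm norm_minus_commute)
    then have "fst z \<in> cball (?P q) r" by (simp add: dist_norm norm_minus_commute)
    ultimately have "z \<in> B" by (auto simp: B_def mem_Times_iff abs_le_iff)
    then have "w z = ennreal M" by (simp add: w_def)
    moreover have "\<phi> (y \<epsilon> z) / 2 \<le> M" using bound(1)[of "y \<epsilon> z"] bound(2)[of "y \<epsilon> z"] by linarith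
    then have "u \<epsilon> z \<le> ennreal M" by (auto simp: u_def indicator_def intro: ennreal_leI)
    ultimately show ?thesis by simp
  next
    case False
    then have "u \<epsilon> z = 0" using supp[of "y \<epsilon> z"] by (auto simp: u_def indicator_def)
    then show ?thesis by simp
  qed
  have ptw: "((\<lambda>\<epsilon>. u \<epsilon> z) \<longlongrightarrow> u0 z) (at_right 0)"
    if z: "fst z \<bullet> b = 0" "\<bar>snd z\<bar> \<noteq> density_on (fst z)" for z
  proof -
    obtain x s where [simp]: "z = (x, s)" by (cases z)
    have x: "x \<bullet> b = 0" using z by simp
    have ylim: "((\<lambda>\<epsilon>. y \<epsilon> z) \<longlongrightarrow> y 0 z) (at_right 0)"
      unfolding y_def by (intro tendsto_intros)
    have const0: ?thesis if "\<forall>\<^sub>F \<epsilon> in at_right 0. u \<epsilon> z = 0" "u0 z = 0"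
      using tendsto_eventually[OF that(1)] that(2) by simp
    \<comment> \<open>If \<open>x \<notin> U\<close> the line over \<open>x\<close> misses the support of \<open>\<phi>\<close>; if the graph point over \<open>x\<close> lies
      outside the large ball, the rescaled points leave the support as \<open>\<epsilon>\<close> tends to zero.\<close>
    consider "x \<notin> U" | "x \<in> U" "y 0 z \<notin> ball q (3 * r)" | "x \<in> U" "y 0 z \<in> ball q (3 * r)" by blast
    then show ?thesis
    proof cases
      case 1
      have P: "?P (y \<epsilon> z) = x" for \<epsilon> using x basis by (simp add: y_def hyperplane_proj_id)
      have "y \<epsilon> z \<notin> ball q r" for \<epsilon>
      proof
        assume "y \<epsilon> z \<in> ball q r"
        then have "y \<epsilon> z \<in> ball q (3 * r)" using radius by auto
        then have "?P (y \<epsilon> z) \<in> U" using proj_ball by (simp add: image_subset_iff)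
        with 1 show False by (simp only: P)
      qed
      then show ?thesis using supp by (intro const0) (simp_all add: u_def u0_def)
    next
      case 2
      have "y 0 z \<in> - cball q r" using 2 radius by auto
      then have "\<forall>\<^sub>F \<epsilon> in at_right 0. y \<epsilon> z \<in> - cball q r"
        by (intro topological_tendstoD[OF ylim]) auto
      then have "\<forall>\<^sub>F \<epsilon> in at_right 0. u \<epsilon> z = 0"
        by (rule eventually_mono) (use supp in \<open>auto simp: u_def\<close>)
      moreover have "u0 z = 0" using \<open>y 0 z \<in> - cball q r\<close> supp by (auto simp: u0_def)
      ultimately show ?thesis by (rule const0)
    next
      case 3
      let ?c = "graph_area_density b g x"
      have c: "?c > 0" "density_on x = ?c"
        using graph_area_density_ge_1[of b g x] 3 by (auto simp: density_on_def)
      have y0: "y 0 z = x + g x *\<^sub>R b" using 3 by (simp add: y_def height_def)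
      then have "y 0 z \<in> S" using 3 x patch_sub by (auto simp: patch_def)
      have yy: "y \<epsilon> z = x + (g x + \<epsilon> * s) *\<^sub>R b" for \<epsilon> using 3 by (simp add: y_def height_def)
      have l: "((\<lambda>\<epsilon>. infdist (y \<epsilon> z) S / \<epsilon>) \<longlongrightarrow> \<bar>s\<bar> / ?c) (at_right 0)"
        unfolding yy using 3 x y0 by (intro infdist_along_axis) auto
      have pos: "\<forall>\<^sub>F \<epsilon>::real in at_right 0. \<epsilon> > 0" by (rule eventually_at_right_less)
      show ?thesis
      proof (cases "\<bar>s\<bar> < ?c")
        case True
        then have "\<bar>s\<bar> / ?c < 1" using c by simp
        from order_tendstoD(2)[OF l this] pos
        have "\<forall>\<^sub>F \<epsilon> in at_right 0. ennreal (\<phi> (y \<epsilon> z) / 2) = u \<epsilon> z"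
          by eventually_elim (auto simp: u_def indicator_def divide_less_eq)
        moreover have "((\<lambda>\<epsilon>. \<phi> (y \<epsilon> z)) \<longlongrightarrow> \<phi> (y 0 z)) (at_right 0)"
          using isCont_tendsto_compose[OF cont[OF \<open>y 0 z \<in> S\<close>] ylim] .
        then have "((\<lambda>\<epsilon>. ennreal (\<phi> (y \<epsilon> z) / 2)) \<longlongrightarrow> ennreal (\<phi> (y 0 z) / 2)) (at_right 0)"
          by (intro tendsto_ennrealI tendsto_divide) auto
        ultimately show ?thesis
          using True c by (subst tendsto_cong[symmetric]) (auto simp: u0_def elim: tendsto_cong)
      next
        case False
        then have "1 < \<bar>s\<bar> / ?c" using c z by simp
        from order_tendstoD(1)[OF l this] pos
        have "\<forall>\<^sub>F \<epsilon> in at_right 0. u \<epsilon> z = 0"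
          by eventually_elim (auto simp: u_def indicator_def less_divide_eq)
        moreover have "u0 z = 0" using False c by (auto simp: u0_def)
        ultimately show ?thesis by (rule const0)
      qed
    qed
  qed
  have "AE z in ?H \<Otimes>\<^sub>M lborel. u0 z \<le> w z"
    using AE0
  proof (rule eventually_mono)
    fix z assume z: "fst z \<bullet> b = 0 \<and> \<bar>snd z\<bar> \<noteq> density_on (fst z)"
    have "\<forall>\<^sub>F \<epsilon>::real in at_right 0. \<epsilon> > 0" by (rule eventually_at_right_less)
    then have "\<forall>\<^sub>F \<epsilon> in at_right 0. u \<epsilon> z \<le> w z" by (rule eventually_mono) (use dom z in auto)
    then show "u0 z \<le> w z" using z by (intro tendsto_upperbound[OF ptw]) auto
  qed
  then have "(\<integral>\<^sup>+z. u0 z \<partial>(?H \<Otimes>\<^sub>M lborel)) \<le> (\<integral>\<^sup>+z. w z \<partial>(?H \<Otimes>\<^sub>M lborel))"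
    by (rule nn_integral_mono_AE)
  then show "(\<integral>\<^sup>+y. ennreal (\<phi> y) \<partial>graph_measure) < \<infinity>"
    using w_fin unfolding lim by (rule order.strict_trans1)
  show "(tube_mean S \<phi> \<longlongrightarrow> (\<integral>\<^sup>+y. ennreal (\<phi> y) \<partial>graph_measure)) (at_right 0)"
  proof (rule tendsto_at_right_sequentially[of 0 1])
    fix e :: "nat \<Rightarrow> real" assume e: "\<And>n. 0 < e n" "e \<longlonglongrightarrow> 0"
    have e0: "filterlim e (at_right 0) sequentially"
      using e by (intro tendsto_imp_filterlim_at_right) auto
    have "(\<lambda>n. \<integral>\<^sup>+z. u (e n) z \<partial>(?H \<Otimes>\<^sub>M lborel)) \<longlonglongrightarrow> (\<integral>\<^sup>+z. u0 z \<partial>(?H \<Otimes>\<^sub>M lborel))"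
    proof (rule nn_integral_dominated_convergence[where w=w])
      show "AE z in ?H \<Otimes>\<^sub>M lborel. u (e n) z \<le> w z" for n
        using AE0 by (rule eventually_mono) (use dom e in auto)
      show "AE z in ?H \<Otimes>\<^sub>M lborel. (\<lambda>n. u (e n) z) \<longlonglongrightarrow> u0 z"
        using AE0 by (rule eventually_mono) (use filterlim_compose[OF ptw e0] in auto)
    qed (use w_fin in auto)
    then show "(\<lambda>n. tube_mean S \<phi> (e n)) \<longlonglongrightarrow> (\<integral>\<^sup>+y. ennreal (\<phi> y) \<partial>graph_measure)"
      by (simp add: slice e lim)
  qed simp
qed

end

section \<open>Gluing and comparing Borel measures\<close>

lemma exists_finite_sum_measure:
  assumes "finite I" "\<And>i. i \<in> I \<Longrightarrow> sets (M i) = sets N"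
  obtains \<sigma> where "sets \<sigma> = sets N"
    "\<And>f. f \<in> borel_measurable N \<Longrightarrow> (\<integral>\<^sup>+x. f x \<partial>\<sigma>) = (\<Sum>i\<in>I. \<integral>\<^sup>+x. f x \<partial>M i)"
proof -
  define \<sigma> where "\<sigma> = measure_of (space N) (sets N) (\<lambda>A. \<Sum>i\<in>I. emeasure (M i) A)"
  have sets: "sets \<sigma> = sets N" by (simp add: \<sigma>_def)
  have em: "emeasure \<sigma> A = (\<Sum>i\<in>I. emeasure (M i) A)" if "A \<in> sets N" for A
  proof (rule emeasure_measure_of[OF \<sigma>_def sets.space_closed])
    show "A \<in> sets \<sigma>" using that sets by simp
    show "positive (sets \<sigma>) (\<lambda>A. \<Sum>i\<in>I. emeasure (M i) A)" by (simp add: positive_def)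
    show "countably_additive (sets \<sigma>) (\<lambda>A. \<Sum>i\<in>I. emeasure (M i) A)"
    proof (rule countably_additiveI)
      fix A :: "nat \<Rightarrow> _" assume A: "range A \<subseteq> sets \<sigma>" "disjoint_family A"
      have "(\<Sum>n. \<Sum>i\<in>I. emeasure (M i) (A n)) = (\<Sum>i\<in>I. \<Sum>n. emeasure (M i) (A n))"
        by (rule suminf_sum) simp
      also have "\<dots> = (\<Sum>i\<in>I. emeasure (M i) (\<Union>n. A n))"
        using A sets assms by (intro sum.cong refl suminf_emeasure) auto
      finally show "(\<Sum>n. \<Sum>i\<in>I. emeasure (M i) (A n)) = (\<Sum>i\<in>I. emeasure (M i) (\<Union>n. A n))" .
    qed
  qed
  have meas: "borel_measurable \<sigma> = borel_measurable N"
      "\<And>i. i \<in> I \<Longrightarrow> borel_measurable (M i) = borel_measurable N"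
    using sets assms by (auto intro!: measurable_cong_sets)
  have "(\<integral>\<^sup>+x. f x \<partial>\<sigma>) = (\<Sum>i\<in>I. \<integral>\<^sup>+x. f x \<partial>M i)" if "f \<in> borel_measurable N" for f
    using that
  proof (induction rule: borel_measurable_induct)
    case (cong f g)
    have "(\<integral>\<^sup>+x. f x \<partial>L) = (\<integral>\<^sup>+x. g x \<partial>L)" if "sets L = sets N" for L
      using cong(3) sets_eq_imp_space_eq[OF that] by (intro nn_integral_cong) auto
    then show ?case using cong sets assms by simp
  next
    case (set A)
    then show ?case using sets assms em by simp
  next
    case (mult u c)
    then show ?case by (simp add: nn_integral_cmult meas sum_distrib_left)
  next
    case (add u v)
    then show ?case by (simp add: nn_integral_add meas sum.distrib)
  next
    case (seq U)
    have s: "(\<integral>\<^sup>+x. (SUP n. U n x) \<partial>L) = (SUP n. \<integral>\<^sup>+x. U n x \<partial>L)" if "sets L = sets N" for L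
    proof -
      have "borel_measurable L = borel_measurable N" using that by (auto intro!: measurable_cong_sets)
      then show ?thesis using seq by (intro nn_integral_monotone_convergence_SUP) auto
    qed
    have inc: "incseq (\<lambda>n. \<integral>\<^sup>+x. U n x \<partial>L)" for L
      using \<open>incseq U\<close> by (auto simp: incseq_def le_fun_def intro!: nn_integral_mono)
    have "(\<integral>\<^sup>+x. (SUP n. U n x) \<partial>\<sigma>) = (SUP n. \<Sum>i\<in>I. \<integral>\<^sup>+x. U n x \<partial>M i)"
      using seq by (simp add: s sets)
    also have "\<dots> = (\<Sum>i\<in>I. SUP n. \<integral>\<^sup>+x. U n x \<partial>M i)"
      by (rule ennreal_SUP_sum[OF inc])
    also have "\<dots> = (\<Sum>i\<in>I. \<integral>\<^sup>+x. (SUP n. U n x) \<partial>M i)"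
      using assms by (intro sum.cong refl s[symmetric]) auto
    finally show ?case by (simp add: SUP_apply image_comp)
  qed
  with sets show thesis by (rule that)
qed

lemma borel_measures_eq_if_eq_on_open:
  fixes \<mu> \<nu> :: "'a::topological_space measure"
  assumes [measurable_cong]: "sets \<mu> = sets borel" "sets \<nu> = sets borel" and "open B"
    and eq: "\<And>V. open V \<Longrightarrow> V \<subseteq> B \<Longrightarrow> emeasure \<mu> V = emeasure \<nu> V" and "emeasure \<mu> B < \<infinity>"
    and "A \<in> sets borel" "A \<subseteq> B"
  shows "emeasure \<mu> A = emeasure \<nu> A"
proof -
  let ?\<mu> = "density \<mu> (indicator B)" and ?\<nu> = "density \<nu> (indicator B)"
  have [measurable]: "B \<in> sets borel" using \<open>open B\<close> by auto
  have r: "emeasure (density \<rho> (indicator B)) X = emeasure \<rho> (X \<inter> B)"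
    if "X \<in> sets borel" "sets \<rho> = sets borel" for X and \<rho> :: "'a measure"
  proof -
    have [measurable_cong]: "sets \<rho> = sets borel" by fact
    have [measurable]: "X \<in> sets borel" by fact
    have "emeasure (density \<rho> (indicator B)) X = (\<integral>\<^sup>+x. indicator B x * indicator X x \<partial>\<rho>)"
      by (rule emeasure_density) measurable
    also have "\<dots> = (\<integral>\<^sup>+x. indicator (X \<inter> B) x \<partial>\<rho>)"
      by (intro nn_integral_cong) (auto simp: indicator_def)
    also have "\<dots> = emeasure \<rho> (X \<inter> B)" by (rule nn_integral_indicator) measurable
    finally show ?thesis .
  qed
  have "?\<mu> = ?\<nu>"
  proof (rule measure_eqI_generator_eq[where E="Collect open" and \<Omega>=UNIV and A="\<lambda>_::nat. UNIV"])
    show "Int_stable (Collect open)" by (auto simp: Int_stable_def)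
    show "emeasure ?\<mu> X = emeasure ?\<nu> X" if "X \<in> Collect open" for X
      using that assms by (auto simp: r intro!: eq)
    show "emeasure ?\<mu> UNIV \<noteq> \<infinity>" using assms by (simp add: r)
  qed (use assms in \<open>auto simp: borel_def\<close>)
  then have "emeasure \<mu> (A \<inter> B) = emeasure \<nu> (A \<inter> B)" using r assms by metis
  then show ?thesis using \<open>A \<subseteq> B\<close> by (simp add: Int_absorb2)
qed

text \<open>By the Lindelof property countably many of the neighbourhoods cover \<open>A\<close>; making them disjoint
  cuts \<open>A\<close> into countably many pieces on which the measures agree.\<close>

lemma borel_measures_eq_if_eq_locally:
  fixes \<mu> \<nu> :: "'a::second_countable_topology measure"
  assumes sets: "sets \<mu> = sets borel" "sets \<nu> = sets borel" and A: "A \<in> sets borel"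
    and loc: "\<And>p. p \<in> A \<Longrightarrow> \<exists>B. open B \<and> p \<in> B \<and>
      (\<forall>X. X \<in> sets borel \<longrightarrow> X \<subseteq> B \<longrightarrow> emeasure \<mu> X = emeasure \<nu> X)"
  shows "emeasure \<mu> A = emeasure \<nu> A"
proof (cases "A = {}")
  case False
  obtain B where B: "\<And>p. p \<in> A \<Longrightarrow> open (B p)" "\<And>p. p \<in> A \<Longrightarrow> p \<in> B p"
      "\<And>p X. p \<in> A \<Longrightarrow> X \<in> sets borel \<Longrightarrow> X \<subseteq> B p \<Longrightarrow> emeasure \<mu> X = emeasure \<nu> X"
    using loc by metis
  obtain \<B> where \<B>: "\<B> \<subseteq> B ` A" "countable \<B>" "\<Union>\<B> = \<Union>(B ` A)"
    using Lindelof[of "B ` A"] B(1) by auto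
  have "\<B> \<noteq> {}" using \<B>(3) B(2) False by auto
  define C where "C = from_nat_into \<B>"
  have C: "range C = \<B>" using range_from_nat_into[OF \<open>\<B> \<noteq> {}\<close> \<B>(2)] by (simp add: C_def)
  have Cb: "C n \<in> B ` A" for n using C \<B>(1) by blast
  then have Cm: "range C \<subseteq> sets borel" using B(1) by (auto intro!: borel_open) (metis imageE)
  define D where "D n = A \<inter> disjointed C n" for n
  have Dm: "D n \<in> sets borel" for n
    using sets.range_disjointed_sets[OF Cm] A by (auto simp: D_def)
  have DA: "A = (\<Union>n. D n)"
    using B(2) \<B>(3) C UN_disjointed_eq[of C] by (auto simp: D_def)
  have dis: "disjoint_family D"
    using disjoint_family_disjointed[of C] by (auto simp: D_def disjoint_family_on_def)
  have "emeasure \<mu> (D n) = emeasure \<nu> (D n)" for n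
  proof -
    obtain p where "p \<in> A" "C n = B p" using Cb by blast
    moreover have "D n \<subseteq> C n" using disjointed_subset[of C n] by (auto simp: D_def)
    ultimately show ?thesis using B(3) Dm by metis
  qed
  moreover have "emeasure \<rho> A = (\<Sum>n. emeasure \<rho> (D n))" if "sets \<rho> = sets borel" for \<rho> :: "'a measure"
    unfolding DA using Dm dis that by (intro suminf_emeasure[symmetric]) auto
  ultimately show ?thesis using sets by simp
qed simp

section \<open>The area measure of a compact hypersurface\<close>

text \<open>Area as Minkowski content, in weak form. Unlike the description by graphs it does not
  depend on charts, which is what makes the local graph measures fit together.\<close>

definition minkowski_measure :: "'a::euclidean_space set \<Rightarrow> 'a measure \<Rightarrow> bool" where
  "minkowski_measure S \<sigma> \<longleftrightarrow> sets \<sigma> = sets borel \<and> emeasure \<sigma> (- S) = 0 \<and> emeasure \<sigma> UNIV < \<infinity> \<and>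
     (\<forall>\<phi> M. \<phi> \<in> borel_measurable borel \<longrightarrow> (\<forall>y. 0 \<le> \<phi> y \<and> \<phi> y \<le> M) \<longrightarrow> (\<forall>p\<in>S. isCont \<phi> p) \<longrightarrow>
       (tube_mean S \<phi> \<longlongrightarrow> (\<integral>\<^sup>+y. ennreal (\<phi> y) \<partial>\<sigma>)) (at_right 0))"

lemma (in graph_patch) exists_graph_ball:
  assumes "smooth_hypersurface S" "closed S" "patch \<subseteq> S" "p \<in> patch"
  obtains r L where "graph_ball b U g S p r L"
proof -
  let ?P = "hyperplane_proj b"
  obtain r0 where r0: "r0 > 0" "?P ` ball p r0 \<subseteq> U" "S \<inter> ball p r0 \<subseteq> patch"
    using smooth_hypersurface_coincides_with_graph[OF assms(1) basis open_dom smooth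
        assms(3,4)[unfolded patch_def]] unfolding patch_def .
  have "?P p \<in> U" using r0 by auto
  obtain r1 L where r1: "r1 > 0" "ball (?P p) r1 \<subseteq> U" "0 \<le> L"
      "\<And>x y. x \<in> ball (?P p) r1 \<Longrightarrow> y \<in> ball (?P p) r1 \<Longrightarrow> \<bar>g x - g y\<bar> \<le> L * norm (x - y)"
    by (rule smooth_on_locally_lipschitz[OF smooth open_dom \<open>?P p \<in> U\<close>]) blast
  define r where "r = min r0 r1 / 3"
  have sub: "ball p (3 * r) \<subseteq> ball p r0" by (auto simp: r_def)
  have "?P y \<in> ball (?P p) r1" if "y \<in> ball p (3 * r)" for y
    using that norm_hyperplane_proj_le[OF basis, of "p - y"]
    by (auto simp: r_def dist_norm hyperplane_proj_diff)
  then have "?P ` ball p (3 * r) \<subseteq> ball (?P p) r1" by blast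
  then have lip: "\<bar>g x - g y\<bar> \<le> L * norm (x - y)"
    if "x \<in> ?P ` ball p (3 * r)" "y \<in> ?P ` ball p (3 * r)" for x y
    using r1(4) that by blast
  have "graph_ball b U g S p r L"
  proof
    show "p \<in> S" using assms by blast
    show "r > 0" using r0 r1 by (simp add: r_def)
    show "S \<inter> ball p (3 * r) \<subseteq> patch" "?P ` ball p (3 * r) \<subseteq> U" using r0 sub by blast+
  qed (use assms r1 lip in auto)
  then show thesis by (rule that)
qed

lemma smooth_hypersurface_graph_ball:
  assumes "smooth_hypersurface S" "closed S" "p \<in> S"
  obtains b U g r L where "graph_ball b U g S p r L"
proof -
  obtain b U and g where g: "b \<in> Basis" "open U" "smooth_on U g"
      "(\<lambda>x. x + g x *\<^sub>R b) ` (U \<inter> {x. x \<bullet> b = 0}) \<subseteq> S"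
      "p \<in> (\<lambda>x. x + g x *\<^sub>R b) ` (U \<inter> {x. x \<bullet> b = 0})"
    using smooth_hypersurface_local_graph[OF assms(1,3)] .
  interpret graph_patch b U g by unfold_locales fact+
  obtain r L where "graph_ball b U g S p r L"
    using exists_graph_ball[OF assms(1,2) g(4,5)[folded patch_def]] .
  then show thesis by (rule that)
qed

text \<open>The graph measures of finitely many small balls are added with the weights of a partition of
  unity. Each weight is supported in its ball, where the tube limit is known, and for small \<open>\<epsilon>\<close> the
  weights add up to one on the whole tube.\<close>

lemma exists_minkowski_measure:
  fixes S :: "'a::euclidean_space set"
  assumes "smooth_hypersurface S" "compact S" "S \<noteq> {}"
  obtains \<sigma> where "minkowski_measure S \<sigma>"
proof -
  have "closed S" using assms compact_imp_closed by blast
  have "\<exists>b U g r L. graph_ball b U g S p r L" if p: "p \<in> S" for p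
  proof -
    obtain b U g r L where "graph_ball b U g S p r L"
      using smooth_hypersurface_graph_ball[OF assms(1) \<open>closed S\<close> p] .
    then show ?thesis by (intro exI)
  qed
  then obtain b U g r L where gb: "\<And>p. p \<in> S \<Longrightarrow> graph_ball (b p) (U p) (g p) S p (r p) (L p)"
    by metis
  have rpos: "r p > 0" if "p \<in> S" for p using graph_ball.radius[OF gb[OF that]] .
  obtain P where P: "P \<subseteq> S" "finite P" "S \<subseteq> (\<Union>p\<in>P. ball p (r p))"
  proof (rule compactE_image[OF \<open>compact S\<close>, of S "\<lambda>p. ball p (r p)"])
    show "S \<subseteq> (\<Union>p\<in>S. ball p (r p))" using rpos by (auto intro: centre_in_ball[THEN iffD2])
  qed auto
  define \<theta> where "\<theta> p x = max 0 (r p - dist p x)" for p x :: 'a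
  define \<Theta> where "\<Theta> x = (\<Sum>p\<in>P. \<theta> p x)" for x
  define \<psi> where "\<psi> p x = \<theta> p x / \<Theta> x" for p x
  have \<theta>0: "\<theta> p x \<ge> 0" for p x by (simp add: \<theta>_def)
  have \<theta>pos: "\<theta> p x > 0 \<longleftrightarrow> x \<in> ball p (r p)" for p x by (auto simp: \<theta>_def)
  have \<Theta>pos: "\<Theta> x > 0" if x: "x \<in> (\<Union>p\<in>P. ball p (r p))" for x
  proof -
    obtain p where "p \<in> P" "\<theta> p x > 0" using x \<theta>pos by blast
    then show ?thesis unfolding \<Theta>_def using \<theta>0 P(2) by (intro sum_pos2) auto
  qed
  have cont\<theta>: "continuous_on UNIV (\<theta> p)" for p unfolding \<theta>_def by (intro continuous_intros)
  have cont\<Theta>: "continuous_on UNIV \<Theta>" unfolding \<Theta>_def by (intro continuous_on_sum cont\<theta>)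
  have [measurable]: "\<theta> p \<in> borel_measurable borel" "\<Theta> \<in> borel_measurable borel" for p
    using cont\<theta> cont\<Theta> by (auto intro: borel_measurable_continuous_onI)
  have [measurable]: "\<psi> p \<in> borel_measurable borel" for p unfolding \<psi>_def by measurable
  have \<psi>0: "\<psi> p x \<ge> 0" for p x
    unfolding \<psi>_def \<Theta>_def by (intro divide_nonneg_nonneg sum_nonneg \<theta>0)
  have \<psi>1: "\<psi> p x \<le> 1" if "p \<in> P" for p x
  proof -
    have "\<theta> p x \<le> \<Theta> x" unfolding \<Theta>_def using that P(2) \<theta>0 by (intro member_le_sum) auto
    then show ?thesis using \<theta>0[of p x] by (auto simp: \<psi>_def divide_le_eq)
  qed
  have \<psi>supp: "\<psi> p x = 0" if "x \<notin> ball p (r p)" for p x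
    using that \<theta>pos[of p x] \<theta>0[of p x] by (auto simp: \<psi>_def)
  have \<psi>sum: "(\<Sum>p\<in>P. \<psi> p x) = 1" if "x \<in> (\<Union>p\<in>P. ball p (r p))" for x
    using \<Theta>pos[OF that] by (simp add: \<psi>_def \<Theta>_def flip: sum_divide_distrib)
  have \<psi>cont: "isCont (\<psi> p) x" if "x \<in> S" for p x
  proof -
    have "x \<in> (\<Union>p\<in>P. ball p (r p))" using that P(3) by (rule subsetD[rotated])
    then have "\<Theta> x \<noteq> 0" by (rule \<Theta>pos[THEN less_imp_neq, THEN not_sym])
    moreover have "isCont (\<theta> p) x" "isCont \<Theta> x"
      using cont\<theta>[of p] cont\<Theta> by (simp_all add: continuous_on_eq_continuous_at)
    ultimately show ?thesis unfolding \<psi>_def by (intro isCont_divide)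
  qed
  define \<tau> where "\<tau> p = graph_patch.graph_measure (b p) (U p) (g p)" for p
  have patch: "graph_patch (b p) (U p) (g p)" if "p \<in> P" for p
    using gb P(1) that graph_ball.axioms(1) by blast
  have sets\<tau> [measurable_cong]: "sets (\<tau> p) = sets borel" if "p \<in> P" for p
    unfolding \<tau>_def by (rule graph_patch.sets_graph_measure[OF patch[OF that]])
  obtain \<sigma> where \<sigma>: "sets \<sigma> = sets borel" and
    int\<sigma>: "\<And>f. f \<in> borel_measurable borel \<Longrightarrow>
      (\<integral>\<^sup>+x. f x \<partial>\<sigma>) = (\<Sum>p\<in>P. \<integral>\<^sup>+x. f x \<partial>density (\<tau> p) (\<lambda>x. ennreal (\<psi> p x)))"
    using exists_finite_sum_measure[OF P(2), of "\<lambda>p. density (\<tau> p) (\<lambda>x. ennreal (\<psi> p x))" borel]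
      sets\<tau> by (auto simp: sets_density)
  have int: "(\<integral>\<^sup>+x. f x \<partial>\<sigma>) = (\<Sum>p\<in>P. \<integral>\<^sup>+x. ennreal (\<psi> p x) * f x \<partial>\<tau> p)"
    if [measurable]: "f \<in> borel_measurable borel" for f
  proof -
    have "(\<integral>\<^sup>+x. f x \<partial>density (\<tau> p) (\<lambda>x. ennreal (\<psi> p x))) = (\<integral>\<^sup>+x. ennreal (\<psi> p x) * f x \<partial>\<tau> p)"
      if "p \<in> P" for p
    proof -
      note [measurable_cong] = sets\<tau>[OF that]
      show ?thesis by (rule nn_integral_density) measurable
    qed
    then show ?thesis by (simp add: int\<sigma>)
  qed
  obtain e where e: "e > 0" "(\<Union>x\<in>S. ball x e) \<subseteq> (\<Union>p\<in>P. ball p (r p))"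
    using compact_subset_open_imp_ball_epsilon_subset[OF \<open>compact S\<close> open_UN[OF ballI[OF open_ball]] P(3)] .
  have tube: "y \<in> (\<Union>p\<in>P. ball p (r p))" if "infdist y S < e" for y
  proof -
    obtain x where "x \<in> S" "infdist y S = dist y x"
      using infdist_attains_inf[OF \<open>closed S\<close> \<open>S \<noteq> {}\<close>] by metis
    then have "y \<in> (\<Union>x\<in>S. ball x e)" using that by (auto simp: dist_commute)
    then show ?thesis using e(2) by (rule subsetD[rotated])
  qed
  have lim: "(tube_mean S (\<lambda>y. \<psi> p y * \<phi> y) \<longlongrightarrow> (\<integral>\<^sup>+y. ennreal (\<psi> p y) * ennreal (\<phi> y) \<partial>\<tau> p)) (at_right 0)"
      "(\<integral>\<^sup>+y. ennreal (\<psi> p y) * ennreal (\<phi> y) \<partial>\<tau> p) < \<infinity>"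
    if "p \<in> P" and [measurable]: "\<phi> \<in> borel_measurable borel" and \<phi>: "\<And>y. 0 \<le> \<phi> y" "\<And>y. \<phi> y \<le> M"
      "\<And>x. x \<in> S \<Longrightarrow> isCont \<phi> x" for \<phi> M p
  proof -
    interpret graph_ball "b p" "U p" "g p" S p "r p" "L p" using gb P(1) \<open>p \<in> P\<close> by blast
    have b: "0 \<le> \<psi> p y * \<phi> y" "\<psi> p y * \<phi> y \<le> M" for y
      using \<psi>0[of p y] \<psi>1[OF \<open>p \<in> P\<close>, of y] \<phi>(1,2)[of y] mult_left_le_one_le[of "\<phi> y" "\<psi> p y"] by auto
    have s: "\<psi> p y * \<phi> y = 0" if "y \<notin> ball p (r p)" for y using \<psi>supp[OF that] by simp
    have c: "isCont (\<lambda>y. \<psi> p y * \<phi> y) x" if "x \<in> S" for x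
      using \<psi>cont[OF that] \<phi>(3)[OF that] by (rule isCont_mult)
    show "(tube_mean S (\<lambda>y. \<psi> p y * \<phi> y) \<longlongrightarrow> (\<integral>\<^sup>+y. ennreal (\<psi> p y) * ennreal (\<phi> y) \<partial>\<tau> p)) (at_right 0)"
      "(\<integral>\<^sup>+y. ennreal (\<psi> p y) * ennreal (\<phi> y) \<partial>\<tau> p) < \<infinity>"
      using tube_mean_tendsto_graph_integral[of "\<lambda>y. \<psi> p y * \<phi> y" M, OF _ b s c]
        graph_integral_finite[of "\<lambda>y. \<psi> p y * \<phi> y" M, OF _ b s c] \<psi>0 \<phi>(1)
      by (simp_all add: \<tau>_def ennreal_mult)
  qed
  have "minkowski_measure S \<sigma>"
    unfolding minkowski_measure_def
  proof (intro conjI allI impI)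
    show "sets \<sigma> = sets borel" by fact
    have Sm [measurable]: "S \<in> sets borel" using \<open>closed S\<close> by auto
    have "emeasure \<sigma> (- S) = (\<integral>\<^sup>+x. indicator (- S) x \<partial>\<sigma>)"
      using \<sigma> Sm by (intro nn_integral_indicator[symmetric]) auto
    also have "\<dots> = (\<Sum>p\<in>P. \<integral>\<^sup>+x. ennreal (\<psi> p x) * indicator (- S) x \<partial>\<tau> p)"
      using Sm by (intro int) auto
    also have "\<dots> = (\<Sum>p\<in>P. 0)"
    proof (rule sum.cong)
      fix p assume "p \<in> P"
      interpret graph_ball "b p" "U p" "g p" S p "r p" "L p" using gb P(1) \<open>p \<in> P\<close> by blast
      have "AE x in \<tau> p. ennreal (\<psi> p x) * indicator (- S) x = 0"
        unfolding \<tau>_def using AE_graph_measure patch_sub by (auto elim!: eventually_mono)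
      then have "(\<integral>\<^sup>+x. ennreal (\<psi> p x) * indicator (- S) x \<partial>\<tau> p) = (\<integral>\<^sup>+x. 0 \<partial>\<tau> p)"
        by (rule nn_integral_cong_AE)
      then show "(\<integral>\<^sup>+x. ennreal (\<psi> p x) * indicator (- S) x \<partial>\<tau> p) = 0" by simp
    qed simp
    finally show "emeasure \<sigma> (- S) = 0" by simp
    have "emeasure \<sigma> UNIV = (\<integral>\<^sup>+x. 1 \<partial>\<sigma>)" using \<sigma> sets_eq_imp_space_eq[OF \<sigma>] by simp
    also have "\<dots> = (\<Sum>p\<in>P. \<integral>\<^sup>+x. ennreal (\<psi> p x) * ennreal 1 \<partial>\<tau> p)"
      using int[of "\<lambda>_. 1"] by simp
    also have "\<dots> < \<infinity>"
      using lim(2)[of _ "\<lambda>_. 1" 1] P(2) by (simp add: less_top)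
    finally show "emeasure \<sigma> UNIV < \<infinity>" .
  next
    fix \<phi> :: "'a \<Rightarrow> real" and M
    assume [measurable]: "\<phi> \<in> borel_measurable borel" and \<phi>: "\<forall>y. 0 \<le> \<phi> y \<and> \<phi> y \<le> M"
      and \<phi>c: "\<forall>p\<in>S. isCont \<phi> p"
    have "((\<lambda>\<epsilon>. \<Sum>p\<in>P. tube_mean S (\<lambda>y. \<psi> p y * \<phi> y) \<epsilon>) \<longlongrightarrow>
        (\<Sum>p\<in>P. \<integral>\<^sup>+y. ennreal (\<psi> p y) * ennreal (\<phi> y) \<partial>\<tau> p)) (at_right 0)"
      using \<phi> \<phi>c by (intro tendsto_sum lim) auto
    also have "(\<Sum>p\<in>P. \<integral>\<^sup>+y. ennreal (\<psi> p y) * ennreal (\<phi> y) \<partial>\<tau> p) = (\<integral>\<^sup>+y. ennreal (\<phi> y) \<partial>\<sigma>)"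
      by (rule int[symmetric]) measurable
    finally have l: "((\<lambda>\<epsilon>. \<Sum>p\<in>P. tube_mean S (\<lambda>y. \<psi> p y * \<phi> y) \<epsilon>) \<longlongrightarrow>
        (\<integral>\<^sup>+y. ennreal (\<phi> y) \<partial>\<sigma>)) (at_right 0)" .
    have "(\<Sum>p\<in>P. tube_mean S (\<lambda>y. \<psi> p y * \<phi> y) \<epsilon>) = tube_mean S \<phi> \<epsilon>" if "\<epsilon> < e" for \<epsilon>
    proof -
      have [measurable]: "{y. infdist y S < \<epsilon>} \<in> sets borel"
        by (intro borel_open open_Collect_less continuous_intros)
      have "(\<Sum>p\<in>P. tube_mean S (\<lambda>y. \<psi> p y * \<phi> y) \<epsilon>) =
          (\<integral>\<^sup>+y. (\<Sum>p\<in>P. ennreal (1 / (2 * \<epsilon>)) * (ennreal (\<psi> p y * \<phi> y) * indicator {y. infdist y S < \<epsilon>} y)) \<partial>lborel)"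
        unfolding tube_mean_def by (rule nn_integral_sum[symmetric]) measurable
      also have "\<dots> = tube_mean S \<phi> \<epsilon>"
        unfolding tube_mean_def
      proof (intro nn_integral_cong)
        fix y
        show "(\<Sum>p\<in>P. ennreal (1 / (2 * \<epsilon>)) * (ennreal (\<psi> p y * \<phi> y) * indicator {y. infdist y S < \<epsilon>} y)) =
            ennreal (1 / (2 * \<epsilon>)) * (ennreal (\<phi> y) * indicator {y. infdist y S < \<epsilon>} y)"
        proof (cases "infdist y S < \<epsilon>")
          case True
          have "(\<Sum>p\<in>P. ennreal (\<psi> p y * \<phi> y)) = ennreal (\<phi> y)"
            using \<psi>sum[OF tube[of y]] True that \<psi>0 \<phi> by (simp add: flip: sum_distrib_right)
          then show ?thesis using True by (simp flip: sum_distrib_left)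
        qed simp
      qed
      finally show ?thesis .
    qed
    moreover have "\<forall>\<^sub>F \<epsilon> in at_right 0. \<epsilon> \<in> {0<..<e}"
      using e(1) by (rule eventually_at_right_real)
    ultimately have "\<forall>\<^sub>F \<epsilon> in at_right 0. (\<Sum>p\<in>P. tube_mean S (\<lambda>y. \<psi> p y * \<phi> y) \<epsilon>) = tube_mean S \<phi> \<epsilon>"
      by (auto elim!: eventually_mono)
    with l show "(tube_mean S \<phi> \<longlongrightarrow> (\<integral>\<^sup>+y. ennreal (\<phi> y) \<partial>\<sigma>)) (at_right 0)"
      by (rule Lim_transform_eventually)
  qed
  then show thesis by (rule that)
qed

text \<open>Both sides are limits of the same tube integrals, hence integrate continuous functions supported in
  the ball alike.\<close>

lemma (in graph_ball) minkowski_measure_eq_graph_measure: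
  assumes \<sigma>: "minkowski_measure S \<sigma>" and "X \<in> sets borel" "X \<subseteq> ball q r"
  shows "emeasure \<sigma> X = emeasure graph_measure X"
proof (rule borel_measures_eq_if_eq_on_open[of _ _ "ball q r"])
  show sets\<sigma>: "sets \<sigma> = sets borel" using \<sigma> by (simp add: minkowski_measure_def)
  have "emeasure \<sigma> (ball q r) \<le> emeasure \<sigma> UNIV"
    using sets\<sigma> by (intro emeasure_mono) auto
  also have "\<dots> < \<infinity>" using \<sigma> by (simp add: minkowski_measure_def)
  finally show "emeasure \<sigma> (ball q r) < \<infinity>" .
  fix V :: "'a set" assume V: "open V" "V \<subseteq> ball q r"
  have "q + r *\<^sub>R b \<notin> ball q r" using basis by (simp add: dist_norm)
  with V have "- V \<noteq> {}" by auto
  \<comment> \<open>Continuous functions increasing to the indicator of \<open>V\<close>; both measures integrate them alike.\<close>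
  define h where "h n x = min 1 (real n * infdist x (- V))" for n x
  have hc: "continuous_on UNIV (h n)" for n unfolding h_def by (intro continuous_intros)
  then have [measurable]: "h n \<in> borel_measurable borel" for n by (rule borel_measurable_continuous_onI)
  have h: "0 \<le> h n x" "h n x \<le> 1" for n x by (auto simp: h_def infdist_nonneg)
  have hV: "h n x = 0" if "x \<notin> V" for n x using that by (simp add: h_def)
  have "(\<integral>\<^sup>+x. ennreal (h n x) \<partial>\<sigma>) = (\<integral>\<^sup>+x. ennreal (h n x) \<partial>graph_measure)" for n
  proof (rule tendsto_unique)
    show "(tube_mean S (h n) \<longlongrightarrow> (\<integral>\<^sup>+x. ennreal (h n x) \<partial>graph_measure)) (at_right 0)"
    proof (rule tube_mean_tendsto_graph_integral[of _ 1])
      show "h n y = 0" if "y \<notin> ball q r" for y using that V(2) by (intro hV) blast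
      show "isCont (h n) p" for p using hc[of n] by (simp add: continuous_on_eq_continuous_at)
    qed (use h in auto)
    have "\<forall>p\<in>S. isCont (h n) p" using hc by (simp add: continuous_on_eq_continuous_at)
    moreover have "\<forall>y. 0 \<le> h n y \<and> h n y \<le> 1" using h by auto
    moreover have "h n \<in> borel_measurable borel" by measurable
    ultimately show "(tube_mean S (h n) \<longlongrightarrow> (\<integral>\<^sup>+x. ennreal (h n x) \<partial>\<sigma>)) (at_right 0)"
      using \<sigma> unfolding minkowski_measure_def by blast
  qed simp
  then have eq: "(\<lambda>n. \<integral>\<^sup>+x. ennreal (h n x) \<partial>\<sigma>) = (\<lambda>n. \<integral>\<^sup>+x. ennreal (h n x) \<partial>graph_measure)"
    by simp
  have lim: "(\<lambda>n. \<integral>\<^sup>+x. ennreal (h n x) \<partial>\<rho>) \<longlonglongrightarrow> emeasure \<rho> V" if "sets \<rho> = sets borel" for \<rho> :: "'a measure"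
  proof -
    note [measurable_cong] = that
    have "(\<lambda>n. \<integral>\<^sup>+x. ennreal (h n x) \<partial>\<rho>) \<longlonglongrightarrow> (\<integral>\<^sup>+x. indicator V x \<partial>\<rho>)"
    proof (rule nn_integral_LIMSEQ)
      show "incseq (\<lambda>n x. ennreal (h n x))"
        by (auto simp: incseq_def le_fun_def h_def intro!: ennreal_leI min.mono mult_right_mono infdist_nonneg)
      show "(\<lambda>n. ennreal (h n x)) \<longlonglongrightarrow> indicator V x" for x
      proof (cases "x \<in> V")
        case True
        have "infdist x (- V) > 0"
          using True V(1) \<open>- V \<noteq> {}\<close> by (intro infdist_pos_not_in_closed) auto
        then obtain N where N: "1 < real N * infdist x (- V)" using reals_Archimedean3 by blast
        have "h n x = 1" if "n \<ge> N" for n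
        proof -
          have "real N * infdist x (- V) \<le> real n * infdist x (- V)"
            using that by (intro mult_right_mono) (auto simp: infdist_nonneg)
          with N show ?thesis by (simp add: h_def)
        qed
        then have "\<forall>\<^sub>F n in sequentially. ennreal (h n x) = indicator V x"
          using True by (intro eventually_sequentiallyI[of N]) simp
        then show ?thesis by (rule tendsto_eventually)
      qed (simp add: hV)
    qed measurable
    then show ?thesis using V(1) that by simp
  qed
  show "emeasure \<sigma> V = emeasure graph_measure V"
    using lim[OF sets\<sigma>] lim[OF sets_graph_measure] unfolding eq by (rule LIMSEQ_unique)
qed (use assms in auto)

text \<open>Any graph in \<open>S\<close>, however irregular its domain, fills \<open>S\<close> locally, so small balls about its points
  suffice to compare the measures on it.\<close>

lemma minkowski_measure_is_area_measure:
  fixes S :: "'a::euclidean_space set"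
  assumes S: "smooth_hypersurface S" "closed S" and \<sigma>: "minkowski_measure S \<sigma>"
  shows "is_area_measure S \<sigma>"
  unfolding is_area_measure_def
proof (intro conjI ballI allI impI)
  show sets\<sigma>: "sets \<sigma> = sets borel" and "emeasure \<sigma> (- S) = 0"
    using \<sigma> by (auto simp: minkowski_measure_def)
  fix b :: 'a and U and g :: "'a \<Rightarrow> real"
  assume "b \<in> Basis" and *: "open U \<and> smooth_on U g \<and> (\<lambda>x. x + g x *\<^sub>R b) ` (U \<inter> {x. x \<bullet> b = 0}) \<subseteq> S"
  interpret graph_patch b U g using \<open>b \<in> Basis\<close> * by unfold_locales auto
  have sub: "patch \<subseteq> S" using * by (simp add: patch_def)
  have "emeasure \<sigma> patch = emeasure graph_measure patch"
  proof (rule borel_measures_eq_if_eq_locally[OF sets\<sigma> sets_graph_measure patch_measurable])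
    fix p assume "p \<in> patch"
    then obtain r L where gb: "graph_ball b U g S p r L"
      using exists_graph_ball[OF S sub] by blast
    show "\<exists>B. open B \<and> p \<in> B \<and> (\<forall>X. X \<in> sets borel \<longrightarrow> X \<subseteq> B \<longrightarrow> emeasure \<sigma> X = emeasure graph_measure X)"
      using graph_ball.minkowski_measure_eq_graph_measure[OF gb \<sigma>] graph_ball.radius[OF gb]
      by (intro exI[of _ "ball p r"]) auto
  qed
  also have "\<dots> = emeasure graph_measure UNIV"
    using AE_graph_measure by (intro emeasure_eq_AE) auto
  finally show "emeasure \<sigma> ((\<lambda>x. x + g x *\<^sub>R b) ` (U \<inter> {x. x \<bullet> b = 0})) =
        (\<integral>\<^sup>+x\<in>U \<inter> {x. x \<bullet> b = 0}.
           ennreal (sqrt (1 + (\<Sum>i\<in>Basis - {b}. (frechet_derivative g (at x) i)\<^sup>2)))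
         \<partial>hyperplane_lborel b)"
    unfolding emeasure_graph_measure_total patch_def .
qed

text \<open>Inside a small ball every open piece of the hypersurface is itself a graph over an open set, so
  two area measures agree there.\<close>

lemma is_area_measure_unique:
  fixes S :: "'a::euclidean_space set"
  assumes S: "smooth_hypersurface S" "closed S" and \<mu>: "is_area_measure S \<mu>" and \<nu>: "is_area_measure S \<nu>"
    and fin: "emeasure \<mu> UNIV < \<infinity>"
  shows "\<mu> = \<nu>"
proof -
  have sets: "sets \<mu> = sets borel" "sets \<nu> = sets borel"
    using \<mu> \<nu> by (auto simp: is_area_measure_def)
  have Sm: "S \<in> sets borel" using S(2) by auto
  have carried: "emeasure \<rho> X = emeasure \<rho> (X \<inter> S)" if "is_area_measure S \<rho>" "X \<in> sets borel" for \<rho> X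
  proof (rule emeasure_eq_AE)
    have "- S \<in> null_sets \<rho>" using that Sm by (auto simp: is_area_measure_def null_sets_def)
    then show "AE x in \<rho>. x \<in> X \<longleftrightarrow> x \<in> X \<inter> S"
      by (rule AE_not_in[THEN eventually_mono]) auto
  qed (use that Sm in \<open>auto simp: is_area_measure_def\<close>)
  have loc: "emeasure \<mu> (X \<inter> S) = emeasure \<nu> (X \<inter> S)" if X: "X \<in> sets borel" for X
  proof (rule borel_measures_eq_if_eq_locally[OF sets])
    show "X \<inter> S \<in> sets borel" using X Sm by auto
    fix p assume "p \<in> X \<inter> S"
    then have "p \<in> S" by simp
    obtain b U g r L where gb: "graph_ball b U g S p r L"
      using smooth_hypersurface_graph_ball[OF S \<open>p \<in> S\<close>] .
    interpret graph_ball b U g S p r L by (rule gb)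
    have "emeasure \<mu> V = emeasure \<nu> V" if V: "open V" "V \<subseteq> ball p r" for V
    proof -
      define U' where "U' = U \<inter> (\<lambda>x. x + g x *\<^sub>R b) -` V"
      have "open U'"
        unfolding U'_def using open_dom V(1)
        by (intro continuous_open_preimage continuous_intros smooth_on_continuous[OF smooth])
      moreover have "smooth_on U' g" by (rule smooth_on_subset[OF smooth]) (simp add: U'_def)
      moreover have "V \<subseteq> ball p (3 * r)" using V(2) radius by auto
      then have VS: "(\<lambda>x. x + g x *\<^sub>R b) ` (U' \<inter> {x. x \<bullet> b = 0}) = V \<inter> S"
        using coincide patch_sub unfolding U'_def patch_def by blast
      ultimately have "emeasure \<rho> (V \<inter> S) = (\<integral>\<^sup>+x\<in>U' \<inter> {x. x \<bullet> b = 0}.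
          ennreal (sqrt (1 + (\<Sum>i\<in>Basis - {b}. (frechet_derivative g (at x) i)\<^sup>2)))
          \<partial>hyperplane_lborel b)" if "is_area_measure S \<rho>" for \<rho>
        using that[unfolded is_area_measure_def, THEN conjunct2, THEN conjunct2, rule_format,
            OF basis, of U' g] by simp
      then have "emeasure \<mu> (V \<inter> S) = emeasure \<nu> (V \<inter> S)" using \<mu> \<nu> by simp
      then show ?thesis using carried[OF \<mu>] carried[OF \<nu>] V(1) by simp
    qed
    moreover have "emeasure \<mu> (ball p r) < \<infinity>"
      using emeasure_mono[of "ball p r" UNIV \<mu>] fin sets by (auto simp: less_top top_unique)
    ultimately have "emeasure \<mu> Y = emeasure \<nu> Y" if "Y \<in> sets borel" "Y \<subseteq> ball p r" for Y
      using borel_measures_eq_if_eq_on_open[OF sets open_ball _ _ that] by blast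
    then show "\<exists>B. open B \<and> p \<in> B \<and> (\<forall>X. X \<in> sets borel \<longrightarrow> X \<subseteq> B \<longrightarrow> emeasure \<mu> X = emeasure \<nu> X)"
      using radius by (intro exI[of _ "ball p r"]) auto
  qed
  show ?thesis
    by (rule measure_eqI) (use sets loc carried \<mu> \<nu> in auto)
qed

theorem area_measure_minkowski:
  assumes "smooth_hypersurface S" "compact S" "S \<noteq> {}"
  shows "minkowski_measure S (area_measure S)"
proof -
  have "closed S" using assms compact_imp_closed by blast
  obtain \<sigma> where \<sigma>: "minkowski_measure S \<sigma>" using exists_minkowski_measure[OF assms] .
  then have "is_area_measure S \<sigma>" "emeasure \<sigma> UNIV < \<infinity>"
    using minkowski_measure_is_area_measure assms \<open>closed S\<close> by (auto simp: minkowski_measure_def)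
  then have "area_measure S = \<sigma>"
    unfolding area_measure_def
    using is_area_measure_unique[OF assms(1) \<open>closed S\<close>] by (metis the_equality)
  with \<sigma> show ?thesis by simp
qed

section \<open>The boundary of a full-dimensional submanifold\<close>

definition gradient :: "('a::euclidean_space \<Rightarrow> real) \<Rightarrow> 'a \<Rightarrow> 'a" where
  "gradient F x = (\<Sum>i\<in>Basis. frechet_derivative F (at x) i *\<^sub>R i)"

lemma has_derivative_gradient:
  assumes "smooth_on W F" "open W" "x \<in> W"
  shows "(F has_derivative (\<lambda>v. gradient F x \<bullet> v)) (at x)"
proof -
  have der: "(F has_derivative frechet_derivative F (at x)) (at x)"
    using smooth_on_has_derivative[OF assms] .
  then have lin: "linear (frechet_derivative F (at x))" by (rule has_derivative_linear)
  have "frechet_derivative F (at x) v = gradient F x \<bullet> v" for v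
  proof -
    have "frechet_derivative F (at x) (\<Sum>i\<in>Basis. (v \<bullet> i) *\<^sub>R i) =
        (\<Sum>i\<in>Basis. (v \<bullet> i) * frechet_derivative F (at x) i)"
      by (simp add: linear_sum[OF lin] linear_scale[OF lin] del: euclidean_representation)
    moreover have "gradient F x \<bullet> v = (\<Sum>i\<in>Basis. (v \<bullet> i) * frechet_derivative F (at x) i)"
      unfolding gradient_def inner_sum_left inner_scaleR_left
      by (simp add: inner_commute mult.commute)
    ultimately show ?thesis by (simp add: euclidean_representation)
  qed
  then have "frechet_derivative F (at x) = (\<lambda>v. gradient F x \<bullet> v)" by (rule ext)
  then show ?thesis using der by simp
qed

lemma continuous_on_gradient: "smooth_on W F \<Longrightarrow> continuous_on W (gradient F)"
  unfolding gradient_def by (intro continuous_intros smooth_on_continuous_derivative)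

text \<open>What is used of an ambient chart that straightens the boundary: its coordinate \<open>F\<close> transversal to
  the boundary, and the curves that it provides in the zero set of \<open>F\<close>. The last clause realises every
  vector orthogonal to the gradient as the velocity of such a curve.\<close>

definition boundary_chart :: "'a::euclidean_space set \<Rightarrow> 'a set \<Rightarrow> ('a \<Rightarrow> real) \<Rightarrow> bool" where
  "boundary_chart K W F \<longleftrightarrow> open W \<and> smooth_on W F \<and>
     (\<forall>x\<in>W. x \<in> K \<longleftrightarrow> F x \<le> 0) \<and> (\<forall>x\<in>W. x \<in> manifold_boundary K \<longleftrightarrow> F x = 0) \<and>
     (\<forall>x\<in>W. gradient F x \<noteq> 0) \<and>
     (\<forall>x\<in>W. \<forall>v. F x = 0 \<longrightarrow> gradient F x \<bullet> v = 0 \<longrightarrow> v \<in> tangent_space (manifold_boundary K) x)"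

lemma eventually_positive_along_direction:
  fixes F :: "'a::euclidean_space \<Rightarrow> real"
  assumes "(F has_derivative D) (at p)" "F p = 0" "D v > 0"
  shows "\<forall>\<^sub>F t in at_right 0. F (p + t *\<^sub>R v) > 0"
proof -
  have lin: "linear D" using assms(1) by (rule has_derivative_linear)
  have line: "((\<lambda>t. p + t *\<^sub>R v) has_derivative (\<lambda>t. t *\<^sub>R v)) (at 0)"
    by (auto intro!: derivative_eq_intros)
  have "(F has_derivative D) (at (p + 0 *\<^sub>R v))" using assms(1) by simp
  with line have "((\<lambda>t. F (p + t *\<^sub>R v)) has_derivative (\<lambda>t. D (t *\<^sub>R v))) (at 0)"
    by (rule has_derivative_compose)
  then have "((\<lambda>t. F (p + t *\<^sub>R v)) has_real_derivative D v) (at 0)"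
    by (simp add: has_field_derivative_def linear_scale[OF lin] mult_commute_abs)
  from DERIV_pos_inc_right[OF this assms(3)]
  obtain d where "d > 0" "\<forall>h>0. h < d \<longrightarrow> 0 < F (p + h *\<^sub>R v)" using assms(2) by auto
  then show ?thesis unfolding eventually_at_right_field by auto
qed

lemma eventually_in_open_along_direction:
  fixes p v :: "'a::real_normed_vector"
  assumes "open W" "p \<in> W"
  shows "\<forall>\<^sub>F t in at_right 0. p + t *\<^sub>R v \<in> W"
proof -
  have "((\<lambda>t. p + t *\<^sub>R v) \<longlongrightarrow> p + 0 *\<^sub>R v) (at_right 0)" by (intro tendsto_intros)
  then show ?thesis using assms by (intro topological_tendstoD) auto
qed

text \<open>Curves in the boundary are images under the inverse chart of straight lines in the bounding
  hyperplane. That a boundary point with \<open>F < 0\<close> cannot occur in another chart follows from the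
  boundary being disjoint from the interior of \<open>K\<close>: along the gradient \<open>F\<close> becomes positive, which
  leads out of \<open>K\<close>.\<close>

lemma boundary_chart_exists:
  fixes K :: "'a::euclidean_space set"
  assumes "p \<in> manifold_boundary K"
  obtains W F where "p \<in> W" "boundary_chart K W F" "p \<notin> interior K"
proof -
  have char: "\<exists>W V \<psi>. \<exists>b\<in>Basis. q \<in> W \<and> smooth_diffeo W V \<psi> \<and>
     \<psi> ` (W \<inter> K) = V \<inter> {y. y \<bullet> b \<le> 0} \<and> \<psi> q \<bullet> b = 0" if "q \<in> manifold_boundary K" for q
    using that unfolding manifold_boundary_def by blast
  have chart: "open W \<and> smooth_on W (\<lambda>x. \<psi> x \<bullet> b) \<and> (\<forall>x\<in>W. x \<in> K \<longleftrightarrow> \<psi> x \<bullet> b \<le> 0) \<and>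
      (\<forall>x\<in>W. gradient (\<lambda>x. \<psi> x \<bullet> b) x \<noteq> 0) \<and>
      (\<forall>x\<in>W. \<forall>v. \<psi> x \<bullet> b = 0 \<longrightarrow> gradient (\<lambda>x. \<psi> x \<bullet> b) x \<bullet> v = 0 \<longrightarrow>
         v \<in> tangent_space {y\<in>W. \<psi> y \<bullet> b = 0} x)"
    if b: "b \<in> Basis" and dif: "smooth_diffeo W V \<psi>" and im: "\<psi> ` (W \<inter> K) = V \<inter> {y. y \<bullet> b \<le> 0}"
    for W V \<psi> and b :: 'a
  proof -
    define \<xi> where "\<xi> = inv_into W \<psi>"
    have d: "open W" "open V" "bij_betw \<psi> W V" "smooth_on W \<psi>" "smooth_on V \<xi>"
      using dif by (auto simp: smooth_diffeo_def \<xi>_def)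
    have \<psi>V: "\<psi> x \<in> V" and \<xi>\<psi>: "\<xi> (\<psi> x) = x" if "x \<in> W" for x
      using d(3) that by (auto simp: \<xi>_def bij_betw_def)
    have \<xi>W: "\<xi> y \<in> W" and \<psi>\<xi>: "\<psi> (\<xi> y) = y" if "y \<in> V" for y
      using d(3) that by (auto simp: \<xi>_def bij_betw_def inv_into_into f_inv_into_f)
    let ?F = "\<lambda>x. \<psi> x \<bullet> b"
    have smF: "smooth_on W ?F"
      using d(1,4) by (auto simp: smooth_on_def intro: Ck_on_inner_left)
    define D where "D x = frechet_derivative \<psi> (at x)" for x
    define E where "E y = frechet_derivative \<xi> (at y)" for y
    have derD: "(\<psi> has_derivative D x) (at x)" if "x \<in> W" for x
      unfolding D_def using smooth_on_has_derivative[OF d(4,1) that] .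
    have derE: "(\<xi> has_derivative E y) (at y)" if "y \<in> V" for y
      unfolding E_def using smooth_on_has_derivative[OF d(5,2) that] .
    have DE: "D x (E (\<psi> x) v) = v" if "x \<in> W" for x v
    proof -
      have "((\<lambda>y. \<psi> (\<xi> y)) has_derivative (\<lambda>v. D x (E (\<psi> x) v))) (at (\<psi> x))"
        using that by (intro has_derivative_compose[OF derE]) (simp_all add: \<psi>V \<xi>\<psi> derD)
      moreover have "((\<lambda>y. \<psi> (\<xi> y)) has_derivative (\<lambda>v. v)) (at (\<psi> x))"
        by (rule has_derivative_transform_within_open[OF has_derivative_ident d(2) \<psi>V[OF that]])
          (simp add: \<psi>\<xi>)
      ultimately show ?thesis using has_derivative_unique by metis
    qed
    have ED: "E (\<psi> x) (D x v) = v" if "x \<in> W" for x v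
    proof -
      have "((\<lambda>y. \<xi> (\<psi> y)) has_derivative (\<lambda>v. E (\<psi> x) (D x v))) (at x)"
        by (intro has_derivative_compose[OF derD derE] that \<psi>V)
      moreover have "((\<lambda>y. \<xi> (\<psi> y)) has_derivative (\<lambda>v. v)) (at x)"
        by (rule has_derivative_transform_within_open[OF has_derivative_ident d(1) that])
          (simp add: \<xi>\<psi>)
      ultimately show ?thesis using has_derivative_unique by metis
    qed
    have grad: "gradient ?F x \<bullet> v = D x v \<bullet> b" if "x \<in> W" for x v
    proof -
      have "(?F has_derivative (\<lambda>v. D x v \<bullet> b)) (at x)"
        by (intro has_derivative_inner_left derD that)
      with has_derivative_gradient[OF smF d(1) that] show ?thesis
        using has_derivative_unique by metis
    qed
    have K: "x \<in> K \<longleftrightarrow> ?F x \<le> 0" if "x \<in> W" for x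
    proof
      assume "x \<in> K"
      then have "\<psi> x \<in> V \<inter> {y. y \<bullet> b \<le> 0}" using that im by blast
      then show "?F x \<le> 0" by simp
    next
      assume "?F x \<le> 0"
      then have "\<psi> x \<in> \<psi> ` (W \<inter> K)" using im \<psi>V[OF that] by simp
      then obtain z where "z \<in> W" "z \<in> K" "\<psi> x = \<psi> z" by blast
      then show "x \<in> K" using \<xi>\<psi> that by metis
    qed
    have g0: "gradient ?F x \<noteq> 0" if "x \<in> W" for x
    proof
      assume "gradient ?F x = 0"
      then have "D x (E (\<psi> x) b) \<bullet> b = 0" using grad[OF that, of "E (\<psi> x) b"] by simp
      then show False using DE[OF that] b by simp
    qed
    have tan: "v \<in> tangent_space {y\<in>W. \<psi> y \<bullet> b = 0} x"
      if x: "x \<in> W" "?F x = 0" "gradient ?F x \<bullet> v = 0" for x v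
    proof -
      define w where "w = D x v"
      have w: "w \<bullet> b = 0" using grad[OF x(1)] x(3) by (simp add: w_def)
      define c where "c t = \<psi> x + t *\<^sub>R w" for t :: real
      obtain e where e: "e > 0" "ball (\<psi> x) e \<subseteq> V" using d(2) \<psi>V[OF x(1)] openE by blast
      define \<delta> where "\<delta> = e / (norm w + 1)"
      have \<delta>: "\<delta> > 0" using e(1) by (simp add: \<delta>_def add_nonneg_pos)
      have cV: "c t \<in> V" if "t \<in> {-\<delta><..<\<delta>}" for t
      proof -
        have "\<bar>t\<bar> * norm w \<le> \<bar>t\<bar> * (norm w + 1)" by (intro mult_left_mono) auto
        also have "\<dots> < \<delta> * (norm w + 1)"
          using that by (intro mult_strict_right_mono) (auto simp: add_nonneg_pos)
        also have "\<dots> = e" by (simp add: \<delta>_def add_nonneg_eq_0_iff)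
        finally have "dist (\<psi> x) (c t) < e" by (simp add: c_def dist_norm)
        with e(2) show ?thesis by auto
      qed
      have "smooth_on {-\<delta><..<\<delta>} c"
        unfolding smooth_on_def c_def
        by (intro allI Ck_on_add Ck_on_const Ck_on_linear bounded_linear_scaleR_left) auto
      then have "smooth_on {-\<delta><..<\<delta>} (\<lambda>t. \<xi> (c t))"
        using cV d(2,5) by (intro smooth_on_compose[of _ V c \<xi>]) auto
      moreover have "(\<lambda>t. \<xi> (c t)) ` {-\<delta><..<\<delta>} \<subseteq> {y\<in>W. ?F y = 0}"
        using cV \<xi>W \<psi>\<xi> w x(2) by (auto simp: inner_add_left c_def)
      moreover have "\<xi> (c 0) = x" using x(1) by (simp add: c_def \<xi>\<psi>)
      moreover have "((\<lambda>t. \<xi> (c t)) has_vector_derivative v) (at 0)"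
      proof -
        have "(c has_derivative (\<lambda>t. t *\<^sub>R w)) (at 0)"
          unfolding c_def by (auto intro!: derivative_eq_intros)
        then have "((\<lambda>t. \<xi> (c t)) has_derivative (\<lambda>t. E (\<psi> x) (t *\<^sub>R w))) (at 0)"
          by (rule has_derivative_compose) (use derE[OF \<psi>V[OF x(1)]] in \<open>simp add: c_def\<close>)
        moreover have "E (\<psi> x) (t *\<^sub>R w) = t *\<^sub>R v" for t
          using has_derivative_linear[OF derE[OF \<psi>V[OF x(1)]]] ED[OF x(1)]
          by (simp add: linear_scale w_def)
        ultimately show ?thesis by (simp add: has_vector_derivative_def)
      qed
      ultimately show ?thesis using \<delta> unfolding tangent_space_def by blast
    qed
    show ?thesis using d(1) smF K g0 tan by blast
  qed
  have not_interior: "q \<notin> interior K" if q: "q \<in> manifold_boundary K" for q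
  proof
    assume int: "q \<in> interior K"
    obtain W V \<psi> b where c: "b \<in> Basis" "q \<in> W" "smooth_diffeo W V \<psi>"
        "\<psi> ` (W \<inter> K) = V \<inter> {y. y \<bullet> b \<le> 0}" "\<psi> q \<bullet> b = 0" using char[OF q] by blast
    let ?F = "\<lambda>x. \<psi> x \<bullet> b" and ?g = "gradient (\<lambda>x. \<psi> x \<bullet> b) q"
    note ch = chart[OF c(1,3,4)]
    have "?g \<bullet> ?g > 0" using ch c(2) by auto
    then have "\<forall>\<^sub>F t in at_right 0. ?F (q + t *\<^sub>R ?g) > 0"
      using has_derivative_gradient[of W ?F q] ch c by (intro eventually_positive_along_direction) auto
    moreover have "\<forall>\<^sub>F t in at_right 0. q + t *\<^sub>R ?g \<in> W \<inter> interior K"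
      using ch c int by (intro eventually_in_open_along_direction) auto
    ultimately have "\<forall>\<^sub>F t in at_right (0::real). False"
    proof eventually_elim
      fix t assume t: "?F (q + t *\<^sub>R ?g) > 0" "q + t *\<^sub>R ?g \<in> W \<inter> interior K"
      then have "q + t *\<^sub>R ?g \<in> K" using interior_subset by blast
      then show False using t ch by auto
    qed
    then show False by simp
  qed
  obtain W V \<psi> b where c: "b \<in> Basis" "p \<in> W" "smooth_diffeo W V \<psi>"
      "\<psi> ` (W \<inter> K) = V \<inter> {y. y \<bullet> b \<le> 0}" "\<psi> p \<bullet> b = 0" using char[OF assms] by blast
  let ?F = "\<lambda>x. \<psi> x \<bullet> b"
  note ch = chart[OF c(1,3,4)]
  have bd: "x \<in> manifold_boundary K \<longleftrightarrow> ?F x = 0" if "x \<in> W" for x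
  proof
    assume x: "x \<in> manifold_boundary K"
    then have "?F x \<le> 0" using ch that by (auto simp: manifold_boundary_def)
    moreover have "\<not> ?F x < 0"
    proof
      assume "?F x < 0"
      have "open (W \<inter> ?F -` {..<0})"
        using ch smooth_on_continuous[of W ?F] by (intro continuous_open_preimage) auto
      moreover have "W \<inter> ?F -` {..<0} \<subseteq> K" using ch by auto
      ultimately have "x \<in> interior K" using \<open>?F x < 0\<close> that by (intro interiorI) auto
      with not_interior[OF x] show False by simp
    qed
    ultimately show "?F x = 0" by simp
  next
    assume "?F x = 0"
    moreover have "x \<in> K" using ch that calculation by simp
    ultimately show "x \<in> manifold_boundary K"
      using that c unfolding manifold_boundary_def by blast
  qed
  have mono: "tangent_space {y\<in>W. ?F y = 0} x \<subseteq> tangent_space (manifold_boundary K) x" for x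
    unfolding tangent_space_def using bd by (blast intro: order.trans)
  have "boundary_chart K W ?F"
    unfolding boundary_chart_def using ch bd mono by blast
  with c(2) show thesis using not_interior[OF assms] by (rule that)
qed

lemma manifold_boundary_not_interior:
  assumes "p \<in> manifold_boundary K" shows "p \<notin> interior K"
  using boundary_chart_exists[OF assms] by blast

lemma compact_manifold_boundary:
  assumes "compact K" "full_dim_submanifold_with_boundary K"
  shows "compact (manifold_boundary K)"
proof -
  have "manifold_boundary K \<subseteq> K" unfolding manifold_boundary_def by blast
  then have "manifold_boundary K = K - interior K"
    using assms(2) manifold_boundary_not_interior
    unfolding full_dim_submanifold_with_boundary_def by blast
  then show ?thesis using assms(1) by (simp add: compact_diff)
qed

lemma smooth_hypersurface_manifold_boundary: "smooth_hypersurface (manifold_boundary K)"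
  unfolding smooth_hypersurface_def
proof
  fix p assume "p \<in> manifold_boundary K"
  then obtain W F where c: "p \<in> W" "boundary_chart K W F" using boundary_chart_exists by blast
  then have ch: "open W" "smooth_on W F" "\<And>x. x \<in> W \<Longrightarrow> x \<in> manifold_boundary K \<longleftrightarrow> F x = 0" "gradient F p \<noteq> 0"
    by (auto simp: boundary_chart_def)
  have "\<exists>v. frechet_derivative F (at p) v \<noteq> 0"
    using ch(4) unfolding gradient_def by (metis (no_types, lifting) scale_zero_left sum.neutral)
  with c ch show "\<exists>W (F::'a \<Rightarrow> real). open W \<and> p \<in> W \<and> smooth_on W F \<and>
     manifold_boundary K \<inter> W = {x\<in>W. F x = 0} \<and> (\<exists>v. frechet_derivative F (at p) v \<noteq> 0)"
    by (intro exI[of _ W] exI[of _ F]) auto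
qed

text \<open>Velocities of curves in the zero set of \<open>F\<close> are orthogonal to the gradient, and every vector
  orthogonal to the gradient is such a velocity.\<close>

lemma normal_space_manifold_boundary:
  assumes c: "p \<in> W" "boundary_chart K W F" "p \<in> manifold_boundary K"
  shows "normal_space (manifold_boundary K) p = range (\<lambda>t. t *\<^sub>R gradient F p)"
proof -
  let ?g = "gradient F p" and ?S = "manifold_boundary K"
  have ch: "open W" "smooth_on W F" "\<And>x. x \<in> W \<Longrightarrow> x \<in> ?S \<longleftrightarrow> F x = 0" "?g \<noteq> 0"
      "\<And>v. ?g \<bullet> v = 0 \<Longrightarrow> v \<in> tangent_space ?S p"
    using c by (auto simp: boundary_chart_def)
  have tan: "?g \<bullet> v = 0" if v: "v \<in> tangent_space ?S p" for v
  proof -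
    obtain \<gamma> d where \<gamma>: "d > 0" "\<gamma> ` {-d<..<d::real} \<subseteq> ?S" "\<gamma> 0 = p" "(\<gamma> has_vector_derivative v) (at 0)"
      using v unfolding tangent_space_def by blast
    have "(\<gamma> has_derivative (\<lambda>t. t *\<^sub>R v)) (at 0)"
      using \<gamma>(4) by (simp add: has_vector_derivative_def)
    then have "((\<lambda>t. F (\<gamma> t)) has_derivative (\<lambda>t. ?g \<bullet> (t *\<^sub>R v))) (at 0)"
      by (rule has_derivative_compose)
        (use has_derivative_gradient[OF ch(2,1) c(1)] \<gamma>(3) in simp)
    moreover have "((\<lambda>t. F (\<gamma> t)) has_derivative (\<lambda>t. 0)) (at 0)"
    proof -
      have "isCont \<gamma> 0" using \<gamma>(4) has_vector_derivative_continuous by blast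
      then have "\<forall>\<^sub>F t in at 0. \<gamma> t \<in> W"
        using ch(1) c(1) \<gamma>(3) unfolding isCont_def by (auto intro: topological_tendstoD)
      moreover have "\<forall>\<^sub>F t in at 0. t \<in> {-d<..<d}"
        using \<gamma>(1) by (intro eventually_at_in_open') auto
      ultimately have "\<forall>\<^sub>F t in at 0. F (\<gamma> t) = 0"
        by eventually_elim (use \<gamma>(2) ch(3) in blast)
      moreover have "F (\<gamma> 0) = 0" using \<gamma>(3) c ch(3) by simp
      ultimately show ?thesis
        by (intro has_derivative_transform_eventually[OF has_derivative_const[of 0]])
          (auto elim: eventually_mono)
    qed
    ultimately have "(\<lambda>t. ?g \<bullet> (t *\<^sub>R v)) = (\<lambda>t. 0)" by (rule has_derivative_unique)
    then have "?g \<bullet> (1 *\<^sub>R v) = 0" by metis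
    then show ?thesis by simp
  qed
  show ?thesis
  proof (intro equalityI subsetI)
    fix a assume a: "a \<in> normal_space ?S p"
    define v where "v = a - ((?g \<bullet> a) / (?g \<bullet> ?g)) *\<^sub>R ?g"
    have "?g \<bullet> v = 0" using ch(4) by (simp add: v_def inner_diff_right)
    then have "v \<bullet> a = 0" using a ch(5)
      by (simp add: normal_space_def orthogonal_comp_def orthogonal_def)
    then have "v \<bullet> v = 0" using \<open>?g \<bullet> v = 0\<close>
      by (subst (2) v_def) (simp add: inner_diff_right inner_commute)
    then show "a \<in> range (\<lambda>t. t *\<^sub>R ?g)" unfolding v_def by auto
  next
    fix a assume "a \<in> range (\<lambda>t. t *\<^sub>R ?g)"
    then show "a \<in> normal_space ?S p"
      using tan by (auto simp: normal_space_def orthogonal_comp_def orthogonal_def inner_commute)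
  qed
qed

text \<open>Of the two unit vectors on the normal line, the gradient direction leads to \<open>F > 0\<close>, out of \<open>K\<close>,
  and the opposite one to \<open>F < 0\<close>, into \<open>K\<close>.\<close>

lemma outward_unit_normal_eq_gradient:
  assumes c: "p \<in> W" "boundary_chart K W F" "p \<in> manifold_boundary K"
  shows "outward_unit_normal K p = gradient F p /\<^sub>R norm (gradient F p)"
proof -
  let ?g = "gradient F p" and ?n = "gradient F p /\<^sub>R norm (gradient F p)"
  have ch: "open W" "smooth_on W F" "\<And>x. x \<in> W \<Longrightarrow> x \<in> K \<longleftrightarrow> F x \<le> 0" "?g \<noteq> 0" "F p = 0"
    using c by (auto simp: boundary_chart_def)
  have der: "(F has_derivative (\<lambda>v. ?g \<bullet> v)) (at p)" by (rule has_derivative_gradient[OF ch(2,1) c(1)])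
  then have der': "((\<lambda>x. - F x) has_derivative (\<lambda>v. - (?g \<bullet> v))) (at p)" by (rule has_derivative_minus)
  have pos: "?g \<bullet> ?n > 0" using ch(4) by simp
  have inW: "\<forall>\<^sub>F t in at_right 0. p + t *\<^sub>R v \<in> W" for v
    by (rule eventually_in_open_along_direction[OF ch(1) c(1)])
  have out: "\<forall>\<^sub>F t in at_right 0. p + t *\<^sub>R ?n \<notin> K"
    using inW[of ?n] eventually_positive_along_direction[OF der ch(5) pos]
    by eventually_elim (use ch(3) in force)
  have "\<forall>\<^sub>F t in at_right 0. - F (p + t *\<^sub>R (- ?n)) > 0"
    using pos ch(5) by (intro eventually_positive_along_direction[OF der']) auto
  with inW[of "- ?n"] have inn: "\<forall>\<^sub>F t in at_right 0. p + t *\<^sub>R (- ?n) \<in> K"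
    by eventually_elim (use ch(3) in force)
  have N: "normal_space (manifold_boundary K) p = range (\<lambda>t. t *\<^sub>R ?g)"
    by (rule normal_space_manifold_boundary[OF c])
  show ?thesis
    unfolding outward_unit_normal_def
  proof (rule the_equality)
    show "norm ?n = 1 \<and> ?n \<in> normal_space (manifold_boundary K) p \<and>
        (\<forall>\<^sub>F t in at_right 0. p + t *\<^sub>R ?n \<notin> K)"
      using out ch(4) by (auto simp: N)
    fix \<nu> assume \<nu>: "norm \<nu> = 1 \<and> \<nu> \<in> normal_space (manifold_boundary K) p \<and>
        (\<forall>\<^sub>F t in at_right 0. p + t *\<^sub>R \<nu> \<notin> K)"
    then obtain s where s: "\<nu> = s *\<^sub>R ?g" unfolding N by blast
    then have "\<bar>s\<bar> = inverse (norm ?g)" using \<nu> ch(4) by (simp add: field_simps)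
    then have "s = inverse (norm ?g) \<or> s = - inverse (norm ?g)" by linarith
    then consider "\<nu> = ?n" | "\<nu> = - ?n" using s by (metis scaleR_minus_left)
    then show "\<nu> = ?n"
    proof cases
      case 2
      have "\<forall>\<^sub>F t in at_right 0. p + t *\<^sub>R \<nu> \<notin> K" using \<nu> by blast
      with inn have "\<forall>\<^sub>F t in at_right (0::real). False"
        unfolding 2 by eventually_elim blast
      then show ?thesis by simp
    qed
  qed
qed

lemma continuous_on_outward_unit_normal: "continuous_on (manifold_boundary K) (outward_unit_normal K)"
  unfolding continuous_on_eq_continuous_within
proof
  let ?S = "manifold_boundary K"
  fix p assume p: "p \<in> ?S"
  obtain W F where c: "p \<in> W" "boundary_chart K W F" using boundary_chart_exists[OF p] .
  then have ch: "open W" "smooth_on W F" "\<And>x. x \<in> W \<Longrightarrow> gradient F x \<noteq> 0"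
    by (auto simp: boundary_chart_def)
  have "continuous_on (?S \<inter> W) (\<lambda>x. gradient F x /\<^sub>R norm (gradient F x))"
    using ch by (intro continuous_intros continuous_on_subset[OF continuous_on_gradient[OF ch(2)]]) auto
  then have "continuous_on (?S \<inter> W) (outward_unit_normal K)"
    by (rule continuous_on_eq) (use outward_unit_normal_eq_gradient[OF _ c(2)] in auto)
  then have "continuous (at p within ?S \<inter> W) (outward_unit_normal K)"
    using p c(1) by (simp add: continuous_on_eq_continuous_within)
  moreover have "at p within ?S \<inter> W = at p within ?S"
    by (rule at_within_nhd[OF c(1) ch(1)]) auto
  ultimately show "continuous (at p within ?S) (outward_unit_normal K)" by simp
qed

lemma norm_outward_unit_normal:
  assumes "p \<in> manifold_boundary K" shows "norm (outward_unit_normal K p) = 1"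
proof -
  obtain W F where c: "p \<in> W" "boundary_chart K W F" using boundary_chart_exists[OF assms] .
  then have "gradient F p \<noteq> 0" by (auto simp: boundary_chart_def)
  then show ?thesis by (simp add: outward_unit_normal_eq_gradient[OF c assms])
qed

text \<open>The segment from a point to a nearest point of \<open>S\<close> is orthogonal to every curve in \<open>S\<close>.\<close>

lemma Tub_eq_infdist:
  fixes S :: "'a::euclidean_space set"
  assumes "closed S" "S \<noteq> {}"
  shows "Tub \<epsilon> S = {y. infdist y S < \<epsilon>}"
proof (intro equalityI subsetI)
  fix y assume "y \<in> Tub \<epsilon> S"
  then obtain p a where pa: "y = p + a" "p \<in> S" "norm a < \<epsilon>" unfolding Tub_def by blast
  then show "y \<in> {y. infdist y S < \<epsilon>}" using infdist_le[of p S y] by (simp add: dist_norm)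
next
  fix y assume y: "y \<in> {y. infdist y S < \<epsilon>}"
  obtain p where p: "p \<in> S" "infdist y S = dist y p" using infdist_attains_inf[OF assms] by blast
  have "v \<bullet> (y - p) = 0" if v: "v \<in> tangent_space S p" for v
  proof -
    obtain \<gamma> d where \<gamma>: "d > 0" "\<gamma> ` {-d<..<d::real} \<subseteq> S" "\<gamma> 0 = p" "(\<gamma> has_vector_derivative v) (at 0)"
      using v unfolding tangent_space_def by blast
    let ?f = "\<lambda>t. (y - \<gamma> t) \<bullet> (y - \<gamma> t)"
    have "(?f has_derivative (\<lambda>t. (y - \<gamma> 0) \<bullet> (0 - t *\<^sub>R v) + (0 - t *\<^sub>R v) \<bullet> (y - \<gamma> 0))) (at 0)"
      using \<gamma>(4) unfolding has_vector_derivative_def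
      by (intro has_derivative_inner has_derivative_diff has_derivative_const)
    moreover have "(\<lambda>t. (y - \<gamma> 0) \<bullet> (0 - t *\<^sub>R v) + (0 - t *\<^sub>R v) \<bullet> (y - \<gamma> 0)) = (*) (- 2 * (v \<bullet> (y - p)))"
      by (simp add: fun_eq_iff \<gamma>(3) inner_commute)
    ultimately have "(?f has_real_derivative - 2 * (v \<bullet> (y - p))) (at 0)"
      by (simp add: has_field_derivative_def)
    moreover have "\<forall>t. \<bar>0 - t\<bar> < d \<longrightarrow> ?f 0 \<le> ?f t"
    proof (intro allI impI)
      fix t assume "\<bar>0 - t\<bar> < d"
      then have "\<gamma> t \<in> S" using \<gamma>(2) by (auto simp: abs_less_iff)
      then have "norm (y - p) \<le> norm (y - \<gamma> t)" using infdist_le[of "\<gamma> t" S y] p by (simp add: dist_norm)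
      then have "(norm (y - p))\<^sup>2 \<le> (norm (y - \<gamma> t))\<^sup>2" by (intro power_mono) auto
      then show "?f 0 \<le> ?f t" by (simp add: \<gamma>(3) power2_norm_eq_inner)
    qed
    ultimately have "- 2 * (v \<bullet> (y - p)) = 0" using DERIV_local_min[OF _ \<gamma>(1)] by blast
    then show ?thesis by simp
  qed
  then have "y - p \<in> normal_space S p"
    by (simp add: normal_space_def orthogonal_comp_def orthogonal_def)
  moreover have "norm (y - p) < \<epsilon>" using y p by (simp add: dist_norm)
  moreover have "y = p + (y - p)" by simp
  ultimately show "y \<in> Tub \<epsilon> S" using p(1) unfolding Tub_def by blast
qed

section \<open>Projections of the unit sphere\<close>

text \<open>Let \<open>B\<close> be the unit ball and \<open>\<lambda>\<close> Lebesgue measure. The double integral of \<open>1\<^sub>A x 1\<^sub>B (x + y)\<close> against \<open>\<nu>\<close> in \<open>x\<close>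
  and \<open>\<lambda>\<close> in \<open>y\<close> is evaluated in both orders; invariance of one or the other measure gives
  \<open>\<nu> A \<lambda> B = \<nu> B \<lambda> A\<close>, and \<open>B\<close> has the same finite positive mass for both.\<close>

lemma translation_invariant_eq_lborel:
  fixes \<nu> :: "'a::euclidean_space measure"
  assumes [measurable_cong]: "sets \<nu> = sets borel" and "sigma_finite_measure \<nu>"
    and inv: "\<And>a. distr \<nu> borel ((+) a) = \<nu>" and ball: "emeasure \<nu> (ball 0 1) = emeasure lborel (ball (0::'a) 1)"
  shows "\<nu> = lborel"
proof (rule measure_eqI)
  interpret \<nu>: sigma_finite_measure \<nu> by fact
  interpret pair_sigma_finite \<nu> "lborel :: 'a measure" by standard
  define B where "B = ball (0::'a) 1"
  have [measurable]: "B \<in> sets borel" by (simp add: B_def)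
  fix A assume "A \<in> sets \<nu>"
  then have [measurable]: "A \<in> sets borel" by (simp add: assms(1))
  have shift: "(\<integral>\<^sup>+x. f (a + x) \<partial>\<nu>) = (\<integral>\<^sup>+x. f x \<partial>\<nu>)"
    if [measurable]: "f \<in> borel_measurable borel" for f :: "'a \<Rightarrow> ennreal" and a
    by (subst (2) inv[of a, symmetric]) (simp add: nn_integral_distr)
  have lshift: "(\<integral>\<^sup>+y. f (a + s *\<^sub>R y) \<partial>lborel) = (\<integral>\<^sup>+y. f y \<partial>lborel)"
    if [measurable]: "f \<in> borel_measurable borel" and "\<bar>s\<bar> = 1" for f :: "'a \<Rightarrow> ennreal" and a and s :: real
    by (subst (2) lborel_affine[of s a]) (use that(2) in \<open>auto simp: nn_integral_density nn_integral_distr density_1\<close>)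
  have "emeasure \<nu> A * emeasure lborel B = (\<integral>\<^sup>+x. indicator A x * (\<integral>\<^sup>+y. indicator B y \<partial>lborel) \<partial>\<nu>)"
    by (simp add: nn_integral_multc)
  also have "\<dots> = (\<integral>\<^sup>+x. \<integral>\<^sup>+y. indicator A x * indicator B (x + y) \<partial>lborel \<partial>\<nu>)"
  proof (rule nn_integral_cong)
    fix x
    have "(\<integral>\<^sup>+y. indicator A x * indicator B (x + y) \<partial>lborel) =
        indicator A x * (\<integral>\<^sup>+y. indicator B (x + y) \<partial>lborel)"
      by (rule nn_integral_cmult) measurable
    also have "(\<integral>\<^sup>+y. indicator B (x + y) \<partial>lborel) = (\<integral>\<^sup>+y. indicator B y \<partial>lborel)"
      using lshift[of "indicator B" 1 x] by simp
    finally show "indicator A x * (\<integral>\<^sup>+y. indicator B y \<partial>lborel) =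
        (\<integral>\<^sup>+y. indicator A x * indicator B (x + y) \<partial>lborel)" ..
  qed
  also have "\<dots> = (\<integral>\<^sup>+y. \<integral>\<^sup>+x. indicator A x * indicator B (x + y) \<partial>\<nu> \<partial>lborel)"
    by (rule Fubini'[symmetric]) measurable
  also have "\<dots> = (\<integral>\<^sup>+y. \<integral>\<^sup>+x. indicator A (- y + x) * indicator B x \<partial>\<nu> \<partial>lborel)"
  proof (rule nn_integral_cong)
    fix y :: 'a
    show "(\<integral>\<^sup>+x. indicator A x * indicator B (x + y) \<partial>\<nu>) =
        (\<integral>\<^sup>+x. indicator A (- y + x) * indicator B x \<partial>\<nu>)"
      using shift[of "\<lambda>x. indicator A x * indicator B (x + y)" "- y"] by simp
  qed
  also have "\<dots> = (\<integral>\<^sup>+x. \<integral>\<^sup>+y. indicator A (- y + x) * indicator B x \<partial>lborel \<partial>\<nu>)"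
    by (rule Fubini') measurable
  also have "\<dots> = (\<integral>\<^sup>+x. emeasure lborel A * indicator B x \<partial>\<nu>)"
  proof (rule nn_integral_cong)
    fix x
    have "(\<integral>\<^sup>+y. indicator A (- y + x) * indicator B x \<partial>lborel) =
        (\<integral>\<^sup>+y. indicator A (- y + x) \<partial>lborel) * indicator B x"
      by (rule nn_integral_multc) measurable
    also have "(\<integral>\<^sup>+y. indicator A (- y + x) \<partial>lborel) = (\<integral>\<^sup>+y. indicator A y \<partial>lborel)"
      using lshift[of "indicator A" "-1" x] by simp
    finally show "(\<integral>\<^sup>+y. indicator A (- y + x) * indicator B x \<partial>lborel) =
        emeasure lborel A * indicator B x" by simp
  qed
  also have "\<dots> = emeasure lborel A * emeasure lborel B"
    using ball by (subst nn_integral_cmult_indicator) (simp_all add: B_def assms(1))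
  finally have eq: "emeasure \<nu> A * emeasure lborel B = emeasure lborel A * emeasure lborel B" .
  have "emeasure lborel B = ennreal (measure lborel B)" "measure lborel B > 0"
    unfolding B_def using content_ball_pos[of 1 "0::'a"] emeasure_lborel_ball_finite[of "0::'a" 1]
    by (auto intro!: emeasure_eq_ennreal_measure simp: less_top)
  with eq show "emeasure \<nu> A = emeasure lborel A"
    using ennreal_mult_cancel_left[of "emeasure lborel B" "emeasure \<nu> A" "emeasure lborel A"]
    by (simp add: mult.commute)
qed (simp add: assms)

lemma lborel_distr_orthogonal_transformation:
  fixes T :: "'a::euclidean_space \<Rightarrow> 'a"
  assumes T: "orthogonal_transformation T"
  shows "distr lborel borel T = lborel"
proof (rule translation_invariant_eq_lborel)
  have lin: "linear T" using T by (rule orthogonal_transformation_linear)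
  have [measurable]: "T \<in> borel_measurable borel"
    using lin by (intro borel_measurable_continuous_onI linear_continuous_on linear_conv_bounded_linear[THEN iffD1])
  have ball: "T -` ball 0 r = ball 0 r" "T -` cball 0 r = cball 0 r" for r
    using orthogonal_transformation_norm[OF T] by auto
  show "emeasure (distr lborel borel T) (ball 0 1) = emeasure lborel (ball (0::'a) 1)"
    by (simp add: emeasure_distr ball)
  show "sigma_finite_measure (distr lborel borel T)"
  proof
    have "(\<Union>n::nat. cball (0::'a) (real n)) = UNIV" using real_arch_simple by auto
    moreover have "emeasure (distr lborel borel T) (cball 0 r) < \<infinity>" for r
      using emeasure_lborel_cball_finite[of "0::'a" r] by (simp add: emeasure_distr ball less_top)
    ultimately show "\<exists>A. countable A \<and> A \<subseteq> sets (distr lborel borel T) \<and>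
        \<Union> A = space (distr lborel borel T) \<and> (\<forall>a\<in>A. emeasure (distr lborel borel T) a \<noteq> \<infinity>)"
      by (intro exI[of _ "range (\<lambda>n::nat. cball (0::'a) (real n))"]) (auto simp: less_top)
  qed
  fix a
  obtain c where c: "a = T c" using orthogonal_transformation_surj[OF T] by (metis surjD)
  have "distr (distr lborel borel T) borel ((+) a) = distr (distr lborel borel ((+) c)) borel T"
    by (simp add: distr_distr comp_def c linear_add[OF lin])
  then show "distr (distr lborel borel T) borel ((+) a) = distr lborel borel T"
    by (simp add: lborel_distr_plus)
qed simp

lemma smooth_hypersurface_sphere: "smooth_hypersurface (sphere (0::'a::euclidean_space) 1)"
  unfolding smooth_hypersurface_def
proof
  fix p :: 'a assume p: "p \<in> sphere 0 1"
  let ?F = "\<lambda>x::'a. (\<Sum>i\<in>Basis. (x \<bullet> i) * (x \<bullet> i)) + (- 1)"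
  have sm: "smooth_on UNIV ?F"
    unfolding smooth_on_def
    by (intro allI Ck_on_add Ck_on_sum Ck_on_mult Ck_on_const Ck_on_linear bounded_linear_inner_left) auto
  have F: "?F x = x \<bullet> x - 1" for x by (subst euclidean_inner) simp
  have "((\<lambda>x. x \<bullet> x - 1) has_derivative (\<lambda>v. 2 * (p \<bullet> v))) (at p)"
    by (auto intro!: derivative_eq_intros simp: inner_commute)
  then have "frechet_derivative ?F (at p) = (\<lambda>v. 2 * (p \<bullet> v))"
    unfolding F by (rule frechet_derivative_at[symmetric])
  then have "frechet_derivative ?F (at p) p \<noteq> 0"
    using p by (simp add: norm_eq_1)
  moreover have "sphere 0 1 \<inter> UNIV = {x\<in>UNIV. ?F x = 0}" unfolding F by (auto simp: norm_eq_1)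
  ultimately show "\<exists>W (F::'a \<Rightarrow> real). open W \<and> p \<in> W \<and> smooth_on W F \<and>
     sphere 0 1 \<inter> W = {x\<in>W. F x = 0} \<and> (\<exists>v. frechet_derivative F (at p) v \<noteq> 0)"
    using sm by (intro exI[of _ UNIV] exI[of _ ?F]) blast
qed

lemma infdist_unit_sphere: "infdist y (sphere (0::'a::euclidean_space) 1) = \<bar>norm y - 1\<bar>"
proof (rule antisym)
  obtain b :: 'a where b: "b \<in> Basis" using nonempty_Basis by blast
  define u where "u = (if y = 0 then b else y /\<^sub>R norm y)"
  have "u \<in> sphere 0 1" using b by (simp add: u_def)
  moreover have "dist y u = \<bar>norm y - 1\<bar>"
  proof (cases "y = 0")
    case False
    then have "y - u = (1 - inverse (norm y)) *\<^sub>R y"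
      by (simp add: u_def scaleR_left_diff_distrib)
    then have "dist y u = \<bar>(1 - inverse (norm y)) * norm y\<bar>"
      by (simp add: dist_norm abs_mult)
    then show ?thesis using False by (simp add: left_diff_distrib)
  qed (use b in \<open>simp add: u_def\<close>)
  ultimately show "infdist y (sphere 0 1) \<le> \<bar>norm y - 1\<bar>" using infdist_le by metis
  then have ne: "sphere (0::'a) 1 \<noteq> {}" using \<open>u \<in> sphere 0 1\<close> by blast
  obtain z where "z \<in> sphere 0 1" "infdist y (sphere 0 1) = dist y z"
    using infdist_attains_inf[OF closed_sphere ne] by metis
  then show "\<bar>norm y - 1\<bar> \<le> infdist y (sphere 0 1)"
    using norm_triangle_ineq3[of y z] by (simp add: dist_norm)
qed

lemma nn_integral_abs_between_squares:
  assumes "0 \<le> a" "a \<le> b"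
  shows "(\<integral>\<^sup>+t. ennreal \<bar>t\<bar> * indicator {t. a < t\<^sup>2 \<and> t\<^sup>2 < b} t \<partial>lborel) = ennreal (b - a)"
proof -
  let ?I = "{sqrt a..sqrt b}"
  have half: "(\<integral>\<^sup>+t. ennreal \<bar>t\<bar> * indicator ?I t \<partial>lborel) = ennreal ((b - a) / 2)"
  proof -
    have "(\<integral>\<^sup>+t. ennreal \<bar>t\<bar> * indicator ?I t \<partial>lborel) = ennreal ((sqrt b)\<^sup>2 / 2 - (sqrt a)\<^sup>2 / 2)"
    proof (rule nn_integral_FTC_Icc)
      show "((\<lambda>t. t\<^sup>2 / 2) has_real_derivative \<bar>t\<bar>) (at t)" if "t \<in> ?I" for t
      proof -
        have "t \<ge> 0" using that assms by (auto intro: order.trans[of 0 "sqrt a"])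
        then show ?thesis by (auto intro!: derivative_eq_intros)
      qed
    qed (use assms in auto)
    then show ?thesis using assms by (simp add: diff_divide_distrib)
  qed
  have half': "(\<integral>\<^sup>+t. ennreal \<bar>t\<bar> * indicator ?I (- t) \<partial>lborel) = ennreal ((b - a) / 2)"
    using nn_integral_real_affine[of "\<lambda>t. ennreal \<bar>t\<bar> * indicator ?I t" "-1" 0] half by simp
  have "AE t in lborel. t \<noteq> s" for s :: real by (rule AE_lborel_singleton)
  from this[of "sqrt a"] this[of "sqrt b"] this[of "- sqrt a"] this[of "- sqrt b"] this[of 0]
  have "AE t in lborel. ennreal \<bar>t\<bar> * indicator {t. a < t\<^sup>2 \<and> t\<^sup>2 < b} t =
      ennreal \<bar>t\<bar> * indicator ?I t + ennreal \<bar>t\<bar> * indicator ?I (- t)"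
  proof eventually_elim
    fix t :: real assume t: "t \<noteq> sqrt a" "t \<noteq> sqrt b" "t \<noteq> - sqrt a" "t \<noteq> - sqrt b" "t \<noteq> 0"
    have sq: "a < t\<^sup>2 \<longleftrightarrow> sqrt a < \<bar>t\<bar>" "t\<^sup>2 < b \<longleftrightarrow> \<bar>t\<bar> < sqrt b"
      by (metis real_sqrt_abs real_sqrt_less_iff)+
    have "0 \<le> sqrt a" using assms by simp
    then have "a < t\<^sup>2 \<and> t\<^sup>2 < b \<longleftrightarrow> t \<in> ?I \<or> - t \<in> ?I" "\<not> (t \<in> ?I \<and> - t \<in> ?I)"
      unfolding sq atLeastAtMost_iff using t by linarith+
    then show "ennreal \<bar>t\<bar> * indicator {t. a < t\<^sup>2 \<and> t\<^sup>2 < b} t =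
        ennreal \<bar>t\<bar> * indicator ?I t + ennreal \<bar>t\<bar> * indicator ?I (- t)"
      by (cases "t \<in> ?I"; cases "- t \<in> ?I") (simp_all add: indicator_def)
  qed
  then have "(\<integral>\<^sup>+t. ennreal \<bar>t\<bar> * indicator {t. a < t\<^sup>2 \<and> t\<^sup>2 < b} t \<partial>lborel) =
      (\<integral>\<^sup>+t. ennreal \<bar>t\<bar> * indicator ?I t + ennreal \<bar>t\<bar> * indicator ?I (- t) \<partial>lborel)"
    by (rule nn_integral_cong_AE)
  also have "\<dots> = ennreal ((b - a) / 2) + ennreal ((b - a) / 2)"
    by (subst nn_integral_add) (auto simp: half half')
  also have "\<dots> = ennreal (b - a)" using assms by (simp flip: ennreal_plus)
  finally show ?thesis .
qed

text \<open>On the line over a point \<open>x\<close> of the hyperplane, the shell of radii \<open>1 - \<epsilon>\<close> and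
  \<open>1 + \<epsilon>\<close> is given by bounds on \<open>t\<^sup>2\<close>. The weight \<open>\<bar>t\<bar>\<close> therefore integrates to exactly
  \<open>4 \<epsilon>\<close> if \<open>x\<close> lies in the inner disc, to at most \<open>4 \<epsilon>\<close> in the outer disc, and to zero beyond. The
  truncation at \<open>2\<close> makes the weight bounded without changing it on the shell.\<close>

lemma tube_mean_sphere_bounds:
  fixes b :: "'a::euclidean_space"
  assumes b: "b \<in> Basis" and \<epsilon>: "0 < \<epsilon>" "\<epsilon> < 1"
  shows "ennreal (2 * (unit_ball_vol (real (DIM('a) - 1)) * (1 - \<epsilon>) ^ (DIM('a) - 1)))
      \<le> tube_mean (sphere 0 1) (\<lambda>y. min \<bar>y \<bullet> b\<bar> 2) \<epsilon>" (is ?lower)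
    and "tube_mean (sphere 0 1) (\<lambda>y. min \<bar>y \<bullet> b\<bar> 2) \<epsilon>
      \<le> ennreal (2 * (unit_ball_vol (real (DIM('a) - 1)) * (1 + \<epsilon>) ^ (DIM('a) - 1)))" (is ?upper)
proof -
  let ?H = "hyperplane_lborel b" and ?c = "ennreal (1 / (2 * \<epsilon>))"
  define A where "A = {y::'a. 1 - \<epsilon> < norm y \<and> norm y < 1 + \<epsilon>}"
  have [measurable]: "A \<in> sets borel" unfolding A_def by measurable
  define J where "J x = (\<integral>\<^sup>+t. ennreal \<bar>t\<bar> * indicator {t. (1 - \<epsilon>)\<^sup>2 - (norm x)\<^sup>2 < t\<^sup>2 \<and> t\<^sup>2 < (1 + \<epsilon>)\<^sup>2 - (norm x)\<^sup>2} t \<partial>lborel)"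
    for x :: 'a
  have "tube_mean (sphere 0 1) (\<lambda>y. min \<bar>y \<bullet> b\<bar> 2) \<epsilon> = (\<integral>\<^sup>+y. ?c * (ennreal \<bar>y \<bullet> b\<bar> * indicator A y) \<partial>lborel)"
    unfolding tube_mean_def
  proof (intro nn_integral_cong)
    fix y :: 'a
    have "\<bar>y \<bullet> b\<bar> \<le> norm y" by (rule Basis_le_norm[OF b])
    then show "?c * (ennreal (min \<bar>y \<bullet> b\<bar> 2) * indicator {y. infdist y (sphere 0 1) < \<epsilon>} y) =
        ?c * (ennreal \<bar>y \<bullet> b\<bar> * indicator A y)"
      using \<epsilon> by (auto simp: infdist_unit_sphere A_def indicator_def abs_less_iff min_def)
  qed
  also have "\<dots> = (\<integral>\<^sup>+x. \<integral>\<^sup>+t. ?c * (ennreal \<bar>(x + t *\<^sub>R b) \<bullet> b\<bar> * indicator A (x + t *\<^sub>R b)) \<partial>lborel \<partial>?H)"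
    by (rule nn_integral_lborel_hyperplane[OF b]) measurable
  also have "\<dots> = (\<integral>\<^sup>+x. ?c * J x \<partial>?H)"
  proof (rule nn_integral_cong_AE, rule eventually_mono[OF AE_hyperplane_lborel[OF b]])
    fix x :: 'a assume x: "x \<bullet> b = 0"
    have "x + t *\<^sub>R b \<in> A \<longleftrightarrow> (1 - \<epsilon>)\<^sup>2 - (norm x)\<^sup>2 < t\<^sup>2 \<and> t\<^sup>2 < (1 + \<epsilon>)\<^sup>2 - (norm x)\<^sup>2" for t
    proof -
      have "(norm (x + t *\<^sub>R b))\<^sup>2 = (norm x)\<^sup>2 + t\<^sup>2"
        using x b inner_commute[of b x] unfolding power2_norm_eq_inner
        by (simp add: inner_add_left inner_add_right power2_eq_square)
      moreover have "1 - \<epsilon> < norm (x + t *\<^sub>R b) \<longleftrightarrow> (1 - \<epsilon>)\<^sup>2 < (norm (x + t *\<^sub>R b))\<^sup>2"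
        "norm (x + t *\<^sub>R b) < 1 + \<epsilon> \<longleftrightarrow> (norm (x + t *\<^sub>R b))\<^sup>2 < (1 + \<epsilon>)\<^sup>2"
        using \<epsilon> by (auto intro!: power_strict_mono dest: power_less_imp_less_base)
      ultimately show ?thesis by (auto simp: A_def)
    qed
    moreover have "(x + t *\<^sub>R b) \<bullet> b = t" for t using x b by (simp add: inner_add_left)
    ultimately show "(\<integral>\<^sup>+t. ?c * (ennreal \<bar>(x + t *\<^sub>R b) \<bullet> b\<bar> * indicator A (x + t *\<^sub>R b)) \<partial>lborel) = ?c * J x"
      unfolding J_def by (subst nn_integral_cmult[symmetric]) (auto simp: indicator_def intro!: nn_integral_cong)
  qed
  finally have tm: "tube_mean (sphere 0 1) (\<lambda>y. min \<bar>y \<bullet> b\<bar> 2) \<epsilon> = (\<integral>\<^sup>+x. ?c * J x \<partial>?H)" .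
  have four: "(1 + \<epsilon>)\<^sup>2 - (1 - \<epsilon>)\<^sup>2 = 4 * \<epsilon>" by (simp add: power2_eq_square algebra_simps)
  have c4: "?c * ennreal (4 * \<epsilon>) = 2" using \<epsilon> by (simp flip: ennreal_mult)
  have low: "2 * indicator (cball 0 (1 - \<epsilon>)) x \<le> ?c * J x" for x
  proof (cases "x \<in> cball 0 (1 - \<epsilon>)")
    case True
    then have "(norm x)\<^sup>2 \<le> (1 - \<epsilon>)\<^sup>2" by (intro power_mono) auto
    then have "J x = ennreal (4 * \<epsilon>)"
      unfolding J_def using \<epsilon> four by (subst nn_integral_abs_between_squares) auto
    then show ?thesis using True c4 by simp
  qed simp
  have upp: "?c * J x \<le> 2 * indicator (cball 0 (1 + \<epsilon>)) x" for x
  proof (cases "x \<in> cball 0 (1 + \<epsilon>)")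
    case True
    \<comment> \<open>Over the rim between the discs the lower bound on \<open>t\<^sup>2\<close> is negative and is replaced by zero.\<close>
    define a where "a = max 0 ((1 - \<epsilon>)\<^sup>2 - (norm x)\<^sup>2)"
    have "(norm x)\<^sup>2 \<le> (1 + \<epsilon>)\<^sup>2" using True by (intro power_mono) auto
    then have a: "0 \<le> a" "a \<le> (1 + \<epsilon>)\<^sup>2 - (norm x)\<^sup>2" "(1 + \<epsilon>)\<^sup>2 - (norm x)\<^sup>2 - a \<le> 4 * \<epsilon>"
      using four \<epsilon> by (auto simp: a_def)
    have "J x \<le> (\<integral>\<^sup>+t. ennreal \<bar>t\<bar> * indicator {t. a < t\<^sup>2 \<and> t\<^sup>2 < (1 + \<epsilon>)\<^sup>2 - (norm x)\<^sup>2} t \<partial>lborel)"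
      unfolding J_def by (intro nn_integral_mono) (auto simp: indicator_def a_def)
    also have "\<dots> = ennreal ((1 + \<epsilon>)\<^sup>2 - (norm x)\<^sup>2 - a)" using a by (intro nn_integral_abs_between_squares)
    also have "\<dots> \<le> ennreal (4 * \<epsilon>)" using a by (intro ennreal_leI)
    finally have "?c * J x \<le> ?c * ennreal (4 * \<epsilon>)" by (rule mult_left_mono) simp
    then show ?thesis using True c4 by simp
  next
    case False
    then have "(1 + \<epsilon>)\<^sup>2 \<le> (norm x)\<^sup>2" using \<epsilon> by (intro power_mono) auto
    then have "indicator {t. (1 - \<epsilon>)\<^sup>2 - (norm x)\<^sup>2 < t\<^sup>2 \<and> t\<^sup>2 < (1 + \<epsilon>)\<^sup>2 - (norm x)\<^sup>2} t = (0::ennreal)" for t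
    proof -
      have "\<not> t\<^sup>2 < (1 + \<epsilon>)\<^sup>2 - (norm x)\<^sup>2"
        using zero_le_power2[of t] \<open>(1 + \<epsilon>)\<^sup>2 \<le> (norm x)\<^sup>2\<close> by linarith
      then show ?thesis by simp
    qed
    then show ?thesis by (simp add: J_def)
  qed
  have disc: "(\<integral>\<^sup>+x. 2 * indicator (cball 0 r) x \<partial>?H) =
      ennreal (2 * (unit_ball_vol (real (DIM('a) - 1)) * r ^ (DIM('a) - 1)))" if "r > 0" for r
    using that emeasure_hyperplane_lborel_cball[OF b that]
    by (simp add: nn_integral_cmult_indicator ennreal_mult unit_ball_vol_nonneg)
  have "(\<integral>\<^sup>+x. 2 * indicator (cball 0 (1 - \<epsilon>)) x \<partial>?H) \<le> (\<integral>\<^sup>+x. ?c * J x \<partial>?H)"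
    by (intro nn_integral_mono low)
  then show ?lower unfolding tm by (subst (asm) disc) (use \<epsilon> in auto)
  have "(\<integral>\<^sup>+x. ?c * J x \<partial>?H) \<le> (\<integral>\<^sup>+x. 2 * indicator (cball 0 (1 + \<epsilon>)) x \<partial>?H)"
    by (intro nn_integral_mono upp)
  then show ?upper unfolding tm by (subst (asm) disc) (use \<epsilon> in auto)
qed

lemma minkowski_sphere: "minkowski_measure (sphere (0::'a::euclidean_space) 1) (area_measure (sphere 0 1))"
proof (rule area_measure_minkowski[OF smooth_hypersurface_sphere])
  obtain b :: 'a where "b \<in> Basis" using nonempty_Basis by blast
  then have "b \<in> sphere 0 1" by simp
  then show "sphere (0::'a) 1 \<noteq> {}" by blast
qed simp

lemma minkowski_sphere_tendsto:
  fixes n :: "'a::euclidean_space"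
  shows "(tube_mean (sphere 0 1) (\<lambda>y. min \<bar>y \<bullet> n\<bar> 2) \<longlongrightarrow>
     (\<integral>\<^sup>+u. ennreal (min \<bar>u \<bullet> n\<bar> 2) \<partial>area_measure (sphere 0 1))) (at_right 0)"
proof -
  have "continuous_on UNIV (\<lambda>y. min \<bar>y \<bullet> n\<bar> 2)" by (intro continuous_intros)
  then have "(\<lambda>y. min \<bar>y \<bullet> n\<bar> 2) \<in> borel_measurable borel" "\<forall>p\<in>sphere 0 1. isCont (\<lambda>y. min \<bar>y \<bullet> n\<bar> 2) p"
    by (auto intro: borel_measurable_continuous_onI simp: continuous_on_eq_continuous_at)
  moreover have "\<forall>y. 0 \<le> min \<bar>y \<bullet> n\<bar> 2 \<and> min \<bar>y \<bullet> n\<bar> 2 \<le> 2" by auto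
  ultimately show ?thesis using minkowski_sphere[where 'a='a] unfolding minkowski_measure_def by blast
qed

lemma nn_integral_sphere_abs_inner_Basis:
  fixes b :: "'a::euclidean_space"
  assumes b: "b \<in> Basis"
  shows "(\<integral>\<^sup>+u. ennreal (min \<bar>u \<bullet> b\<bar> 2) \<partial>area_measure (sphere 0 1)) =
    ennreal (2 * unit_ball_vol (real (DIM('a) - 1)))"
proof (rule tendsto_unique[OF _ minkowski_sphere_tendsto])
  let ?v = "unit_ball_vol (real (DIM('a) - 1))" and ?k = "DIM('a) - 1"
  have ev: "\<forall>\<^sub>F \<epsilon> in at_right 0. \<epsilon> \<in> {0<..<1::real}" by (rule eventually_at_right_real) simp
  have lim: "((\<lambda>\<epsilon>. ennreal (2 * (?v * (1 + s * \<epsilon>) ^ ?k))) \<longlongrightarrow> ennreal (2 * (?v * (1 + s * 0) ^ ?k))) (at_right 0)"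
    for s :: real
    by (intro tendsto_ennrealI tendsto_intros)
  show "(tube_mean (sphere 0 1) (\<lambda>y. min \<bar>y \<bullet> b\<bar> 2) \<longlongrightarrow> ennreal (2 * ?v)) (at_right 0)"
  proof (rule tendsto_sandwich)
    show "\<forall>\<^sub>F \<epsilon> in at_right 0. ennreal (2 * (?v * (1 + (- 1) * \<epsilon>) ^ ?k))
        \<le> tube_mean (sphere 0 1) (\<lambda>y. min \<bar>y \<bullet> b\<bar> 2) \<epsilon>"
      using ev by (rule eventually_mono) (use tube_mean_sphere_bounds(1)[OF b] in simp)
    show "\<forall>\<^sub>F \<epsilon> in at_right 0. tube_mean (sphere 0 1) (\<lambda>y. min \<bar>y \<bullet> b\<bar> 2) \<epsilon>
        \<le> ennreal (2 * (?v * (1 + 1 * \<epsilon>) ^ ?k))"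
      using ev by (rule eventually_mono) (use tube_mean_sphere_bounds(2)[OF b] in simp)
    show "((\<lambda>\<epsilon>. ennreal (2 * (?v * (1 + (- 1) * \<epsilon>) ^ ?k))) \<longlongrightarrow> ennreal (2 * ?v)) (at_right 0)"
      using lim[of "-1"] by simp
    show "((\<lambda>\<epsilon>. ennreal (2 * (?v * (1 + 1 * \<epsilon>) ^ ?k))) \<longlongrightarrow> ennreal (2 * ?v)) (at_right 0)"
      using lim[of 1] by simp
  qed
qed simp

text \<open>A rotation that takes a basis vector to \<open>n\<close> preserves the shells and Lebesgue measure, hence the
  tube integrals and their limit.\<close>

lemma nn_integral_sphere_abs_inner:
  fixes n :: "real ^ 'n"
  assumes n: "norm n = 1"
  shows "(\<integral>\<^sup>+u. ennreal (min \<bar>u \<bullet> n\<bar> 2) \<partial>area_measure (sphere 0 1)) =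
    ennreal (2 * unit_ball_vol (real (CARD('n) - 1)))"
proof -
  obtain b :: "real ^ 'n" where b: "b \<in> Basis" using nonempty_Basis by blast
  obtain T where T: "orthogonal_transformation T" "T b = n"
    using orthogonal_transformation_exists_1[of b n] b n by auto
  have [measurable]: "T \<in> borel_measurable borel"
    using orthogonal_transformation_linear[OF T(1)]
    by (intro borel_measurable_continuous_onI linear_continuous_on linear_conv_bounded_linear[THEN iffD1])
  have "tube_mean (sphere 0 1) (\<lambda>y. min \<bar>y \<bullet> n\<bar> 2) \<epsilon> = tube_mean (sphere 0 1) (\<lambda>y. min \<bar>y \<bullet> b\<bar> 2) \<epsilon>" for \<epsilon>
  proof -
    have "T y \<bullet> n = y \<bullet> b" for y
      using T unfolding orthogonal_transformation_def by metis
    moreover have "norm (T y) = norm y" for y by (rule orthogonal_transformation_norm[OF T(1)])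
    ultimately show ?thesis
      unfolding tube_mean_def infdist_unit_sphere
      by (subst lborel_distr_orthogonal_transformation[OF T(1), symmetric])
        (simp add: nn_integral_distr indicator_def)
  qed
  then have "tube_mean (sphere 0 1) (\<lambda>y. min \<bar>y \<bullet> n\<bar> 2) = tube_mean (sphere 0 1) (\<lambda>y. min \<bar>y \<bullet> b\<bar> 2)"
    by (rule ext)
  with minkowski_sphere_tendsto[of n]
  have "(tube_mean (sphere 0 1) (\<lambda>y. min \<bar>y \<bullet> b\<bar> 2) \<longlongrightarrow>
      (\<integral>\<^sup>+u. ennreal (min \<bar>u \<bullet> n\<bar> 2) \<partial>area_measure (sphere 0 1))) (at_right 0)" by simp
  then have "(\<integral>\<^sup>+u. ennreal (min \<bar>u \<bullet> n\<bar> 2) \<partial>area_measure (sphere 0 1)) =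
      (\<integral>\<^sup>+u. ennreal (min \<bar>u \<bullet> b\<bar> 2) \<partial>area_measure (sphere 0 1))"
    using minkowski_sphere_tendsto[of b] by (rule tendsto_unique[rotated]) simp
  then show ?thesis using nn_integral_sphere_abs_inner_Basis[OF b] by simp
qed

section \<open>The tube formula\<close>

lemma integral_sphere_abs_inner:
  fixes n :: "real ^ 'n"
  assumes n: "norm n = 1"
  shows "(LINT u|area_measure (sphere 0 1). indicator (sphere 0 1) u * \<bar>u \<bullet> n\<bar>) =
    2 * unit_ball_vol (real (CARD('n) - 1))"
proof -
  let ?\<sigma> = "area_measure (sphere (0 :: real ^ 'n) 1)"
  have sets [measurable_cong]: "sets ?\<sigma> = sets borel" and null: "emeasure ?\<sigma> (- sphere 0 1) = 0"
    using minkowski_sphere[where 'a="real ^ 'n"] by (auto simp: minkowski_measure_def)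
  have "- sphere 0 1 \<in> null_sets ?\<sigma>"
    using null sets by (auto simp: null_sets_def borel_comp)
  then have "AE u in ?\<sigma>. ennreal (indicator (sphere 0 1) u * \<bar>u \<bullet> n\<bar>) = ennreal (min \<bar>u \<bullet> n\<bar> 2)"
  proof (rule AE_not_in[THEN eventually_mono])
    fix u :: "real ^ 'n" assume "u \<notin> - sphere 0 1"
    then have "u \<in> sphere 0 1" "\<bar>u \<bullet> n\<bar> \<le> 1" using Cauchy_Schwarz_ineq2[of u n] n by auto
    then show "ennreal (indicator (sphere 0 1) u * \<bar>u \<bullet> n\<bar>) = ennreal (min \<bar>u \<bullet> n\<bar> 2)"
      by (simp add: min_def)
  qed
  then have "(\<integral>\<^sup>+u. ennreal (indicator (sphere 0 1) u * \<bar>u \<bullet> n\<bar>) \<partial>?\<sigma>) =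
      ennreal (2 * unit_ball_vol (real (CARD('n) - 1)))"
    unfolding nn_integral_sphere_abs_inner[OF n, symmetric] by (rule nn_integral_cong_AE)
  moreover have [measurable]: "sphere (0 :: real ^ 'n) 1 \<in> sets borel" by (simp add: borel_closed)
  have "(\<lambda>u. indicator (sphere 0 1) u * \<bar>u \<bullet> n\<bar>) \<in> borel_measurable ?\<sigma>" by measurable
  ultimately show ?thesis
    by (simp add: integral_eq_nn_integral unit_ball_vol_nonneg)
qed

text \<open>Fubini exchanges the two surface integrals; the inner integral over directions no longer depends
  on the normal.\<close>

lemma integral_weighted_projected_area:
  fixes K :: "(real ^ 'n) set"
  assumes bd: "compact (manifold_boundary K)" "manifold_boundary K \<noteq> {}"
  shows "(LINT u:sphere 0 1|area_measure (sphere 0 1). weighted_projected_area K u) =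
    unit_ball_vol (real (CARD('n) - 1)) * measure (area_measure (manifold_boundary K)) UNIV"
proof -
  let ?S = "manifold_boundary K" and ?B = "sphere (0 :: real ^ 'n) 1"
  define \<sigma> where "\<sigma> = area_measure ?S"
  define \<rho> where "\<rho> = area_measure ?B"
  have \<sigma>: "minkowski_measure ?S \<sigma>"
    unfolding \<sigma>_def using smooth_hypersurface_manifold_boundary bd by (intro area_measure_minkowski)
  have \<rho>: "minkowski_measure ?B \<rho>" unfolding \<rho>_def by (rule minkowski_sphere)
  have sets [measurable_cong]: "sets \<sigma> = sets borel" "sets \<rho> = sets borel"
    using \<sigma> \<rho> by (auto simp: minkowski_measure_def)
  have space: "space \<sigma> = UNIV" "space \<rho> = UNIV"
    using sets_eq_imp_space_eq[OF sets(1)] sets_eq_imp_space_eq[OF sets(2)] by auto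
  interpret \<sigma>: finite_measure \<sigma>
    using \<sigma> by (intro finite_measureI) (auto simp: minkowski_measure_def space)
  interpret \<rho>: finite_measure \<rho>
    using \<rho> by (intro finite_measureI) (auto simp: minkowski_measure_def space)
  interpret pair_sigma_finite \<rho> \<sigma> by standard
  interpret P: finite_measure "\<rho> \<Otimes>\<^sub>M \<sigma>"
    by (intro finite_measure_pair_measure) unfold_locales
  have Sm [measurable]: "?S \<in> sets borel" using bd(1) by (intro borel_closed compact_imp_closed)
  \<comment> \<open>The outward normal is cut off outside the boundary, where its definition says nothing, to obtain a
    Borel function.\<close>
  define m where "m q = indicator ?S q *\<^sub>R outward_unit_normal K q" for q
  have [measurable]: "m \<in> borel_measurable borel"
    unfolding m_def by (rule borel_measurable_continuous_on_indicator[OF Sm continuous_on_outward_unit_normal])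
  have m1: "norm (m q) = indicator ?S q" for q
    by (simp add: m_def norm_outward_unit_normal indicator_def)
  define f where "f u q = indicator ?B u * \<bar>u \<bullet> m q\<bar>" for u q
  have "integrable (\<rho> \<Otimes>\<^sub>M \<sigma>) (case_prod f)"
  proof (rule P.integrable_const_bound[where B=1])
    have "norm (f u q) \<le> 1" for u q
    proof (cases "u \<in> ?B")
      case True
      have "\<bar>u \<bullet> m q\<bar> \<le> norm u * norm (m q)" by (rule Cauchy_Schwarz_ineq2)
      also have "\<dots> \<le> 1" using True by (simp add: m1 indicator_def)
      finally show ?thesis using True by (simp add: f_def)
    qed (simp add: f_def)
    then have "norm (case_prod f x) \<le> 1" for x by (simp add: case_prod_beta')
    then show "AE x in \<rho> \<Otimes>\<^sub>M \<sigma>. norm (case_prod f x) \<le> 1" by simp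
    have [measurable]: "?B \<in> sets borel" by (simp add: borel_closed)
    have "(\<lambda>x. f (fst x) (snd x)) \<in> borel_measurable (borel \<Otimes>\<^sub>M borel)" unfolding f_def by measurable
    then have "(\<lambda>x. f (fst x) (snd x)) \<in> borel_measurable (\<rho> \<Otimes>\<^sub>M \<sigma>)"
      using measurable_cong_sets[OF sets_pair_measure_cong[OF sets(2) sets(1)] refl] by blast
    then show "case_prod f \<in> borel_measurable (\<rho> \<Otimes>\<^sub>M \<sigma>)" by (simp add: case_prod_beta')
  qed
  then have fub: "(LINT q|\<sigma>. LINT u|\<rho>. f u q) = (LINT u|\<rho>. LINT q|\<sigma>. f u q)"
    by (rule Fubini_integral)
  have "(LINT u:?B|\<rho>. weighted_projected_area K u) = (LINT u|\<rho>. 1 / 2 * (LINT q|\<sigma>. f u q))"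
  proof -
    have "indicator ?S q *\<^sub>R \<bar>u \<bullet> outward_unit_normal K q\<bar> = \<bar>u \<bullet> m q\<bar>" for u q
      by (simp add: m_def indicator_def)
    then have w: "weighted_projected_area K u = 1 / 2 * (LINT q|\<sigma>. \<bar>u \<bullet> m q\<bar>)" for u
      unfolding weighted_projected_area_def set_lebesgue_integral_def \<sigma>_def by simp
    have "indicator ?B u *\<^sub>R weighted_projected_area K u = 1 / 2 * (LINT q|\<sigma>. f u q)" for u
      unfolding w f_def by simp
    then show ?thesis by (simp only: set_lebesgue_integral_def)
  qed
  also have "\<dots> = 1 / 2 * (LINT q|\<sigma>. LINT u|\<rho>. f u q)" by (simp add: fub)
  also have "(LINT q|\<sigma>. LINT u|\<rho>. f u q) =
      (LINT q|\<sigma>. indicator ?S q * (2 * unit_ball_vol (real (CARD('n) - 1))))"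
  proof (rule Bochner_Integration.integral_cong[OF refl])
    fix q
    show "(LINT u|\<rho>. f u q) = indicator ?S q * (2 * unit_ball_vol (real (CARD('n) - 1)))"
    proof (cases "q \<in> ?S")
      case True
      then show ?thesis
        using integral_sphere_abs_inner[of "m q"] m1[of q] by (simp add: f_def \<rho>_def)
    next
      case False
      then show ?thesis by (simp add: f_def m_def)
    qed
  qed
  also have "1 / 2 * \<dots> = unit_ball_vol (real (CARD('n) - 1)) * measure \<sigma> ?S"
    by (simp add: space)
  also have "measure \<sigma> ?S = measure \<sigma> UNIV"
    using \<sigma> sets Sm by (intro measure_eq_AE) (auto simp: minkowski_measure_def null_sets_def space borel_comp
        intro!: AE_not_in[THEN eventually_mono, of "- ?S"])
  finally show ?thesis by (simp add: \<sigma>_def \<rho>_def)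
qed

lemma tube_volume_tendsto_area:
  fixes S :: "'a::euclidean_space set"
  assumes S: "smooth_hypersurface S" "compact S" "S \<noteq> {}"
  shows "((\<lambda>\<epsilon>. measure lebesgue (Tub \<epsilon> S) / (2 * \<epsilon>)) \<longlongrightarrow> measure (area_measure S) UNIV) (at_right 0)"
proof -
  let ?\<sigma> = "area_measure S"
  have \<sigma>: "minkowski_measure S ?\<sigma>" by (rule area_measure_minkowski[OF S])
  then have fin: "emeasure ?\<sigma> UNIV < \<infinity>" and sets: "sets ?\<sigma> = sets borel" by (auto simp: minkowski_measure_def)
  have "(tube_mean S (\<lambda>_. 1) \<longlongrightarrow> (\<integral>\<^sup>+y. ennreal 1 \<partial>?\<sigma>)) (at_right 0)"
    using \<sigma> unfolding minkowski_measure_def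
    by (elim conjE allE[of _ "\<lambda>_. 1"] allE[of _ 1]) auto
  also have "(\<integral>\<^sup>+y. ennreal 1 \<partial>?\<sigma>) = ennreal (measure ?\<sigma> UNIV)"
    using fin sets_eq_imp_space_eq[OF sets] by (simp add: emeasure_eq_ennreal_measure less_top)
  finally have lim: "((\<lambda>\<epsilon>. enn2real (tube_mean S (\<lambda>_. 1) \<epsilon>)) \<longlongrightarrow> measure ?\<sigma> UNIV) (at_right 0)"
    by (rule tendsto_enn2real) simp
  have "enn2real (tube_mean S (\<lambda>_. 1) \<epsilon>) = measure lebesgue (Tub \<epsilon> S) / (2 * \<epsilon>)" if "\<epsilon> > 0" for \<epsilon>
  proof -
    have [measurable]: "{y. infdist y S < \<epsilon>} \<in> sets borel"
      by (intro borel_open open_Collect_less continuous_intros)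
    have "tube_mean S (\<lambda>_. 1) \<epsilon> = ennreal (1 / (2 * \<epsilon>)) * emeasure lborel {y. infdist y S < \<epsilon>}"
      unfolding tube_mean_def by (simp add: nn_integral_cmult_indicator)
    moreover have "emeasure lebesgue {y. infdist y S < \<epsilon>} = emeasure lborel {y. infdist y S < \<epsilon>}"
      by simp
    ultimately show ?thesis
      using that unfolding Tub_eq_infdist[OF compact_imp_closed[OF S(2)] S(3)]
      by (simp add: enn2real_mult measure_def)
  qed
  then have "\<forall>\<^sub>F \<epsilon> in at_right 0. enn2real (tube_mean S (\<lambda>_. 1) \<epsilon>) = measure lebesgue (Tub \<epsilon> S) / (2 * \<epsilon>)"
    using eventually_at_right_less[of 0] by (rule eventually_mono[rotated])
  with lim show ?thesis by (rule Lim_transform_eventually)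
qed

theorem proposition1:
  fixes K :: "(real ^ 'n) set"
  assumes "compact K" and "full_dim_submanifold_with_boundary K"
  shows "((\<lambda>\<epsilon>. measure lebesgue (Tub \<epsilon> (manifold_boundary K)) / (2 * \<epsilon>)) \<longlongrightarrow>
     1 / unit_ball_vol (real (CARD('n) - 1)) *
       (LINT u:sphere 0 1|area_measure (sphere 0 1). weighted_projected_area K u)) (at_right 0)"
proof (cases "manifold_boundary K = {}")
  case True
  then have "weighted_projected_area K u = 0" for u
    by (simp add: weighted_projected_area_def set_lebesgue_integral_def)
  moreover have "Tub \<epsilon> (manifold_boundary K) = {}" for \<epsilon> using True by (simp add: Tub_def)
  ultimately show ?thesis by (simp add: set_lebesgue_integral_def)
next
  case False
  have bd: "compact (manifold_boundary K)" by (rule compact_manifold_boundary[OF assms])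
  define v where "v = unit_ball_vol (real (CARD('n) - 1))"
  have "v > 0" unfolding v_def by (rule unit_ball_vol_pos) simp
  then show ?thesis
    using tube_volume_tendsto_area[OF smooth_hypersurface_manifold_boundary bd False]
    unfolding integral_weighted_projected_area[OF bd False] v_def[symmetric] by simp
qed

end
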